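(* Let $K\ge 2$, $M\ge 2$ and $x\ge 1$. Define $$L_{\mathrm{P2}}(x)= \frac{\pi^{2}}{16}\frac{\underline{C}^{2}}{\overline{C}_{\mathrm{SN}}^{2}}\frac{K}{M^{2}}\; \frac{\max\left[0,\,1-\frac{8}{\underline{C}\pi}\sqrt{\frac{M}{K}}\,x\right]^{2}}{\frac{\overline{C}^{2}}{\overline{C}_{\mathrm{SN}}^{2}}+\frac{4}{\overline{C}_{\mathrm{SN}}^{2}}\frac{x}{\min[\sqrt{M},\sqrt{K}]}+\frac{\sigma^{2}}{\overline{C}_{\mathrm{SN}}^{2}}\left(\overline{c}^{2}+2\frac{x}{\sqrt{K}}\right)+\frac{\sigma^{2}}{\overline{C}^{2}_{\mathrm{SN}}}},$$ $$U_{\mathrm{P2}}(x)= \frac{\pi^{2}}{16}\frac{\overline{C}^{2}}{\underline{C}_{\mathrm{SN}}^{2}}\frac{K}{M^{2}}\; \frac{\left(1+\frac{8}{\overline{C}\pi}\sqrt{\frac{M}{K}}\,x\right)^{2}}{\max\left[0,\,\frac{\underline{C}^{2}}{\underline{C}_{\mathrm{SN}}^{2}}\frac{M-1}{M}-\frac{4}{\underline{C}_{\mathrm{SN}}^{2}}\frac{x}{\min[\sqrt{M},\sqrt{K}]}\right]+\max\left[0,\,\frac{\sigma^{2}}{\underline{C}_{\mathrm{SN}}^{2}}\left(\underline{c}^{2}-2\frac{x}{\sqrt{K}}\right)\right]+\frac{\sigma^{2}}{\underline{C}^{2}_{\mathrm{SN}}}}.$$ Then for every $m\in\{1,\dots,M\}$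 the probability $P_{\mathrm{P2}}(x)$ of the event $\mathrm{SINR}^{\mathrm{P2}}_{m}\notin[L_{\mathrm{P2}}(x),U_{\mathrm{P2}}(x)]$ satisfies $$P_{\mathrm{P2}}(x)\le 814\,K^{2}M^{3}\,e^{-\Delta_{\mathrm{P2}}\,x^{2/9}},\qquad \Delta_{\mathrm{P2}}=\min\left[2^{-11/5},\ \frac{1}{2^{61/36}\,\overline{C}^{2}},\ \frac{1}{8\,\overline{C}^{4}},\ \frac{1}{4\,\overline{c}^{4}}\right].$$
   Context: Fix constants $0<\underline{E}\le\overline{E}<\infty$, $0<\underline{P}\le\overline{P}<\infty$, $P_{\mathrm{rel}}>0$, $\sigma^2>0$ (independent of $M,K$). For $k\in\{1,\dots,K\}$ (relays) and $m\in\{1,\dots,M\}$ (source-destination pairs) let $E_{k,m}\in[\underline{E},\overline{E}]$ and $P_{m,k}\in[\underline{P},\overline{P}]$ be deterministic. Let $h_{k,m}$, $f_{m,k}$ ($1\le k\le K$, $1\le m\le M$) be jointly independent circularly symmetric complex Gaussian $\mathcal{CN}(0,1)$ random variables (backward and forward channel gains). Put $\tilde h_{k,m}=\exp(j\arg h_{k,m})$, $\tilde f_{m,k}=\exp(j\arg f_{m,k})$. Protocol P2 (no relay partitioning): let $$d_{\mathrm{P2},k}=\sqrt{P_{\mathrm{rel}}}\Big[K\sum_{m=1}^M E_{k,m}+MK\sigma^2\Big]^{-1/2},\quad C^{m,\hat m}_{\mathrm{P2},k}=\sqrt{KM}\,d_{\mathrm{P2},k}\sqrt{P_{m,k}E_{k,\hat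 m}},\quad C^{m}_{\mathrm{P2},k}=\sqrt{KM}\,d_{\mathrm{P2},k}\sqrt{P_{m,k}},$$ $$a_k^{m,\hat m,\tilde m}=C^{m,\hat m}_{\mathrm{P2},k}\,\tilde f^{*}_{\tilde m,k}\,f_{m,k}\,\tilde h^{*}_{k,\tilde m}\,h_{k,\hat m},\qquad b_k^{m,\tilde m}=C^{m}_{\mathrm{P2},k}\,\tilde f^{*}_{\tilde m,k}\,f_{m,k}\,\tilde h^{*}_{k,\tilde m},$$ where $^*$ is complex conjugation. The effective SINR of the $m$th link is $$\mathrm{SINR}^{\mathrm{P2}}_{m}=\frac{\big|\sum_{k=1}^{K}\sum_{\tilde m=1}^{M}a_k^{m,m,\tilde m}\big|^2}{\sum_{\hat m\ne m}\big|\sum_{k=1}^{K}\sum_{\tilde m=1}^{M}a_k^{m,\hat m,\tilde m}\big|^2+\sigma^2M\sum_{k=1}^{K}\big|\sum_{\tilde m=1}^{M}b_k^{m,\tilde m}\big|^2+KM^2\sigma^2}.$$ Constants: $\underline{C}=\sqrt{\underline{P}\,\underline{E}P_{\mathrm{rel}}/(\overline{E}+\sigma^2)}$, $\overline{C}=\sqrt{\overline{P}\,\overline{E}P_{\mathrm{rel}}/(\underline{E}+\sigma^2)}$, $\underline{c}=\sqrt{\underline{P}P_{\mathrm{rel}}/(\overline{E}+\sigma^2)}$, $\overline{c}=\sqrt{\overline{P}P_{\mathrm{rel}}/(\underline{E}+\sigma^2)}$, $\overline{C}_{\mathrm{SN}}=\sqrt{\overline{C}^2+\sigma^2(\overline{c}^2+1)}$,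 $\underline{C}_{\mathrm{SN}}=\sqrt{\underline{C}^2+\sigma^2(\underline{c}^2+1)}$. *)

theory Defs
  imports "HOL-Probability.Probability"
begin

text \<open>
  Relays are indexed by \<open>k \<in> {1..K}\<close> and source-destination pairs by \<open>m \<in> {1..M}\<close>.
  In the definitions below \<open>E k m\<close> and \<open>P m k\<close> are the deterministic
  energies \<open>E\<^sub>k\<^sub>,\<^sub>m\<close> and \<open>P\<^sub>m\<^sub>,\<^sub>k\<close>, and \<open>h k m\<close>, \<open>f m k\<close> are the complex values of the channel gains
  at one outcome. The noise variance is \<open>\<sigma>\<^sup>2\<close>.
\<close>

definition circ_complex_normal :: "'a measure \<Rightarrow> real \<Rightarrow> ('a \<Rightarrow> complex) \<Rightarrow> bool"
  where "circ_complex_normal \<Omega> v Z \<longleftrightarrow>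
    prob_space.indep_var \<Omega> borel (\<lambda>\<omega>. Re (Z \<omega>)) borel (\<lambda>\<omega>. Im (Z \<omega>)) \<and>
    distributed \<Omega> lborel (\<lambda>\<omega>. Re (Z \<omega>)) (normal_density 0 (sqrt (v / 2))) \<and>
    distributed \<Omega> lborel (\<lambda>\<omega>. Im (Z \<omega>)) (normal_density 0 (sqrt (v / 2)))"

text \<open>The phase factor \<open>exp (j arg z)\<close>; at \<open>z = 0\<close>, a null event for the gains, it is \<open>1\<close>.\<close>

definition phase :: "complex \<Rightarrow> complex"
  where "phase z = cis (Arg z)"

definition d_P2 :: "real \<Rightarrow> real \<Rightarrow> nat \<Rightarrow> nat \<Rightarrow> (nat \<Rightarrow> nat \<Rightarrow> real) \<Rightarrow> nat \<Rightarrow> real"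
  where "d_P2 Prel \<sigma> K M E k =
    sqrt Prel * (real K * (\<Sum>m=1..M. E k m) + real M * real K * \<sigma>\<^sup>2) powr (- 1 / 2)"

text \<open>\<open>CS_P2\<close> is the signal coefficient with two upper indices, \<open>CN_P2\<close> the noise coefficient with one.\<close>

definition CS_P2 ::
  "real \<Rightarrow> real \<Rightarrow> nat \<Rightarrow> nat \<Rightarrow> (nat \<Rightarrow> nat \<Rightarrow> real) \<Rightarrow> (nat \<Rightarrow> nat \<Rightarrow> real) \<Rightarrow>
   nat \<Rightarrow> nat \<Rightarrow> nat \<Rightarrow> real"
  where "CS_P2 Prel \<sigma> K M E P m mhat k =
    sqrt (real K * real M) * d_P2 Prel \<sigma> K M E k * sqrt (P m k * E k mhat)"

definition CN_P2 ::
  "real \<Rightarrow> real \<Rightarrow> nat \<Rightarrow> nat \<Rightarrow> (nat \<Rightarrow> nat \<Rightarrow> real) \<Rightarrow> (nat \<Rightarrow> nat \<Rightarrow> real) \<Rightarrow>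
   nat \<Rightarrow> nat \<Rightarrow> real"
  where "CN_P2 Prel \<sigma> K M E P m k =
    sqrt (real K * real M) * d_P2 Prel \<sigma> K M E k * sqrt (P m k)"

definition a_P2 ::
  "real \<Rightarrow> real \<Rightarrow> nat \<Rightarrow> nat \<Rightarrow> (nat \<Rightarrow> nat \<Rightarrow> real) \<Rightarrow> (nat \<Rightarrow> nat \<Rightarrow> real) \<Rightarrow>
   (nat \<Rightarrow> nat \<Rightarrow> complex) \<Rightarrow> (nat \<Rightarrow> nat \<Rightarrow> complex) \<Rightarrow>
   nat \<Rightarrow> nat \<Rightarrow> nat \<Rightarrow> nat \<Rightarrow> complex"
  where "a_P2 Prel \<sigma> K M E P h f m mhat mtil k =
    of_real (CS_P2 Prel \<sigma> K M E P m mhat k) *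
    cnj (phase (f mtil k)) * f m k * cnj (phase (h k mtil)) * h k mhat"

definition b_P2 ::
  "real \<Rightarrow> real \<Rightarrow> nat \<Rightarrow> nat \<Rightarrow> (nat \<Rightarrow> nat \<Rightarrow> real) \<Rightarrow> (nat \<Rightarrow> nat \<Rightarrow> real) \<Rightarrow>
   (nat \<Rightarrow> nat \<Rightarrow> complex) \<Rightarrow> (nat \<Rightarrow> nat \<Rightarrow> complex) \<Rightarrow>
   nat \<Rightarrow> nat \<Rightarrow> nat \<Rightarrow> complex"
  where "b_P2 Prel \<sigma> K M E P h f m mtil k =
    of_real (CN_P2 Prel \<sigma> K M E P m k) *
    cnj (phase (f mtil k)) * f m k * cnj (phase (h k mtil))"

definition SINR_P2 ::
  "real \<Rightarrow> real \<Rightarrow> nat \<Rightarrow> nat \<Rightarrow> (nat \<Rightarrow> nat \<Rightarrow> real) \<Rightarrow> (nat \<Rightarrow> nat \<Rightarrow> real) \<Rightarrow>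
   (nat \<Rightarrow> nat \<Rightarrow> complex) \<Rightarrow> (nat \<Rightarrow> nat \<Rightarrow> complex) \<Rightarrow> nat \<Rightarrow> real"
  where "SINR_P2 Prel \<sigma> K M E P h f m =
    (cmod (\<Sum>k=1..K. \<Sum>mtil=1..M. a_P2 Prel \<sigma> K M E P h f m m mtil k))\<^sup>2 /
    ((\<Sum>mhat\<in>{1..M} - {m}.
        (cmod (\<Sum>k=1..K. \<Sum>mtil=1..M. a_P2 Prel \<sigma> K M E P h f m mhat mtil k))\<^sup>2)
     + \<sigma>\<^sup>2 * real M *
        (\<Sum>k=1..K. (cmod (\<Sum>mtil=1..M. b_P2 Prel \<sigma> K M E P h f m mtil k))\<^sup>2)
     + real K * (real M)\<^sup>2 * \<sigma>\<^sup>2)"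

text \<open>
  The lower and upper constants come from one formula: an underlined constant takes the
  lower bounds in the numerator and the upper energy bound \<open>E'\<close> in the denominator, an overlined
  one the other way round.
\<close>

definition C_const :: "real \<Rightarrow> real \<Rightarrow> real \<Rightarrow> real \<Rightarrow> real \<Rightarrow> real"
  where "C_const Prel \<sigma> P E E' = sqrt (P * E * Prel / (E' + \<sigma>\<^sup>2))"

definition c_const :: "real \<Rightarrow> real \<Rightarrow> real \<Rightarrow> real \<Rightarrow> real"
  where "c_const Prel \<sigma> P E' = sqrt (P * Prel / (E' + \<sigma>\<^sup>2))"

definition C_SN :: "real \<Rightarrow> real \<Rightarrow> real \<Rightarrow> real"
  where "C_SN \<sigma> C c = sqrt (C\<^sup>2 + \<sigma>\<^sup>2 * (c\<^sup>2 + 1))"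

text \<open>
  In \<open>L_P2\<close>, \<open>U_P2\<close> and \<open>Delta_P2\<close> the arguments \<open>Cl\<close>, \<open>cl\<close> are the underlined and
  \<open>Cu\<close>, \<open>cu\<close> the overlined constants.
\<close>

definition L_P2 ::
  "real \<Rightarrow> nat \<Rightarrow> nat \<Rightarrow> real \<Rightarrow> real \<Rightarrow> real \<Rightarrow> real \<Rightarrow> real"
  where "L_P2 \<sigma> K M Cl Cu cu x =
    pi\<^sup>2 / 16 * (Cl\<^sup>2 / (C_SN \<sigma> Cu cu)\<^sup>2) * (real K / (real M)\<^sup>2) *
    ((max 0 (1 - 8 / (Cl * pi) * sqrt (real M / real K) * x))\<^sup>2 /
     (Cu\<^sup>2 / (C_SN \<sigma> Cu cu)\<^sup>2
      + 4 / (C_SN \<sigma> Cu cu)\<^sup>2 * (x / min (sqrt (real M)) (sqrt (real K)))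
      + \<sigma>\<^sup>2 / (C_SN \<sigma> Cu cu)\<^sup>2 * (cu\<^sup>2 + 2 * (x / sqrt (real K)))
      + \<sigma>\<^sup>2 / (C_SN \<sigma> Cu cu)\<^sup>2))"

definition U_P2 ::
  "real \<Rightarrow> nat \<Rightarrow> nat \<Rightarrow> real \<Rightarrow> real \<Rightarrow> real \<Rightarrow> real \<Rightarrow> real"
  where "U_P2 \<sigma> K M Cl Cu cl x =
    pi\<^sup>2 / 16 * (Cu\<^sup>2 / (C_SN \<sigma> Cl cl)\<^sup>2) * (real K / (real M)\<^sup>2) *
    ((1 + 8 / (Cu * pi) * sqrt (real M / real K) * x)\<^sup>2 /
     (max 0 (Cl\<^sup>2 / (C_SN \<sigma> Cl cl)\<^sup>2 * ((real M - 1) / real M)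
             - 4 / (C_SN \<sigma> Cl cl)\<^sup>2 * (x / min (sqrt (real M)) (sqrt (real K))))
      + max 0 (\<sigma>\<^sup>2 / (C_SN \<sigma> Cl cl)\<^sup>2 * (cl\<^sup>2 - 2 * (x / sqrt (real K))))
      + \<sigma>\<^sup>2 / (C_SN \<sigma> Cl cl)\<^sup>2))"

definition Delta_P2 :: "real \<Rightarrow> real \<Rightarrow> real"
  where "Delta_P2 Cu cu =
    Min {2 powr (- 11 / 5), 1 / (2 powr (61 / 36) * Cu\<^sup>2), 1 / (8 * Cu ^ 4), 1 / (4 * cu ^ 4)}"

end

theory Submission
  imports Defs
begin

text \<open>
  Write \<open>G\<^sub>k\<close> for the sum over \<open>m'\<close> of the conjugated phases of \<open>f\<^sub>m\<^sub>'\<^sub>,\<^sub>k h\<^sub>k\<^sub>,\<^sub>m\<^sub>'\<close>. Signal, interference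
  and noise are then built from \<open>f\<^sub>m\<^sub>,\<^sub>k h\<^sub>k\<^sub>,\<^sub>n G\<^sub>k\<close> and \<open>f\<^sub>m\<^sub>,\<^sub>k G\<^sub>k\<close>. The signal, the noise and the diagonal part of the
  interference are sums over \<open>k\<close> of independent terms, which Hoeffding's inequality controls after
  truncation. For the off-diagonal part, flipping \<open>h\<^sub>k\<^sub>,\<^sub>n\<close> and \<open>f\<^sub>n\<^sub>,\<^sub>k\<close> simultaneously preserves the law of
  the gains and every \<open>G\<^sub>k\<close>; conditionally on the gains, the interference terms become squares of
  independent Rademacher sums, and truncated Hoeffding applies once more. With
  \<open>t = \<Delta> x\<^sup>2\<^sup>/\<^sup>9\<close> all deviations are of order \<open>t\<^sup>9\<^sup>/\<^sup>2\<close>, i.e. of order \<open>x\<close>.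
\<close>

section \<open>Hoeffding's inequality for truncated complex variables\<close>

text \<open>The exponent 2/9 comes from counting truncations. A Gaussian gain is cut at order sqrt
  t, \<open>G k\<close> at order sqrt (M t), and each use of Hoeffding's inequality costs another
  sqrt t. The signal then deviates at order t^2, the noise at t^(5/2), the diagonal interference at
  t^(7/2). An off-diagonal term is of order t^(3/2); summing over relays gives t^2, squaring gives
  t^4, and summing over interfering sources gives t^(9/2). The obstacle is that the interference of
  different sources shares \<open>f m k\<close> and \<open>G k\<close>, so independence over sources
  has to be supplied by fresh signs. A sign put on \<open>h k n\<close> also enters
  \<open>G k\<close>; the same sign on \<open>f n k\<close> cancels it there, and since n differs
  from m it touches no other factor. Truncation shifts the means. The shift is a root second moment
  times the square root of a tail probability, so tails of order exp (- 2 t) shift by exp (- t)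
  times a polynomial in K and M. The theorem is trivial unless 814 K^2 M^3 exp (- t) <= 1, and in
  that case these shifts are negligible.\<close>

lemma (in prob_space) Hoeffding_complex:
  fixes X :: "'i \<Rightarrow> 'a \<Rightarrow> complex" and B s :: real
  assumes fin: "finite I" and ind: "indep_vars (\<lambda>_. borel) X I"
    and B: "B > 0" and s: "s \<ge> 0"
    and bound: "\<And>i \<omega>. i \<in> I \<Longrightarrow> \<omega> \<in> space M \<Longrightarrow> cmod (X i \<omega>) \<le> B"
  shows "prob {\<omega> \<in> space M. cmod ((\<Sum>i\<in>I. X i \<omega>) - (\<Sum>i\<in>I. expectation (X i)))
            > 2 * B * sqrt (card I * s)} \<le> 4 * exp (- s)"
proof (cases "I = {}")
  case False
  define n where "n = real (card I)"
  have n: "n > 0" using False fin by (simp add: n_def card_gt_0_iff)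
  have rv[measurable]: "X i \<in> borel_measurable M" if "i \<in> I" for i
    using ind that unfolding indep_vars_def by blast
  have int: "integrable M (X i)" if "i \<in> I" for i
    by (rule integrable_const_bound[where B=B]) (use bound that in auto)
  \<comment> \<open>Real and imaginary part each get this deviation. The range has width 2 B, so the
    exponent 2 u^2 / (4 n B^2) equals s, and two deviations below u keep the modulus below sqrt 2 *
    u, the threshold of the lemma.\<close>
  define u where "u = B * sqrt (2 * n * s)"
  have u: "u \<ge> 0" using B n s by (simp add: u_def)
  have part: "prob {\<omega> \<in> space M. \<bar>(\<Sum>i\<in>I. g (X i \<omega>)) - (\<Sum>i\<in>I. expectation (\<lambda>\<omega>. g (X i \<omega>)))\<bar> \<ge> u}
      \<le> 2 * exp (- s)" (is "?p \<le> _")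
    if g[measurable]: "g \<in> borel_measurable borel" and gb: "\<And>z. \<bar>g z\<bar> \<le> cmod z" for g :: "complex \<Rightarrow> real"
  proof -
    interpret Hoeffding_ineq M I "\<lambda>i \<omega>. g (X i \<omega>)" "\<lambda>_. - B" "\<lambda>_. B"
      "\<Sum>i\<in>I. expectation (\<lambda>\<omega>. g (X i \<omega>))"
    proof unfold_locales
      show "indep_vars (\<lambda>_. borel) (\<lambda>i \<omega>. g (X i \<omega>)) I"
        by (rule indep_vars_compose2[OF ind]) simp
      show "AE x in M. g (X i x) \<in> {- B..B}" if "i \<in> I" for i
        using bound[OF that] gb by (intro AE_I2) (auto simp: abs_le_iff, (smt (verit))+)
    qed (use fin in simp_all)
    have ss: "(\<Sum>i\<in>I. (B - - B)\<^sup>2) = 4 * n * B\<^sup>2"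
      by (simp add: n_def power2_eq_square)
    have "?p \<le> 2 * exp (- 2 * u\<^sup>2 / (\<Sum>i\<in>I. (B - - B)\<^sup>2))"
      by (rule Hoeffding_ineq_abs_ge[OF u]) (unfold ss, use n B in simp)
    also have "- 2 * u\<^sup>2 / (\<Sum>i\<in>I. (B - - B)\<^sup>2) = - s"
      unfolding ss using n B s by (simp add: u_def power_mult_distrib)
    finally show ?thesis .
  qed
  let ?A = "\<lambda>g. {\<omega> \<in> space M. \<bar>(\<Sum>i\<in>I. g (X i \<omega>)) - (\<Sum>i\<in>I. expectation (\<lambda>\<omega>. g (X i \<omega>)))\<bar> \<ge> u}"
  have "{\<omega> \<in> space M. cmod ((\<Sum>i\<in>I. X i \<omega>) - (\<Sum>i\<in>I. expectation (X i))) > 2 * B * sqrt (n * s)}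
      \<subseteq> ?A Re \<union> ?A Im"
  proof
    fix \<omega> assume w: "\<omega> \<in> {\<omega> \<in> space M. cmod ((\<Sum>i\<in>I. X i \<omega>) - (\<Sum>i\<in>I. expectation (X i))) > 2 * B * sqrt (n * s)}"
    define z where "z = (\<Sum>i\<in>I. X i \<omega>) - (\<Sum>i\<in>I. expectation (X i))"
    have Re: "Re z = (\<Sum>i\<in>I. Re (X i \<omega>)) - (\<Sum>i\<in>I. expectation (\<lambda>\<omega>. Re (X i \<omega>)))"
      and Im: "Im z = (\<Sum>i\<in>I. Im (X i \<omega>)) - (\<Sum>i\<in>I. expectation (\<lambda>\<omega>. Im (X i \<omega>)))"
      unfolding z_def by (simp_all add: int)
    have "\<bar>Re z\<bar> \<ge> u \<or> \<bar>Im z\<bar> \<ge> u"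
    proof (rule ccontr)
      assume "\<not> ?thesis"
      then have "(Re z)\<^sup>2 \<le> u\<^sup>2" "(Im z)\<^sup>2 \<le> u\<^sup>2" by (auto intro!: power2_le_iff_abs_le[THEN iffD2] simp: u)
      then have "(cmod z)\<^sup>2 \<le> 2 * u\<^sup>2" by (simp add: cmod_power2)
      also have "\<dots> = (2 * B * sqrt (n * s))\<^sup>2" using n s by (simp add: u_def power_mult_distrib)
      finally have "cmod z \<le> 2 * B * sqrt (n * s)"
        by (rule power2_le_imp_le) (use B n s in simp)
      with w show False by (simp add: z_def)
    qed
    then show "\<omega> \<in> ?A Re \<union> ?A Im" using w by (auto simp: Re Im)
  qed
  then have "prob {\<omega> \<in> space M. cmod ((\<Sum>i\<in>I. X i \<omega>) - (\<Sum>i\<in>I. expectation (X i))) > 2 * B * sqrt (n * s)}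
      \<le> prob (?A Re \<union> ?A Im)" by (rule finite_measure_mono) measurable
  also have "\<dots> \<le> prob (?A Re) + prob (?A Im)" by (intro measure_Un_le) measurable
  also have "\<dots> \<le> 2 * exp (- s) + 2 * exp (- s)"
    by (intro add_mono part) (auto simp: abs_Re_le_cmod abs_Im_le_cmod)
  finally show ?thesis by (simp add: n_def)
qed simp

text \<open>Replacing values of modulus above B by 0 makes Hoeffding's inequality applicable.
  Outside the tail events the sum is unchanged, which costs card I * p in probability; each mean
  moves by at most A * sqrt p by Cauchy-Schwarz, which widens the deviation by card I times
  that.\<close>

lemma (in prob_space) Hoeffding_complex_truncated:
  fixes X :: "'i \<Rightarrow> 'a \<Rightarrow> complex" and B s A p :: real
  assumes fin: "finite I" and ind: "indep_vars (\<lambda>_. borel) X I"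
    and B: "B > 0" and s: "s \<ge> 0" and A: "A > 0" and p: "p > 0"
    and sq_int: "\<And>i. i \<in> I \<Longrightarrow> integrable M (\<lambda>\<omega>. (cmod (X i \<omega>))\<^sup>2)"
    and sq: "\<And>i. i \<in> I \<Longrightarrow> expectation (\<lambda>\<omega>. (cmod (X i \<omega>))\<^sup>2) \<le> A\<^sup>2"
    and tail: "\<And>i. i \<in> I \<Longrightarrow> prob {\<omega> \<in> space M. cmod (X i \<omega>) > B} \<le> p"
  shows "prob {\<omega> \<in> space M. cmod ((\<Sum>i\<in>I. X i \<omega>) - (\<Sum>i\<in>I. expectation (X i)))
            > 2 * B * sqrt (card I * s) + card I * (A * sqrt p)} \<le> card I * p + 4 * exp (- s)"
proof -
  have rv[measurable]: "X i \<in> borel_measurable M" if "i \<in> I" for i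
    using ind that unfolding indep_vars_def by blast
  define clip where "clip = (\<lambda>z. if cmod z \<le> B then z else 0)"
  have clip[measurable]: "clip \<in> borel_measurable borel" unfolding clip_def by measurable
  have int: "integrable M (X i)" if "i \<in> I" for i
  proof (rule Bochner_Integration.integrable_bound[where f="\<lambda>\<omega>. 1 + (cmod (X i \<omega>))\<^sup>2"])
    show "AE x in M. norm (X i x) \<le> norm (1 + (cmod (X i x))\<^sup>2)"
    proof (rule AE_I2)
      fix x
      have "0 \<le> (cmod (X i x) - 1)\<^sup>2" by simp
      then show "norm (X i x) \<le> norm (1 + (cmod (X i x))\<^sup>2)"
        using norm_ge_zero[of "X i x"] unfolding power2_diff by (simp del: norm_ge_zero)
    qed
  qed (use that sq_int in auto)
  have intc: "integrable M (\<lambda>\<omega>. clip (X i \<omega>))" if "i \<in> I" for i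
    by (rule integrable_const_bound[where B=B]) (use that B in \<open>auto simp: clip_def\<close>)
  let ?T = "\<lambda>i. {\<omega> \<in> space M. cmod (X i \<omega>) > B}"
  have bias: "cmod (expectation (X i) - expectation (\<lambda>\<omega>. clip (X i \<omega>))) \<le> A * sqrt p" if i: "i \<in> I" for i
  proof -
    \<comment> \<open>Cauchy-Schwarz by the weighted arithmetic-geometric inequality: on the tail
      event 2 |X| <= c |X|^2 + 1 / c. This c balances c A^2 against p / c, and both become A * sqrt
      p.\<close>
    define c where "c = sqrt p / A"
    have c: "c > 0" using A p by (simp add: c_def)
    have [measurable]: "?T i \<in> sets M" using i by measurable
    have "cmod (expectation (X i) - expectation (\<lambda>\<omega>. clip (X i \<omega>)))
        = cmod (expectation (\<lambda>\<omega>. X i \<omega> - clip (X i \<omega>)))"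
      using int[OF i] intc[OF i] by simp
    also have "\<dots> \<le> expectation (\<lambda>\<omega>. cmod (X i \<omega> - clip (X i \<omega>)))" by (rule integral_norm_bound)
    also have "\<dots> \<le> expectation (\<lambda>\<omega>. (c * (cmod (X i \<omega>))\<^sup>2 + indicator (?T i) \<omega> / c) / 2)"
    proof (rule integral_mono)
      fix \<omega> assume w: "\<omega> \<in> space M"
      have "c * (cmod (X i \<omega>))\<^sup>2 + 1 / c - 2 * cmod (X i \<omega>) = (c * cmod (X i \<omega>) - 1)\<^sup>2 / c"
        using c by (simp add: field_simps power2_eq_square)
      also have "\<dots> \<ge> 0" using c by simp
      finally have "2 * cmod (X i \<omega>) \<le> c * (cmod (X i \<omega>))\<^sup>2 + 1 / c" by simp
      then show "cmod (X i \<omega> - clip (X i \<omega>)) \<le> (c * (cmod (X i \<omega>))\<^sup>2 + indicator (?T i) \<omega> / c) / 2"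
        using w c by (auto simp: clip_def)
    qed (use i int intc sq_int in \<open>auto intro!: integrable_real_indicator simp: emeasure_eq_measure\<close>)
    also have "\<dots> = (c * expectation (\<lambda>\<omega>. (cmod (X i \<omega>))\<^sup>2) + prob (?T i) / c) / 2"
      using sq_int[OF i] by (simp add: integrable_real_indicator emeasure_eq_measure)
    also have "\<dots> \<le> (c * A\<^sup>2 + p / c) / 2"
      using c sq[OF i] tail[OF i] by (intro divide_right_mono add_mono mult_left_mono) auto
    also have "\<dots> = A * sqrt p"
      using A p by (simp add: c_def field_simps power2_eq_square)
    finally show ?thesis .
  qed
  let ?S = "{\<omega> \<in> space M. cmod ((\<Sum>i\<in>I. clip (X i \<omega>)) - (\<Sum>i\<in>I. expectation (\<lambda>\<omega>. clip (X i \<omega>))))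
            > 2 * B * sqrt (card I * s)}"
  have S: "prob ?S \<le> 4 * exp (- s)"
  proof (rule Hoeffding_complex[OF fin _ B s])
    show "indep_vars (\<lambda>_. borel) (\<lambda>i \<omega>. clip (X i \<omega>)) I"
      by (rule indep_vars_compose2[OF ind]) simp
  qed (use B in \<open>auto simp: clip_def\<close>)
  have "{\<omega> \<in> space M. cmod ((\<Sum>i\<in>I. X i \<omega>) - (\<Sum>i\<in>I. expectation (X i)))
            > 2 * B * sqrt (card I * s) + card I * (A * sqrt p)} \<subseteq> (\<Union>i\<in>I. ?T i) \<union> ?S"
  proof (rule subsetI, rule ccontr)
    fix \<omega> assume w: "\<omega> \<in> {\<omega> \<in> space M. cmod ((\<Sum>i\<in>I. X i \<omega>) - (\<Sum>i\<in>I. expectation (X i)))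
            > 2 * B * sqrt (card I * s) + card I * (A * sqrt p)}"
      and n: "\<omega> \<notin> (\<Union>i\<in>I. ?T i) \<union> ?S"
    have eq: "(\<Sum>i\<in>I. clip (X i \<omega>)) = (\<Sum>i\<in>I. X i \<omega>)"
      using w n by (intro sum.cong refl) (auto simp: clip_def)
    let ?b = "\<Sum>i\<in>I. expectation (X i) - expectation (\<lambda>\<omega>. clip (X i \<omega>))"
    have b: "cmod ?b \<le> card I * (A * sqrt p)"
      using sum_norm_bound[of I, OF bias] by simp
    have "cmod ((\<Sum>i\<in>I. X i \<omega>) - (\<Sum>i\<in>I. expectation (X i)))
      = cmod (((\<Sum>i\<in>I. X i \<omega>) - (\<Sum>i\<in>I. expectation (\<lambda>\<omega>. clip (X i \<omega>)))) - ?b)"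
      by (simp add: sum_subtractf)
    also have "\<dots> \<le> cmod ((\<Sum>i\<in>I. X i \<omega>) - (\<Sum>i\<in>I. expectation (\<lambda>\<omega>. clip (X i \<omega>)))) + cmod ?b"
      by (rule norm_triangle_ineq4)
    also have "\<dots> \<le> 2 * B * sqrt (card I * s) + card I * (A * sqrt p)"
      using n w b unfolding eq by (intro add_mono) (auto simp: eq)
    finally show False using w by simp
  qed
  moreover have [measurable]: "(\<Union>i\<in>I. ?T i) \<in> sets M" "?S \<in> sets M"
    using fin by (auto intro!: sets.finite_UN)
  ultimately have "prob {\<omega> \<in> space M. cmod ((\<Sum>i\<in>I. X i \<omega>) - (\<Sum>i\<in>I. expectation (X i)))
            > 2 * B * sqrt (card I * s) + card I * (A * sqrt p)} \<le> prob ((\<Union>i\<in>I. ?T i) \<union> ?S)"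
    by (intro finite_measure_mono) measurable
  also have "\<dots> \<le> prob (\<Union>i\<in>I. ?T i) + prob ?S" by (intro measure_Un_le) measurable
  also have "prob (\<Union>i\<in>I. ?T i) \<le> (\<Sum>i\<in>I. prob (?T i))" by (rule measure_UNION_le) (use fin in auto)
  also have "\<dots> \<le> (\<Sum>i\<in>I. p)" by (intro sum_mono tail)
  finally show ?thesis using S by simp
qed

section \<open>The standard complex Gaussian law\<close>

text \<open>Unit total variance is shared equally by the two coordinates, hence the deviation sqrt
  (1/2). A concrete law on the complex plane lets the argument run on a product of copies of it
  instead of on the given probability space.\<close>

definition cgauss :: "complex measure" where
  "cgauss = distr (density lborel (normal_density 0 (sqrt (1 / 2))) \<Otimes>\<^sub>M
     density lborel (normal_density 0 (sqrt (1 / 2)))) borel (\<lambda>(x, y). Complex x y)"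

lemma measurable_Complex [measurable]:
  "f \<in> borel_measurable M \<Longrightarrow> g \<in> borel_measurable M \<Longrightarrow> (\<lambda>x. Complex (f x) (g x)) \<in> borel_measurable M"
  by (simp add: borel_measurable_complex_iff)

lemma prob_space_cgauss: "prob_space cgauss"
proof -
  interpret N: prob_space "density lborel (normal_density 0 (sqrt (1 / 2)))"
    by (rule prob_space_normal_density) simp
  interpret pair_prob_space "density lborel (normal_density 0 (sqrt (1 / 2)))"
    "density lborel (normal_density 0 (sqrt (1 / 2)))" ..
  show ?thesis unfolding cgauss_def
    by (rule prob_space_distr) (simp add: split_def)
qed

lemma sets_cgauss [simp, measurable_cong]: "sets cgauss = sets borel"
  by (simp add: cgauss_def)

lemma space_cgauss [simp]: "space cgauss = UNIV"
  by (simp add: cgauss_def)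

lemma distr_circ_complex_normal:
  assumes "prob_space \<Omega>" and Z: "circ_complex_normal \<Omega> 1 Z" "Z \<in> borel_measurable \<Omega>"
  shows "distr \<Omega> borel Z = cgauss"
proof -
  interpret prob_space \<Omega> by fact
  note D = Z(1)[unfolded circ_complex_normal_def]
  have "distr \<Omega> borel (\<lambda>\<omega>. Re (Z \<omega>)) = density lborel (normal_density 0 (sqrt (1 / 2)))"
    "distr \<Omega> borel (\<lambda>\<omega>. Im (Z \<omega>)) = density lborel (normal_density 0 (sqrt (1 / 2)))"
    using D by (auto simp: distributed_def cong: distr_cong)
  moreover have "distr \<Omega> borel (\<lambda>\<omega>. Re (Z \<omega>)) \<Otimes>\<^sub>M distr \<Omega> borel (\<lambda>\<omega>. Im (Z \<omega>)) =
      distr \<Omega> (borel \<Otimes>\<^sub>M borel) (\<lambda>\<omega>. (Re (Z \<omega>), Im (Z \<omega>)))"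
    using D by (simp add: indep_var_distribution_eq)
  ultimately show ?thesis using Z(2)
    by (simp add: cgauss_def distr_distr split_def comp_def)
qed

text \<open>The density is exp (- |z|^2) / pi. The moments below are computed with nonnegative
  integrals, so that integrability and value come out together.\<close>

lemma nn_integral_cgauss:
  assumes [measurable]: "g \<in> borel_measurable borel"
  shows "nn_integral cgauss g =
    (\<integral>\<^sup>+x. \<integral>\<^sup>+y. ennreal (exp (- (x\<^sup>2 + y\<^sup>2)) / pi) * g (Complex x y) \<partial>lborel \<partial>lborel)"
proof -
  interpret N: prob_space "density lborel (normal_density 0 (sqrt (1 / 2)))"
    by (rule prob_space_normal_density) simp
  have "nn_integral cgauss g = (\<integral>\<^sup>+x. \<integral>\<^sup>+y. g (Complex x y)
     \<partial>density lborel (normal_density 0 (sqrt (1 / 2))) \<partial>density lborel (normal_density 0 (sqrt (1 / 2))))"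
    unfolding cgauss_def by (subst nn_integral_distr) (auto simp: N.nn_integral_fst[symmetric] split_def)
  also have "\<dots> = (\<integral>\<^sup>+x. \<integral>\<^sup>+y. ennreal (normal_density 0 (sqrt (1 / 2)) x) *
      (ennreal (normal_density 0 (sqrt (1 / 2)) y) * g (Complex x y)) \<partial>lborel \<partial>lborel)"
    by (simp add: nn_integral_density nn_integral_cmult)
  also have "\<dots> = (\<integral>\<^sup>+x. \<integral>\<^sup>+y. ennreal (exp (- (x\<^sup>2 + y\<^sup>2)) / pi) * g (Complex x y) \<partial>lborel \<partial>lborel)"
  proof (intro nn_integral_cong)
    fix x y :: real
    have "normal_density 0 (sqrt (1 / 2)) x * normal_density 0 (sqrt (1 / 2)) y = exp (- (x\<^sup>2 + y\<^sup>2)) / pi"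
      by (simp add: normal_density_def mult_exp_exp)
    then show "ennreal (normal_density 0 (sqrt (1 / 2)) x) *
      (ennreal (normal_density 0 (sqrt (1 / 2)) y) * g (Complex x y)) =
        ennreal (exp (- (x\<^sup>2 + y\<^sup>2)) / pi) * g (Complex x y)"
      by (simp add: ennreal_mult[symmetric] mult.assoc[symmetric])
  qed
  finally show ?thesis .
qed

text \<open>Two one-dimensional reflections, first of the real and then of the imaginary coordinate,
  leave the density unchanged. This symmetry is what makes sign flips of the gains preserve their
  joint law.\<close>

lemma distr_uminus_cgauss: "distr cgauss borel uminus = cgauss"
proof (rule measure_eqI)
  fix A assume "A \<in> sets (distr cgauss borel uminus)"
  then have [measurable]: "A \<in> sets borel" by simp
  have "emeasure (distr cgauss borel uminus) A = (\<integral>\<^sup>+z. indicator A (- z) \<partial>cgauss)"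
    by (simp add: nn_integral_distr flip: nn_integral_indicator)
  also have "\<dots> = (\<integral>\<^sup>+x. \<integral>\<^sup>+y. ennreal (exp (- (x\<^sup>2 + y\<^sup>2)) / pi) * indicator A (- Complex x y) \<partial>lborel \<partial>lborel)"
    by (rule nn_integral_cgauss) measurable
  also have "\<dots> = (\<integral>\<^sup>+x. \<integral>\<^sup>+y. ennreal (exp (- (x\<^sup>2 + y\<^sup>2)) / pi) * indicator A (- Complex (- x) y) \<partial>lborel \<partial>lborel)"
    by (subst nn_integral_real_affine[where c="-1" and t=0]) auto
  also have "\<dots> = (\<integral>\<^sup>+x. \<integral>\<^sup>+y. ennreal (exp (- (x\<^sup>2 + y\<^sup>2)) / pi) * indicator A (Complex x y) \<partial>lborel \<partial>lborel)"
  proof (rule nn_integral_cong)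
    fix x :: real
    show "(\<integral>\<^sup>+y. ennreal (exp (- (x\<^sup>2 + y\<^sup>2)) / pi) * indicator A (- Complex (- x) y) \<partial>lborel) =
       (\<integral>\<^sup>+y. ennreal (exp (- (x\<^sup>2 + y\<^sup>2)) / pi) * indicator A (Complex x y) \<partial>lborel)"
      by (subst nn_integral_real_affine[where c="-1" and t=0]) (auto simp: complex_eq_iff Complex_eq intro!: nn_integral_cong arg_cong[where f="indicator A"])
  qed
  also have "\<dots> = (\<integral>\<^sup>+z. indicator A z \<partial>cgauss)"
    by (rule nn_integral_cgauss[symmetric]) measurable
  finally show "emeasure (distr cgauss borel uminus) A = emeasure cgauss A" by simp
qed simp

text \<open>Away from 0 the functions \<open>phase\<close> and \<open>sgn\<close> agree and
  \<open>sgn\<close> has modulus one.\<close>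

lemma AE_cgauss_nonzero: "AE z in cgauss. z \<noteq> 0"
proof (rule AE_I)
  have "emeasure cgauss {0} = (\<integral>\<^sup>+z. indicator {0} z \<partial>cgauss)" by simp
  also have "\<dots> = (\<integral>\<^sup>+x. \<integral>\<^sup>+y. ennreal (exp (- (x\<^sup>2 + y\<^sup>2)) / pi) * indicator {0} (Complex x y) \<partial>lborel \<partial>lborel)"
    by (rule nn_integral_cgauss) measurable
  also have "\<dots> = (\<integral>\<^sup>+(x::real). 0 \<partial>lborel)"
  proof (rule nn_integral_cong)
    fix x :: real
    show "(\<integral>\<^sup>+y. ennreal (exp (- (x\<^sup>2 + y\<^sup>2)) / pi) * indicator {0} (Complex x y) \<partial>lborel) = 0"
      by (intro nn_integral_zero' AE_I[where N="{0}"]) (auto simp: complex_eq_iff indicator_def)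
  qed
  finally show "emeasure cgauss {0} = 0" by simp
qed auto

section \<open>Moments and tail of the modulus of a complex Gaussian\<close>

text \<open>The squared modulus is exponentially distributed with mean 1, and its exponential moment
  at 1/2 is 1 / (1 - 1/2). Both the tail bound and the fourth moment are read off from it.\<close>

lemma cgauss_exp:
  "integrable cgauss (\<lambda>z. exp ((cmod z)\<^sup>2 / 2))" "(\<integral>z. exp ((cmod z)\<^sup>2 / 2) \<partial>cgauss) = 2"
proof -
  have std: "(\<integral>\<^sup>+(y::real). ennreal (exp (- y\<^sup>2 / 2)) \<partial>lborel) = ennreal (sqrt (2 * pi))"
  proof -
    have "(\<integral>\<^sup>+y. ennreal (exp (- y\<^sup>2 / 2)) \<partial>lborel) = (\<integral>\<^sup>+y. ennreal (sqrt (2 * pi)) * ennreal (normal_density 0 1 y) \<partial>lborel)"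
      by (intro nn_integral_cong) (simp add: normal_density_def ennreal_mult[symmetric])
    also have "\<dots> = ennreal (sqrt (2 * pi)) * ennreal 1"
      by (subst nn_integral_cmult) (simp_all add: nn_integral_eq_integral)
    finally show ?thesis by simp
  qed
  have "(\<integral>\<^sup>+z. ennreal (exp ((cmod z)\<^sup>2 / 2)) \<partial>cgauss) =
     (\<integral>\<^sup>+x. \<integral>\<^sup>+y. ennreal (exp (- (x\<^sup>2 + y\<^sup>2)) / pi) * ennreal (exp ((cmod (Complex x y))\<^sup>2 / 2)) \<partial>lborel \<partial>lborel)"
    by (rule nn_integral_cgauss) measurable
  also have "\<dots> = (\<integral>\<^sup>+x. \<integral>\<^sup>+y. ennreal (1 / pi) * ennreal (exp (- x\<^sup>2 / 2)) * ennreal (exp (- y\<^sup>2 / 2)) \<partial>lborel \<partial>lborel)"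
    by (intro nn_integral_cong)
       (simp add: ennreal_mult[symmetric] cmod_power2 mult_exp_exp field_simps)
  also have "\<dots> = ennreal (1 / pi) * ennreal (sqrt (2 * pi)) * ennreal (sqrt (2 * pi))"
    using std by (simp add: nn_integral_cmult nn_integral_multc)
  also have "\<dots> = ennreal 2" by (simp add: ennreal_mult[symmetric])
  finally have *: "(\<integral>\<^sup>+z. ennreal (exp ((cmod z)\<^sup>2 / 2)) \<partial>cgauss) = ennreal 2" .
  have "has_bochner_integral cgauss (\<lambda>z. exp ((cmod z)\<^sup>2 / 2)) 2"
    by (rule has_bochner_integral_nn_integral) (use * in auto)
  then show "integrable cgauss (\<lambda>z. exp ((cmod z)\<^sup>2 / 2))" "(\<integral>z. exp ((cmod z)\<^sup>2 / 2) \<partial>cgauss) = 2"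
    by (auto simp: has_bochner_integral_iff)
qed

lemma nn_integral_square_exp:
  fixes a :: real assumes a: "a > 0"
  shows "(\<integral>\<^sup>+x. ennreal (x\<^sup>2 * exp (- a * x\<^sup>2)) \<partial>lborel) = ennreal (sqrt pi / (2 * a * sqrt a))"
proof -
  \<comment> \<open>The deviation for which the normal density is proportional to exp (- a x^2); the
    factor sqrt (pi / a) below undoes its normalisation.\<close>
  define s where "s = sqrt (1 / (2 * a))"
  have s: "s > 0" "s\<^sup>2 = 1 / (2 * a)" using a by (simp_all add: s_def)
  have m: "has_bochner_integral lborel (\<lambda>x. normal_density 0 s x * (x - 0) ^ (2 * 1)) (fact (2 * 1) / ((2 / s\<^sup>2) ^ 1 * fact 1))"
    by (rule normal_moment_even[OF s(1)])
  have "has_bochner_integral lborel (\<lambda>x. sqrt (pi / a) * (normal_density 0 s x * (x - 0) ^ (2 * 1))) (sqrt (pi / a) * (fact (2 * 1) / ((2 / s\<^sup>2) ^ 1 * fact 1)))"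
    using m by (rule has_bochner_integral_mult_right)
  also have "(\<lambda>x. sqrt (pi / a) * (normal_density 0 s x * (x - 0) ^ (2 * 1))) = (\<lambda>x. x\<^sup>2 * exp (- a * x\<^sup>2))"
    using a by (simp add: normal_density_def s(2) fun_eq_iff)
  also have "sqrt (pi / a) * (fact (2 * 1) / ((2 / s\<^sup>2) ^ 1 * fact 1)) = sqrt pi / (2 * a * sqrt a)"
    using a by (simp add: s(2) real_sqrt_divide)
  finally show ?thesis
    by (subst nn_integral_eq_integral) (auto simp: has_bochner_integral_iff)
qed

lemma cgauss_norm_square:
  "integrable cgauss (\<lambda>z. (cmod z)\<^sup>2)" "(\<integral>z. (cmod z)\<^sup>2 \<partial>cgauss) = 1"
proof -
  have e: "(\<integral>\<^sup>+(y::real). ennreal (exp (- y\<^sup>2)) \<partial>lborel) = ennreal (sqrt pi)"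
  proof -
    have "(\<integral>\<^sup>+y. ennreal (exp (- y\<^sup>2)) \<partial>lborel) = (\<integral>\<^sup>+y. ennreal (sqrt pi) * ennreal (normal_density 0 (sqrt (1 / 2)) y) \<partial>lborel)"
      by (intro nn_integral_cong) (simp add: normal_density_def ennreal_mult[symmetric])
    also have "\<dots> = ennreal (sqrt pi) * ennreal 1"
      by (subst nn_integral_cmult) (simp_all add: nn_integral_eq_integral)
    finally show ?thesis by simp
  qed
  have e2: "(\<integral>\<^sup>+(y::real). ennreal (y\<^sup>2 * exp (- y\<^sup>2)) \<partial>lborel) = ennreal (sqrt pi / 2)"
    using nn_integral_square_exp[of 1] by simp
  have "(\<integral>\<^sup>+z. ennreal ((cmod z)\<^sup>2) \<partial>cgauss) =
     (\<integral>\<^sup>+x. \<integral>\<^sup>+y. ennreal (exp (- (x\<^sup>2 + y\<^sup>2)) / pi) * ennreal ((cmod (Complex x y))\<^sup>2) \<partial>lborel \<partial>lborel)"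
    by (rule nn_integral_cgauss) measurable
  also have "\<dots> = (\<integral>\<^sup>+x. \<integral>\<^sup>+y. ennreal (1 / pi) * ennreal (exp (- x\<^sup>2)) * ennreal (y\<^sup>2 * exp (- y\<^sup>2))
       + ennreal (1 / pi) * ennreal (x\<^sup>2 * exp (- x\<^sup>2)) * ennreal (exp (- y\<^sup>2)) \<partial>lborel \<partial>lborel)"
    by (intro nn_integral_cong)
       (simp add: ennreal_mult[symmetric] ennreal_plus[symmetric] cmod_power2 exp_add exp_diff exp_minus field_simps del: ennreal_plus)
  also have "\<dots> = ennreal (1 / pi) * ennreal (sqrt pi) * ennreal (sqrt pi / 2) + ennreal (1 / pi) * ennreal (sqrt pi / 2) * ennreal (sqrt pi)"
    by (simp add: nn_integral_add nn_integral_cmult e e2 nn_integral_multc)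
  also have "\<dots> = ennreal (1 / 2) + ennreal (1 / 2)"
    by (intro arg_cong2[where f="(+)"]) (simp_all add: ennreal_mult[symmetric])
  also have "\<dots> = ennreal 1" by (subst ennreal_plus[symmetric]) auto
  finally have *: "(\<integral>\<^sup>+z. ennreal ((cmod z)\<^sup>2) \<partial>cgauss) = ennreal 1" .
  have "has_bochner_integral cgauss (\<lambda>z. (cmod z)\<^sup>2) 1"
    by (rule has_bochner_integral_nn_integral) (use * in auto)
  then show "integrable cgauss (\<lambda>z. (cmod z)\<^sup>2)" "(\<integral>z. (cmod z)\<^sup>2 \<partial>cgauss) = 1"
    by (auto simp: has_bochner_integral_iff)
qed

lemma nn_integral_inverse_1_plus_square:
  "(\<integral>\<^sup>+(s::real). ennreal (1 / (1 + s\<^sup>2)) \<partial>lborel) = ennreal pi"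
proof -
  have "(\<integral>\<^sup>+s. ennreal (inverse (1 + s\<^sup>2)) \<partial>lborel) = ennreal (LINT s|lborel. inverse (1 + s\<^sup>2))"
    using integrable_inverse_1_plus_square
    by (intro nn_integral_eq_integral) (simp_all add: set_integrable_def)
  also have "(LINT s|lborel. inverse (1 + s\<^sup>2)) = pi"
    using LBINT_inverse_1_plus_square
    by (simp add: interval_lebesgue_integral_def set_lebesgue_integral_def)
  finally show ?thesis by (simp add: inverse_eq_divide)
qed

text \<open>The substitution \<open>y = x * s\<close> turns the double integral into \<open>1 / (1 + s\<^sup>2)\<close> times a Gaussian moment.\<close>

lemma cgauss_norm:
  "integrable cgauss cmod" "(\<integral>z. cmod z \<partial>cgauss) = sqrt pi / 2"
proof -
  let ?g = "\<lambda>x s::real. ennreal (x\<^sup>2 * exp (- (1 + s\<^sup>2) * x\<^sup>2) * (sqrt (1 + s\<^sup>2) / pi))"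
  have "(\<integral>\<^sup>+z. ennreal (cmod z) \<partial>cgauss) =
     (\<integral>\<^sup>+x. \<integral>\<^sup>+y. ennreal (exp (- (x\<^sup>2 + y\<^sup>2)) / pi) * ennreal (cmod (Complex x y)) \<partial>lborel \<partial>lborel)"
    by (rule nn_integral_cgauss) measurable
  also have "\<dots> = (\<integral>\<^sup>+x. \<integral>\<^sup>+s. ?g x s \<partial>lborel \<partial>lborel)"
  \<comment> \<open>The substitution in the inner integral needs x to be nonzero, so the two inner
    integrals are compared off the null set {0} only.\<close>
  proof (intro nn_integral_cong_AE AE_I[where N="{0}"] subsetI)
    fix x :: real assume "x \<in> {x \<in> space lborel. (\<integral>\<^sup>+y. ennreal (exp (- (x\<^sup>2 + y\<^sup>2)) / pi) * ennreal (cmod (Complex x y)) \<partial>lborel) \<noteq> (\<integral>\<^sup>+s. ?g x s \<partial>lborel)}"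
    moreover have "(\<integral>\<^sup>+y. ennreal (exp (- (x\<^sup>2 + y\<^sup>2)) / pi) * ennreal (cmod (Complex x y)) \<partial>lborel) = (\<integral>\<^sup>+s. ?g x s \<partial>lborel)"
      if x: "x \<noteq> 0"
    proof -
      have "(\<integral>\<^sup>+y. ennreal (exp (- (x\<^sup>2 + y\<^sup>2)) / pi) * ennreal (cmod (Complex x y)) \<partial>lborel)
        = (\<integral>\<^sup>+s. ennreal \<bar>x\<bar> * (ennreal (exp (- (x\<^sup>2 + (x * s)\<^sup>2)) / pi) * ennreal (cmod (Complex x (x * s)))) \<partial>lborel)"
        using x by (subst nn_integral_real_affine[where c=x and t=0]) (auto simp: nn_integral_cmult)
      also have "\<dots> = (\<integral>\<^sup>+s. ?g x s \<partial>lborel)"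
      proof (rule nn_integral_cong)
        fix s :: real
        have "cmod (Complex x (x * s)) = sqrt (x\<^sup>2 * (1 + s\<^sup>2))"
          by (simp add: cmod_def power_mult_distrib distrib_left)
        then have "cmod (Complex x (x * s)) = \<bar>x\<bar> * sqrt (1 + s\<^sup>2)"
          by (simp add: real_sqrt_mult)
        moreover have "x\<^sup>2 + (x * s)\<^sup>2 = (1 + s\<^sup>2) * x\<^sup>2" by (simp add: power_mult_distrib algebra_simps)
        moreover have "\<bar>x\<bar> * (exp (- ((1 + s\<^sup>2) * x\<^sup>2)) / pi * (\<bar>x\<bar> * sqrt (1 + s\<^sup>2))) = \<bar>x\<bar>\<^sup>2 * exp (- (1 + s\<^sup>2) * x\<^sup>2) * (sqrt (1 + s\<^sup>2) / pi)"
          by (simp only: power2_eq_square) (simp add: field_simps)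
        ultimately show "ennreal \<bar>x\<bar> * (ennreal (exp (- (x\<^sup>2 + (x * s)\<^sup>2)) / pi) * ennreal (cmod (Complex x (x * s)))) = ?g x s"
          by (simp only: ennreal_mult[symmetric] power2_abs) (simp add: ennreal_mult[symmetric])
      qed
      finally show ?thesis .
    qed
    ultimately show "x \<in> {0}" by auto
  qed auto
  \<comment> \<open>After the exchange the inner integral is \<open>nn_integral_square_exp\<close>
    with a = 1 + s^2, and the outer one is the arctangent integral.\<close>
  also have "\<dots> = (\<integral>\<^sup>+s. \<integral>\<^sup>+x. ?g x s \<partial>lborel \<partial>lborel)"
    by (rule lborel_pair.Fubini') measurable
  also have "\<dots> = (\<integral>\<^sup>+s. ennreal (1 / (2 * sqrt pi)) * ennreal (1 / (1 + s\<^sup>2)) \<partial>lborel)"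
  proof (rule nn_integral_cong)
    fix s :: real
    define a where "a = 1 + s\<^sup>2"
    have a: "a > 0" by (simp add: a_def add_pos_nonneg)
    have "(\<integral>\<^sup>+x. ?g x s \<partial>lborel) = (\<integral>\<^sup>+x. ennreal (x\<^sup>2 * exp (- a * x\<^sup>2)) * ennreal (sqrt a / pi) \<partial>lborel)"
      using a unfolding a_def[symmetric] by (simp add: ennreal_mult[symmetric])
    also have "\<dots> = ennreal (sqrt pi / (2 * a * sqrt a)) * ennreal (sqrt a / pi)"
      by (subst nn_integral_multc, simp, subst nn_integral_square_exp[OF a], rule refl)
    also have "\<dots> = ennreal (sqrt pi / (2 * a * sqrt a) * (sqrt a / pi))"
      using a by (simp add: ennreal_mult[symmetric])
    also have "sqrt pi / (2 * a * sqrt a) * (sqrt a / pi) = 1 / (2 * sqrt pi) * (1 / a)"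
      using a by (simp add: field_simps)
    finally show "(\<integral>\<^sup>+x. ?g x s \<partial>lborel) = ennreal (1 / (2 * sqrt pi)) * ennreal (1 / (1 + s\<^sup>2))"
      using a by (simp add: a_def ennreal_mult[symmetric])
  qed
  also have "\<dots> = ennreal (1 / (2 * sqrt pi)) * ennreal pi"
    by (subst nn_integral_cmult) (simp_all add: nn_integral_inverse_1_plus_square)
  also have "\<dots> = ennreal (sqrt pi / 2)"
    by (simp add: ennreal_mult[symmetric] real_div_sqrt field_simps)
  finally have *: "(\<integral>\<^sup>+z. ennreal (cmod z) \<partial>cgauss) = ennreal (sqrt pi / 2)" .
  have "has_bochner_integral cgauss cmod (sqrt pi / 2)"
    by (rule has_bochner_integral_nn_integral) (use * in auto)
  then show "integrable cgauss cmod" "(\<integral>z. cmod z \<partial>cgauss) = sqrt pi / 2"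
    by (auto simp: has_bochner_integral_iff)
qed

text \<open>From u^2 / 2 <= exp u at u = |z|^2 / 2 the fourth power is at most 8 exp (|z|^2 / 2),
  whose mean is 16. The crude constant suffices because the fourth moment only enters a truncation
  bias.\<close>

lemma cgauss_norm_4:
  "integrable cgauss (\<lambda>z. (cmod z) ^ 4)" "(\<integral>z. (cmod z) ^ 4 \<partial>cgauss) \<le> 16"
proof -
  have b: "(cmod z) ^ 4 \<le> 8 * exp ((cmod z)\<^sup>2 / 2)" for z
  proof -
    have "((cmod z)\<^sup>2 / 2)\<^sup>2 / 2 \<le> exp ((cmod z)\<^sup>2 / 2)"
      using exp_lower_Taylor_quadratic[of "(cmod z)\<^sup>2 / 2"] zero_le_power2[of "cmod z"] by linarith
    then show ?thesis by (simp add: power_divide)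
  qed
  show 1: "integrable cgauss (\<lambda>z. (cmod z) ^ 4)"
    by (rule Bochner_Integration.integrable_bound[OF integrable_mult_right[OF cgauss_exp(1), of 8]])
       (use b in auto)
  have "(\<integral>z. (cmod z) ^ 4 \<partial>cgauss) \<le> (\<integral>z. 8 * exp ((cmod z)\<^sup>2 / 2) \<partial>cgauss)"
    by (rule integral_mono[OF 1 integrable_mult_right[OF cgauss_exp(1)] b])
  then show "(\<integral>z. (cmod z) ^ 4 \<partial>cgauss) \<le> 16" by (simp add: cgauss_exp)
qed

lemma cgauss_tail:
  "measure cgauss {z. (cmod z)\<^sup>2 > 2 * y} \<le> 2 * exp (- y)"
proof -
  interpret prob_space cgauss by (rule prob_space_cgauss)
  have "measure cgauss {z \<in> space cgauss. exp ((cmod z)\<^sup>2 / 2) \<ge> exp y} \<le> (\<integral>z. exp ((cmod z)\<^sup>2 / 2) \<partial>cgauss) / exp y"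
    by (rule integral_Markov_inequality_measure[OF cgauss_exp(1), where A="{}"]) auto
  moreover have "measure cgauss {z. (cmod z)\<^sup>2 > 2 * y} \<le> measure cgauss {z \<in> space cgauss. exp ((cmod z)\<^sup>2 / 2) \<ge> exp y}"
    by (rule finite_measure_mono) auto
  ultimately have "measure cgauss {z. (cmod z)\<^sup>2 > 2 * y} \<le> 2 / exp y" by (simp only: cgauss_exp)
  then show ?thesis by (simp add: exp_minus divide_inverse)
qed

section \<open>The product space of the channel gains\<close>

text \<open>Left summands (k, m) index the backward gains, right summands (m, k) the forward gains.
  The set has exactly the shape of the index set in the independence hypothesis of the
  theorem.\<close>

definition links :: "nat \<Rightarrow> nat \<Rightarrow> (nat \<times> nat + nat \<times> nat) set"
  where "links K M = ({1..K} \<times> {1..M}) <+> ({1..M} \<times> {1..K})"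

definition gains :: "nat \<Rightarrow> nat \<Rightarrow> (nat \<times> nat + nat \<times> nat \<Rightarrow> complex) measure"
  where "gains K M = PiM (links K M) (\<lambda>_. cgauss)"

locale channel =
  fixes K M :: nat
  assumes K_pos: "K \<ge> 1" and M_pos: "M \<ge> 1"
begin

text \<open>The restriction to \<open>links K M\<close> keeps the image in the extensional function
  space that carries \<open>gains\<close>.\<close>

definition flip :: "(nat \<times> nat + nat \<times> nat \<Rightarrow> real) \<Rightarrow> (nat \<times> nat + nat \<times> nat \<Rightarrow> complex) \<Rightarrow>
    (nat \<times> nat + nat \<times> nat \<Rightarrow> complex)"
  where "flip s x = (\<lambda>i\<in>links K M. of_real (s i) * x i)"

abbreviation h :: "nat \<Rightarrow> nat \<Rightarrow> (nat \<times> nat + nat \<times> nat \<Rightarrow> complex) \<Rightarrow> complex"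
  where "h k m x \<equiv> x (Inl (k, m))"

abbreviation f :: "nat \<Rightarrow> nat \<Rightarrow> (nat \<times> nat + nat \<times> nat \<Rightarrow> complex) \<Rightarrow> complex"
  where "f m k x \<equiv> x (Inr (m, k))"

lemma finite_links [simp]: "finite (links K M)" by (simp add: links_def)

lemma Inl_links [simp]: "Inl (k, m) \<in> links K M \<longleftrightarrow> k \<in> {1..K} \<and> m \<in> {1..M}"
  and Inr_links [simp]: "Inr (m, k) \<in> links K M \<longleftrightarrow> k \<in> {1..K} \<and> m \<in> {1..M}"
  by (auto simp: links_def)

lemma links_nonempty: "links K M \<noteq> {}"
  using Inl_links[of 1 1] K_pos M_pos by fastforce

sublocale prob_space "gains K M"
  unfolding gains_def by (intro prob_space_PiM prob_space_cgauss)

lemma sets_gains [measurable_cong]: "sets (gains K M) = sets (PiM (links K M) (\<lambda>_. borel))"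
  unfolding gains_def by (intro sets_PiM_cong) auto

lemma space_gains: "space (gains K M) = PiE (links K M) (\<lambda>_. UNIV)"
  by (simp add: gains_def space_PiM)

lemma component_measurable [measurable]:
  "i \<in> links K M \<Longrightarrow> (\<lambda>x. x i) \<in> borel_measurable (gains K M)"
  by (simp add: measurable_cong_sets[OF sets_gains refl])

lemma distr_component: "i \<in> links K M \<Longrightarrow> distr (gains K M) borel (\<lambda>x. x i) = cgauss"
  using distr_PiM_component[of "links K M" "\<lambda>_. cgauss" i] distr_cong[OF refl sets_cgauss refl, of "gains K M" "\<lambda>x. x i"]
  by (simp add: prob_space_cgauss gains_def)

lemma indep_components: "indep_vars (\<lambda>_. borel) (\<lambda>i x. x i) (links K M)"
proof (subst indep_vars_iff_distr_eq_PiM'[OF links_nonempty])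
  have "distr (gains K M) (PiM (links K M) (\<lambda>_. borel)) (\<lambda>x. \<lambda>i\<in>links K M. x i) =
      distr (gains K M) (gains K M) (\<lambda>x. x)"
    by (intro distr_cong) (auto simp: sets_gains space_gains intro!: restrict_PiE[symmetric] extensionalityI)
  also have "\<dots> = gains K M" by (rule distr_id)
  also have "\<dots> = PiM (links K M) (\<lambda>i. distr (gains K M) borel (\<lambda>x. x i))"
    unfolding gains_def[of K M] by (intro PiM_cong) (simp_all add: distr_component[unfolded gains_def])
  finally show "distr (gains K M) (PiM (links K M) (\<lambda>_. borel)) (\<lambda>x. \<lambda>i\<in>links K M. x i) =
      PiM (links K M) (\<lambda>i. distr (gains K M) borel (\<lambda>x. x i))" .
qed measurable

section \<open>Invariance of the gains under sign flips\<close>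

lemma flip_measurable [measurable]: "flip s \<in> measurable (gains K M) (gains K M)"
  unfolding flip_def measurable_cong_sets[OF refl sets_gains] by measurable

text \<open>The signed coordinates are still independent, and each still has law
  \<open>cgauss\<close> by symmetry, so their joint law is the same product.\<close>

lemma distr_flip:
  assumes s: "\<And>i. s i \<in> {1, -1}"
  shows "distr (gains K M) (gains K M) (flip s) = gains K M"
proof -
  have ind: "indep_vars (\<lambda>_. borel) (\<lambda>i x. of_real (s i) * x i) (links K M)"
    by (rule indep_vars_compose2[OF indep_components]) simp
  have "distr (gains K M) (PiM (links K M) (\<lambda>_. borel)) (\<lambda>x. \<lambda>i\<in>links K M. of_real (s i) * x i) =
      PiM (links K M) (\<lambda>i. distr (gains K M) borel (\<lambda>x. of_real (s i) * x i))"
    using ind by (subst (asm) indep_vars_iff_distr_eq_PiM'[OF links_nonempty]) auto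
  also have "\<dots> = gains K M" unfolding gains_def[of K M]
  proof (intro PiM_cong refl)
    fix i assume i: "i \<in> links K M"
    have c: "distr (gains K M) borel (\<lambda>x. x i) = cgauss" by (rule distr_component[OF i])
    show "distr (PiM (links K M) (\<lambda>_. cgauss)) borel (\<lambda>x. of_real (s i) * x i) = cgauss"
    proof (cases "s i = 1")
      case True
      then show ?thesis using c by (simp add: gains_def)
    next
      case False
      then have "s i = -1" using s[of i] by auto
      then have "distr (gains K M) borel (\<lambda>x. of_real (s i) * x i) = distr (distr (gains K M) borel (\<lambda>x. x i)) borel uminus"
        using i by (simp add: distr_distr comp_def)
      then show ?thesis unfolding c distr_uminus_cgauss by (simp add: gains_def)
    qed
  qed
  also have "distr (gains K M) (PiM (links K M) (\<lambda>_. borel)) (\<lambda>x. \<lambda>i\<in>links K M. of_real (s i) * x i) =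
      distr (gains K M) (gains K M) (flip s)"
    by (intro distr_cong) (auto simp: sets_gains flip_def)
  finally show ?thesis .
qed

lemma expectation_flip:
  fixes \<Phi> :: "_ \<Rightarrow> 'b::{banach, second_countable_topology}"
  assumes "\<And>i. s i \<in> {1, -1}" and [measurable]: "\<Phi> \<in> borel_measurable (gains K M)"
  shows "expectation (\<lambda>x. \<Phi> (flip s x)) = expectation \<Phi>"
  using integral_distr[of "flip s" "gains K M" "gains K M" \<Phi>] distr_flip[of s] assms by simp

text \<open>The device that removes cross terms: when a gain enters a term through an odd number of
  sign-sensitive factors, flipping that gain alone negates the term, and its mean equals its own
  negative.\<close>

lemma expectation_odd:
  fixes \<Phi> :: "_ \<Rightarrow> 'b::{banach, second_countable_topology}"
  assumes "\<And>i. s i \<in> {1, -1}" and "\<Phi> \<in> borel_measurable (gains K M)"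
    and "\<And>x. \<Phi> (flip s x) = - \<Phi> x"
  shows "expectation \<Phi> = 0"
proof -
  have "expectation \<Phi> = - expectation \<Phi>"
    using expectation_flip[where s=s, OF assms(1,2)] unfolding assms(3) by simp
  then have "2 *\<^sub>R expectation \<Phi> = 0" by (simp only: scaleR_2 eq_neg_iff_add_eq_0)
  then show ?thesis by simp
qed

lemma AE_nonzero: "AE x in gains K M. \<forall>i\<in>links K M. x i \<noteq> 0"
proof (rule AE_finite_allI)
  fix i assume i: "i \<in> links K M"
  have "AE z in distr (gains K M) borel (\<lambda>x. x i). z \<noteq> 0"
    unfolding distr_component[OF i] by (rule AE_cgauss_nonzero)
  then show "AE x in gains K M. x i \<noteq> 0" using i by (subst (asm) AE_distr_iff) auto
qed simp

section \<open>Moments, tails and independence of the coordinates\<close>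

lemma component_integral:
  fixes g :: "complex \<Rightarrow> real"
  assumes i: "i \<in> links K M" and g: "integrable cgauss g"
  shows "integrable (gains K M) (\<lambda>x. g (x i))" "expectation (\<lambda>x. g (x i)) = integral\<^sup>L cgauss g"
proof -
  have [measurable]: "g \<in> borel_measurable borel" using g by (simp add: borel_measurable_integrable measurable_cong_sets[OF sets_cgauss refl, symmetric])
  show "integrable (gains K M) (\<lambda>x. g (x i))" "expectation (\<lambda>x. g (x i)) = integral\<^sup>L cgauss g"
    using g i distr_component[OF i] integrable_distr_eq[of "\<lambda>x. x i" "gains K M" borel g]
      integral_distr[of "\<lambda>x. x i" "gains K M" borel g] by auto
qed

lemma pair_integral:
  fixes g g' :: "complex \<Rightarrow> real"
  assumes ij: "i \<in> links K M" "j \<in> links K M" "i \<noteq> j" and g: "integrable cgauss g" "integrable cgauss g'"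
  shows "integrable (gains K M) (\<lambda>x. g (x i) * g' (x j))"
    "expectation (\<lambda>x. g (x i) * g' (x j)) = integral\<^sup>L cgauss g * integral\<^sup>L cgauss g'"
proof -
  have [measurable]: "g \<in> borel_measurable borel" "g' \<in> borel_measurable borel"
    using g by (simp_all add: borel_measurable_integrable measurable_cong_sets[OF sets_cgauss refl, symmetric])
  let ?X = "\<lambda>l x. (if l = i then g else g') (x l)"
  have ind: "indep_vars (\<lambda>_. borel) ?X {i, j}"
    by (rule indep_vars_compose2[OF indep_vars_subset[OF indep_components]]) (use ij in auto)
  have int: "integrable (gains K M) (?X l)" if "l \<in> {i, j}" for l
    using that ij component_integral(1) g by auto
  have "integrable (gains K M) (\<lambda>x. \<Prod>l\<in>{i, j}. ?X l x)"
    by (rule indep_vars_integrable[OF _ ind int]) auto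
  then show "integrable (gains K M) (\<lambda>x. g (x i) * g' (x j))" using ij by simp
  have "expectation (\<lambda>x. \<Prod>l\<in>{i, j}. ?X l x) = (\<Prod>l\<in>{i, j}. expectation (?X l))"
    by (rule indep_vars_lebesgue_integral[OF _ ind int]) auto
  then show "expectation (\<lambda>x. g (x i) * g' (x j)) = integral\<^sup>L cgauss g * integral\<^sup>L cgauss g'"
    using ij g component_integral(2)[of i g] component_integral(2)[of j g'] by simp
qed

lemma component_tail:
  assumes i: "i \<in> links K M"
  shows "prob {x \<in> space (gains K M). (cmod (x i))\<^sup>2 > 2 * y} \<le> 2 * exp (- y)"
proof -
  have "prob {x \<in> space (gains K M). (cmod (x i))\<^sup>2 > 2 * y} = measure (distr (gains K M) borel (\<lambda>x. x i)) {z. (cmod z)\<^sup>2 > 2 * y}"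
    using i by (subst measure_distr) (auto intro!: arg_cong[where f=prob])
  then show ?thesis using cgauss_tail[of y] by (simp add: distr_component[OF i])
qed

text \<open>That a function depends only on its block is expressed by invariance under
  \<open>restrict\<close>. Blocks are used in two ways: all gains at one relay, and the two gains of
  one pair at a fixed relay.\<close>

lemma indep_blocks:
  fixes F :: "'j \<Rightarrow> _ \<Rightarrow> 'b::topological_space"
  assumes B: "\<And>j. j \<in> L \<Longrightarrow> B j \<subseteq> links K M" "disjoint_family_on B L"
    and F: "\<And>j. j \<in> L \<Longrightarrow> F j \<in> borel_measurable (PiM (B j) (\<lambda>_. borel))"
    and local: "\<And>j x. j \<in> L \<Longrightarrow> F j (restrict x (B j)) = F j x"
  shows "indep_vars (\<lambda>_. borel) F L"
proof -
  have "indep_vars (\<lambda>j. PiM (B j) (\<lambda>_. borel)) (\<lambda>j \<omega>. restrict (\<lambda>i. \<omega> i) (B j)) L"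
    by (rule indep_vars_restrict[OF indep_components B])
  then have "indep_vars (\<lambda>_. borel) (\<lambda>j x. F j (restrict x (B j))) L"
    by (rule indep_vars_compose2) (rule F)
  then show ?thesis using local by (subst (asm) indep_vars_cong[OF refl _ refl]) (auto simp: fun_eq_iff)
qed

end

section \<open>Sums over the relays\<close>

lemma borel_measurable_sgn_complex [measurable]:
  fixes g :: "'a \<Rightarrow> complex"
  assumes [measurable]: "g \<in> borel_measurable N"
  shows "(\<lambda>x. sgn (g x)) \<in> borel_measurable N"
  unfolding sgn_div_norm by measurable

lemma borel_measurable_cnj [measurable]:
  fixes g :: "'a \<Rightarrow> complex"
  assumes [measurable]: "g \<in> borel_measurable N"
  shows "(\<lambda>x. cnj (g x)) \<in> borel_measurable N"
  by (rule measurable_compose[OF assms borel_measurable_continuous_onI]) (intro continuous_intros)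

lemma borel_measurable_complex_of_real:
  "g \<in> borel_measurable N \<Longrightarrow> (\<lambda>x. complex_of_real (g x)) \<in> borel_measurable N"
  by measurable

lemma mult_cnj_sgn: "z * cnj (sgn z) = of_real (cmod z)"
proof (cases "z = 0")
  case False
  have "z * cnj (sgn z) = of_real ((cmod z)\<^sup>2) / of_real (cmod z)"
    unfolding complex_norm_square by (simp add: sgn_eq)
  then show ?thesis using False by (simp add: power2_eq_square)
qed simp

lemma cmod_sgn_le: "cmod (sgn z) \<le> 1"
  by (simp add: norm_sgn)

context channel
begin

lemmas measurable_gain_intros = borel_measurable_times borel_measurable_cnj borel_measurable_sgn_complex
  component_measurable borel_measurable_complex_of_real

text \<open>The gains that touch relay k. Different relays have disjoint columns, which is the
  source of independence over k.\<close>

definition col :: "nat \<Rightarrow> (nat \<times> nat + nat \<times> nat) set"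
  where "col k = Inl ` ({k} \<times> {1..M}) \<union> Inr ` ({1..M} \<times> {k})"

lemma Inl_col [simp]: "Inl (k', m) \<in> col k \<longleftrightarrow> k' = k \<and> m \<in> {1..M}"
  and Inr_col [simp]: "Inr (m, k') \<in> col k \<longleftrightarrow> k' = k \<and> m \<in> {1..M}"
  by (auto simp: col_def)

lemma col_links: "k \<in> {1..K} \<Longrightarrow> col k \<subseteq> links K M"
  by (auto simp: col_def)

lemma disjoint_col: "disjoint_family_on col L"
  by (auto simp: disjoint_family_on_def col_def)

lemma flip_apply [simp]: "i \<in> links K M \<Longrightarrow> flip s x i = of_real (s i) * x i"
  by (simp add: flip_def)

lemma local_measurable:
  assumes "F \<in> borel_measurable (PiM B (\<lambda>_. borel))" "B \<subseteq> links K M"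
    and local: "\<And>x. F (restrict x B) = F x"
  shows "F \<in> borel_measurable (gains K M)"
proof -
  have "(\<lambda>x. restrict x B) \<in> measurable (gains K M) (PiM B (\<lambda>_. borel))"
    using assms(2) by (intro measurable_restrict component_measurable) auto
  from measurable_compose[OF this assms(1)] show ?thesis by (simp add: local)
qed

text \<open>The factor common to all \<open>a\<^sub>k\<close> and \<open>b\<^sub>k\<close> after summation over the third index. It uses \<open>sgn\<close>,
  which is odd everywhere; \<open>phase\<close> differs from it only at \<open>0\<close>.\<close>

definition G :: "nat \<Rightarrow> (nat \<times> nat + nat \<times> nat \<Rightarrow> complex) \<Rightarrow> complex"
  where "G k x = (\<Sum>m'\<in>{1..M}. cnj (sgn (f m' k x)) * cnj (sgn (h k m' x)))"

lemma G_restrict [simp]: "G k (restrict x (col k)) = G k x"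
  unfolding G_def by (intro sum.cong) auto

lemma G_measurable_col [measurable]: "G k \<in> borel_measurable (PiM (col k) (\<lambda>_. borel))"
  unfolding G_def by (intro borel_measurable_sum borel_measurable_times borel_measurable_cnj borel_measurable_sgn_complex measurable_component_singleton) auto

lemma G_measurable [measurable]: "k \<in> {1..K} \<Longrightarrow> G k \<in> borel_measurable (gains K M)"
  by (rule local_measurable[OF G_measurable_col col_links]) auto

lemma component_event: "i \<in> links K M \<Longrightarrow> {x \<in> space (gains K M). a < (cmod (x i))\<^sup>2} \<in> events"
  using component_measurable[of i] by measurable

lemma G_event: "k \<in> {1..K} \<Longrightarrow> {x \<in> space (gains K M). a < cmod (G k x)} \<in> events"
  using G_measurable[of k] by measurable

lemma norm_phases: "cmod (cnj (sgn z) * cnj (sgn w)) \<le> 1"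
  unfolding norm_mult complex_mod_cnj using cmod_sgn_le by (intro mult_le_one) auto

lemma norm_G_le: "cmod (G k x) \<le> real M"
  unfolding G_def using sum_norm_bound[of "{1..M}", OF norm_phases] by simp

text \<open>Every summand of \<open>G k\<close> contains one factor from each of the two gains of a
  pair; since \<open>sgn\<close> is odd, two equal signs cancel.\<close>

lemma G_flip:
  assumes "k \<in> {1..K}" and s: "\<And>i. s i \<in> {1, -1}" "\<And>m'. m' \<in> {1..M} \<Longrightarrow> s (Inl (k, m')) = s (Inr (m', k))"
  shows "G k (flip s x) = G k x"
  unfolding G_def
proof (intro sum.cong refl)
  fix m' assume m': "m' \<in> {1..M}"
  then show "cnj (sgn (f m' k (flip s x))) * cnj (sgn (h k m' (flip s x))) = cnj (sgn (f m' k x)) * cnj (sgn (h k m' x))"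
    using assms(1) s(2)[OF m'] s(1)[of "Inr (m', k)"] by (auto simp: sgn_mult sgn_minus)
qed

text \<open>The summands of \<open>G k\<close> use disjoint pairs of gains, have modulus at most
  one, and have mean zero because flipping \<open>h k m'\<close> alone negates them. Hoeffding's
  inequality then yields the scale sqrt M, against the worst case M of \<open>norm_G_le\<close>; the
  former sets truncation levels, the latter bounds second moments.\<close>

lemma G_tail:
  fixes y :: real
  assumes k: "k \<in> {1..K}" and y: "y \<ge> 0"
  shows "prob {x \<in> space (gains K M). cmod (G k x) > 2 * sqrt (M * y)} \<le> 4 * exp (- y)"
proof -
  let ?F = "\<lambda>m' x. cnj (sgn (f m' k x)) * cnj (sgn (h k m' x))"
  have ind: "indep_vars (\<lambda>_. borel) ?F {1..M}"
    by (rule indep_blocks[where B="\<lambda>m'. {Inl (k, m'), Inr (m', k)}"])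
       (use k in \<open>auto simp: disjoint_family_on_def intro!: borel_measurable_times borel_measurable_cnj borel_measurable_sgn_complex measurable_component_singleton\<close>)
  have E: "expectation (?F m') = 0" if "m' \<in> {1..M}" for m'
    by (rule expectation_odd[where s="\<lambda>i. if i = Inl (k, m') then - 1 else 1"])
       (use that k in \<open>auto simp: sgn_minus\<close>)
  have "prob {x \<in> space (gains K M). cmod ((\<Sum>m'\<in>{1..M}. ?F m' x) - (\<Sum>m'\<in>{1..M}. expectation (?F m')))
            > 2 * 1 * sqrt (card {1..M} * y)} \<le> 4 * exp (- y)"
    by (rule Hoeffding_complex[OF _ ind _ y]) (use norm_phases in auto)
  then show ?thesis by (simp add: E G_def)
qed

text \<open>In the expansion of \<open>G k\<close> only the summand m' = m has nonzero mean: there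
  the phases cancel and leave |f| |h|, with mean (sqrt pi / 2)^2. Any other summand contains the
  sign of \<open>h k m'\<close> exactly once.\<close>

lemma signal_mean:
  assumes k: "k \<in> {1..K}" and m: "m \<in> {1..M}"
  shows "expectation (\<lambda>x. f m k x * h k m x * G k x) = of_real (pi / 4)"
proof -
  let ?F = "\<lambda>m' x. f m k x * h k m x * (cnj (sgn (f m' k x)) * cnj (sgn (h k m' x)))"
  have L: "Inr (m, k) \<in> links K M" "Inl (k, m) \<in> links K M" using k m by auto
  have meas: "?F m' \<in> borel_measurable (gains K M)" if "m' \<in> {1..M}" for m'
    by (intro measurable_gain_intros) (use that k m in auto)
  have int: "integrable (gains K M) (\<lambda>x. cmod (f m k x) * cmod (h k m x))"
    and val: "expectation (\<lambda>x. cmod (f m k x) * cmod (h k m x)) = pi / 4"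
    using pair_integral[OF L _ cgauss_norm(1) cgauss_norm(1)] by (auto simp: cgauss_norm)
  have intF: "integrable (gains K M) (?F m')" if "m' \<in> {1..M}" for m'
  proof (rule Bochner_Integration.integrable_bound[OF int meas[OF that]], rule AE_I2)
    fix x show "norm (?F m' x) \<le> norm (cmod (f m k x) * cmod (h k m x))"
      unfolding norm_mult[of "f m k x * h k m x"] using norm_phases by (auto simp: norm_mult intro!: mult_left_le)
  qed
  have E: "expectation (?F m') = (if m' = m then of_real (pi / 4) else 0)" if m': "m' \<in> {1..M}" for m'
  proof (cases "m' = m")
    case True
    have "?F m = (\<lambda>x. of_real (cmod (f m k x) * cmod (h k m x)))"
    proof
      fix x
      have "?F m x = (f m k x * cnj (sgn (f m k x))) * (h k m x * cnj (sgn (h k m x)))" by (simp add: mult_ac)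
      then show "?F m x = of_real (cmod (f m k x) * cmod (h k m x))" by (simp add: mult_cnj_sgn)
    qed
    then have "expectation (?F m) = of_real (expectation (\<lambda>x. cmod (f m k x) * cmod (h k m x)))"
      by (simp only: integral_complex_of_real)
    then show ?thesis unfolding val using True by simp
  next
    case False
    have "expectation (?F m') = 0"
      by (rule expectation_odd[where s="\<lambda>i. if i = Inl (k, m') then - 1 else 1", OF _ meas[OF m']])
         (use False m m' k in \<open>auto simp: sgn_minus\<close>)
    then show ?thesis using False by simp
  qed
  have "expectation (\<lambda>x. f m k x * h k m x * G k x) = expectation (\<lambda>x. \<Sum>m'\<in>{1..M}. ?F m' x)"
    by (simp add: G_def sum_distrib_left)
  also have "\<dots> = (\<Sum>m'\<in>{1..M}. expectation (?F m'))"
    by (rule Bochner_Integration.integral_sum[OF intF])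
  also have "\<dots> = (\<Sum>m'\<in>{1..M}. if m' = m then of_real (pi / 4) else 0)"
    by (intro sum.cong refl E)
  also have "\<dots> = of_real (pi / 4)" using m by simp
  finally show ?thesis .
qed

text \<open>Truncated Hoeffding over the relays. A term exceeds its level only if |f|^2 or |h|^2
  exceeds 4 t or |G| exceeds 2 sqrt (2 M t), with total probability at most (2 + 2 + 4) exp (- 2 t).
  The exponent is 2 t rather than t because the square root of this probability enters the bias. The
  second moment uses |G| <= M and the unit variance of both gains.\<close>

lemma signal_tail:
  fixes c :: "nat \<Rightarrow> real" and C t :: real
  assumes m: "m \<in> {1..M}" and c: "\<And>k. k \<in> {1..K} \<Longrightarrow> 0 \<le> c k \<and> c k \<le> C" and C: "C > 0" and t: "t > 0"
  shows "prob {x \<in> space (gains K M).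
      cmod ((\<Sum>k\<in>{1..K}. of_real (c k) * (f m k x * h k m x * G k x)) - of_real (pi / 4 * (\<Sum>k\<in>{1..K}. c k)))
        > 2 * (C * (4 * t) * (2 * sqrt (M * (2 * t)))) * sqrt (K * t) + K * (C * M * sqrt (8 * exp (- (2 * t))))}
      \<le> K * (8 * exp (- (2 * t))) + 4 * exp (- t)"
proof -
  let ?X = "\<lambda>k x. of_real (c k) * (f m k x * h k m x * G k x)"
  let ?B = "C * (4 * t) * (2 * sqrt (M * (2 * t)))"
  have meas: "?X k \<in> borel_measurable (PiM (col k) (\<lambda>_. borel))" for k
    using m by (intro borel_measurable_times G_measurable_col measurable_component_singleton) auto
  have loc: "?X k (restrict x (col k)) = ?X k x" for k x using m by simp
  have meas'[measurable]: "?X k \<in> borel_measurable (gains K M)" if "k \<in> {1..K}" for k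
    by (rule local_measurable[where F="?X k", OF meas col_links[OF that] loc])
  have ind: "indep_vars (\<lambda>_. borel) ?X {1..K}"
    by (rule indep_blocks[where F="?X" and B=col, OF col_links disjoint_col meas loc])
  have E: "expectation (?X k) = of_real (pi / 4 * c k)" if "k \<in> {1..K}" for k
    using signal_mean[OF that m] by simp
  have int: "integrable (gains K M) (\<lambda>x. (cmod (f m k x))\<^sup>2 * (cmod (h k m x))\<^sup>2)"
    and val: "expectation (\<lambda>x. (cmod (f m k x))\<^sup>2 * (cmod (h k m x))\<^sup>2) = 1" if "k \<in> {1..K}" for k
    using pair_integral[OF _ _ _ cgauss_norm_square(1) cgauss_norm_square(1), of "Inr (m, k)" "Inl (k, m)"] that m
    by (auto simp: cgauss_norm_square)
  have bd: "(cmod (?X k x))\<^sup>2 \<le> (C * M)\<^sup>2 * ((cmod (f m k x))\<^sup>2 * (cmod (h k m x))\<^sup>2)" if "k \<in> {1..K}" for k x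
  proof -
    have "cmod (?X k x) \<le> C * (cmod (f m k x) * cmod (h k m x) * M)"
      unfolding norm_mult norm_of_real using c[OF that] norm_G_le by (intro mult_mono) auto
    then have "(cmod (?X k x))\<^sup>2 \<le> (C * (cmod (f m k x) * cmod (h k m x) * M))\<^sup>2"
      by (rule power_mono) simp
    then show ?thesis by (simp add: power_mult_distrib mult_ac)
  qed
  have sqi: "integrable (gains K M) (\<lambda>x. (cmod (?X k x))\<^sup>2)" if "k \<in> {1..K}" for k
    by (rule Bochner_Integration.integrable_bound[OF integrable_mult_right[OF int[OF that], of "(C * M)\<^sup>2"]])
       (use that bd in \<open>auto simp: abs_mult\<close>)
  have "prob {x \<in> space (gains K M). cmod ((\<Sum>k\<in>{1..K}. ?X k x) - (\<Sum>k\<in>{1..K}. expectation (?X k)))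
        > 2 * ?B * sqrt (card {1..K} * t) + card {1..K} * (C * M * sqrt (8 * exp (- (2 * t))))}
      \<le> card {1..K} * (8 * exp (- (2 * t))) + 4 * exp (- t)"
  proof (rule Hoeffding_complex_truncated[OF _ ind])
    fix k assume k: "k \<in> {1..K}"
    show "integrable (gains K M) (\<lambda>x. (cmod (?X k x))\<^sup>2)" by (rule sqi[OF k])
    have "expectation (\<lambda>x. (cmod (?X k x))\<^sup>2) \<le> expectation (\<lambda>x. (C * M)\<^sup>2 * ((cmod (f m k x))\<^sup>2 * (cmod (h k m x))\<^sup>2))"
      by (rule integral_mono[OF sqi[OF k] integrable_mult_right[OF int[OF k]] bd[OF k]])
    then show "expectation (\<lambda>x. (cmod (?X k x))\<^sup>2) \<le> (C * M)\<^sup>2" using val[OF k] by simp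
    let ?A1 = "{x \<in> space (gains K M). (cmod (f m k x))\<^sup>2 > 2 * (2 * t)}"
    let ?A2 = "{x \<in> space (gains K M). (cmod (h k m x))\<^sup>2 > 2 * (2 * t)}"
    let ?A3 = "{x \<in> space (gains K M). cmod (G k x) > 2 * sqrt (M * (2 * t))}"
    have [measurable]: "?A1 \<in> sets (gains K M)" "?A2 \<in> sets (gains K M)" "?A3 \<in> sets (gains K M)"
      by (rule component_event G_event; use k m in simp)+
    have "{x \<in> space (gains K M). cmod (?X k x) > ?B} \<subseteq> (?A1 \<union> ?A2) \<union> ?A3"
    proof (rule subsetI, rule ccontr)
      fix x assume x: "x \<in> {x \<in> space (gains K M). cmod (?X k x) > ?B}" and n: "x \<notin> (?A1 \<union> ?A2) \<union> ?A3"
      have sq: "sqrt (4 * t) * sqrt (4 * t) = 4 * t" using t by simp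
      have "cmod (f m k x) \<le> sqrt (4 * t)" "cmod (h k m x) \<le> sqrt (4 * t)"
        using x n by (auto intro!: real_le_rsqrt)
      then have "cmod (?X k x) \<le> C * ((sqrt (4 * t) * sqrt (4 * t)) * (2 * sqrt (M * (2 * t))))"
        unfolding norm_mult norm_of_real using c[OF k] n x t C by (intro mult_mono) auto
      then show False using x unfolding sq by (simp add: mult_ac)
    qed
    then have "prob {x \<in> space (gains K M). cmod (?X k x) > ?B} \<le> prob ((?A1 \<union> ?A2) \<union> ?A3)"
      by (intro finite_measure_mono) measurable
    also have "\<dots> \<le> (prob ?A1 + prob ?A2) + prob ?A3"
      by (intro order.trans[OF measure_Un_le] add_right_mono measure_Un_le) measurable
    also have "\<dots> \<le> (2 * exp (- (2 * t)) + 2 * exp (- (2 * t))) + 4 * exp (- (2 * t))"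
      using k m t by (intro add_mono component_tail G_tail) auto
    finally show "prob {x \<in> space (gains K M). cmod (?X k x) > ?B} \<le> 8 * exp (- (2 * t))" by simp
  qed (use C t M_pos in auto)
  moreover have "(\<Sum>k\<in>{1..K}. expectation (?X k)) = of_real (pi / 4 * (\<Sum>k\<in>{1..K}. c k))"
    unfolding sum_distrib_left of_real_sum by (intro sum.cong refl E)
  moreover have "card {1..K} = K" by simp
  ultimately show ?thesis by (simp only:)
qed

text \<open>Expanding |G|^2 as a double sum over a and b, the diagonal terms have modulus one almost
  everywhere and contribute M copies of the mean of y. A term with a and b distinct is odd in
  \<open>h k a\<close>, since y ignores all signs.\<close>

lemma weighted_mean:
  fixes y :: "_ \<Rightarrow> real"
  assumes k: "k \<in> {1..K}" and y: "integrable (gains K M) y"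
    and even: "\<And>s x. (\<And>i. s i \<in> {1, -1}) \<Longrightarrow> y (flip s x) = y x"
  shows "expectation (\<lambda>x. y x * (cmod (G k x))\<^sup>2) = M * expectation y"
proof -
  have [measurable]: "y \<in> borel_measurable (gains K M)" using y by auto
  let ?u = "\<lambda>a x. cnj (sgn (f a k x)) * cnj (sgn (h k a x))"
  let ?F = "\<lambda>a b x. of_real (y x) * (?u a x * cnj (?u b x))"
  have meas[measurable]: "?F a b \<in> borel_measurable (gains K M)" if "a \<in> {1..M}" "b \<in> {1..M}" for a b
    by (intro measurable_gain_intros) (use that k in auto)
  have intF: "integrable (gains K M) (?F a b)" if "a \<in> {1..M}" "b \<in> {1..M}" for a b
  proof (rule Bochner_Integration.integrable_bound[OF y meas[OF that]], rule AE_I2)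
    fix x
    have "cmod (?u a x * cnj (?u b x)) \<le> 1"
      unfolding norm_mult[of "?u a x"] complex_mod_cnj using norm_phases by (intro mult_le_one) auto
    then show "norm (?F a b x) \<le> norm (y x)"
      unfolding norm_mult[of "of_real (y x)"] by (auto intro!: mult_left_le)
  qed
  have E: "expectation (?F a b) = (if a = b then of_real (expectation y) else 0)" if ab: "a \<in> {1..M}" "b \<in> {1..M}" for a b
  proof (cases "a = b")
    case True
    have "expectation (?F a a) = expectation (\<lambda>x. of_real (y x) :: complex)"
    proof (rule integral_cong_AE)
      \<comment> \<open>Only almost everywhere, because \<open>sgn\<close> vanishes at 0.\<close>
      show "AE x in gains K M. ?F a a x = of_real (y x)"
        using AE_nonzero
      proof eventually_elim
        case (elim x)
        then have "f a k x \<noteq> 0" "h k a x \<noteq> 0" using ab k by auto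
        then have "cmod (?u a x) = 1" by (simp add: norm_mult norm_sgn)
        then show ?case by (simp only: complex_norm_square[symmetric]) simp
      qed
    qed (use ab in measurable)
    then show ?thesis using True by simp
  next
    case False
    have "expectation (?F a b) = 0"
      by (rule expectation_odd[where s="\<lambda>i. if i = Inl (k, a) then - 1 else 1", OF _ meas[OF ab]])
         (use False ab k in \<open>auto simp: sgn_minus even\<close>)
    then show ?thesis using False by simp
  qed
  have "of_real (expectation (\<lambda>x. y x * (cmod (G k x))\<^sup>2)) = expectation (\<lambda>x. of_real (y x * (cmod (G k x))\<^sup>2) :: complex)"
    by (rule integral_complex_of_real[symmetric])
  also have "\<dots> = expectation (\<lambda>x. \<Sum>a\<in>{1..M}. \<Sum>b\<in>{1..M}. ?F a b x)"
    by (intro Bochner_Integration.integral_cong refl)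
       (simp only: of_real_mult complex_norm_square G_def cnj_sum sum_product, simp only: sum_distrib_left)
  also have "\<dots> = (\<Sum>a\<in>{1..M}. \<Sum>b\<in>{1..M}. expectation (?F a b))"
    by (subst Bochner_Integration.integral_sum, intro Bochner_Integration.integrable_sum intF, assumption+,
        intro sum.cong refl Bochner_Integration.integral_sum intF)
  also have "\<dots> = (\<Sum>a\<in>{1..M}. \<Sum>b\<in>{1..M}. if a = b then of_real (expectation y) else 0)"
    by (intro sum.cong refl E)
  also have "\<dots> = of_real (M * expectation y)" by simp
  finally show ?thesis by (simp only: of_real_eq_iff)
qed

text \<open>The common form of the noise and of the diagonal interference; only the weight y at a
  relay differs. The squared \<open>G k\<close> is cut at 8 M t, the square of the level in
  \<open>G_tail\<close> at exponent 2 t, and the second moment again uses |G| <= M. The real terms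
  are embedded in the complex numbers to reuse the truncated inequality.\<close>

lemma weighted_tail:
  fixes y :: "nat \<Rightarrow> _ \<Rightarrow> real" and a b q t :: real
  assumes meas: "\<And>k. k \<in> {1..K} \<Longrightarrow> y k \<in> borel_measurable (PiM (col k) (\<lambda>_. borel))"
    and loc: "\<And>k x. k \<in> {1..K} \<Longrightarrow> y k (restrict x (col k)) = y k x"
    and nonneg: "\<And>k x. k \<in> {1..K} \<Longrightarrow> y k x \<ge> 0"
    and even: "\<And>k s x. k \<in> {1..K} \<Longrightarrow> (\<And>i. s i \<in> {1, -1}) \<Longrightarrow> y k (flip s x) = y k x"
    and sqi: "\<And>k. k \<in> {1..K} \<Longrightarrow> integrable (gains K M) (\<lambda>x. (y k x)\<^sup>2)"
    and sq: "\<And>k. k \<in> {1..K} \<Longrightarrow> expectation (\<lambda>x. (y k x)\<^sup>2) \<le> a\<^sup>2"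
    and tail: "\<And>k. k \<in> {1..K} \<Longrightarrow> prob {x \<in> space (gains K M). y k x > b} \<le> q"
    and pos: "a > 0" "b > 0" "q \<ge> 0" "t > 0"
  shows "prob {x \<in> space (gains K M).
      \<bar>(\<Sum>k\<in>{1..K}. y k x * (cmod (G k x))\<^sup>2) - M * (\<Sum>k\<in>{1..K}. expectation (y k))\<bar>
        > 2 * (b * (8 * M * t)) * sqrt (K * t) + K * (a * M\<^sup>2 * sqrt (q + 4 * exp (- (2 * t))))}
      \<le> K * (q + 4 * exp (- (2 * t))) + 4 * exp (- t)"
proof -
  let ?X = "\<lambda>k x. of_real (y k x * (cmod (G k x))\<^sup>2) :: complex"
  have y[measurable]: "y k \<in> borel_measurable (gains K M)" if "k \<in> {1..K}" for k
    by (rule local_measurable[OF meas[OF that] col_links[OF that] loc[OF that]])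
  have inty: "integrable (gains K M) (y k)" if "k \<in> {1..K}" for k
    by (rule square_integrable_imp_integrable) (use that sqi in auto)
  have meas': "?X k \<in> borel_measurable (PiM (col k) (\<lambda>_. borel))" if "k \<in> {1..K}" for k
    using meas[OF that] by measurable
  have ind: "indep_vars (\<lambda>_. borel) ?X {1..K}"
    by (rule indep_blocks[where F="?X" and B=col, OF col_links disjoint_col meas']) (simp_all add: loc)
  have E: "expectation (?X k) = of_real (M * expectation (y k))" if "k \<in> {1..K}" for k
    unfolding integral_complex_of_real using weighted_mean[OF that inty[OF that] even[OF that]] by simp
  have nX: "cmod (?X k x) = y k x * (cmod (G k x))\<^sup>2" if "k \<in> {1..K}" for k x
    using nonneg[OF that] by (simp add: norm_mult norm_power)
  have bd: "(cmod (?X k x))\<^sup>2 \<le> (M\<^sup>2)\<^sup>2 * (y k x)\<^sup>2" if "k \<in> {1..K}" for k x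
  proof -
    have "cmod (?X k x) \<le> y k x * (real M)\<^sup>2"
      unfolding nX[OF that] using nonneg[OF that] norm_G_le by (intro mult_left_mono power_mono) auto
    then have "(cmod (?X k x))\<^sup>2 \<le> (y k x * (real M)\<^sup>2)\<^sup>2" by (rule power_mono) simp
    then show ?thesis by (simp add: power_mult_distrib mult_ac)
  qed
  have sqX: "integrable (gains K M) (\<lambda>x. (cmod (?X k x))\<^sup>2)" if "k \<in> {1..K}" for k
    by (rule Bochner_Integration.integrable_bound[OF integrable_mult_right[OF sqi[OF that], of "(M\<^sup>2)\<^sup>2"]])
       (use that bd in \<open>auto simp: abs_mult\<close>)
  have "prob {x \<in> space (gains K M). cmod ((\<Sum>k\<in>{1..K}. ?X k x) - (\<Sum>k\<in>{1..K}. expectation (?X k)))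
        > 2 * (b * (8 * M * t)) * sqrt (card {1..K} * t) + card {1..K} * (a * M\<^sup>2 * sqrt (q + 4 * exp (- (2 * t))))}
      \<le> card {1..K} * (q + 4 * exp (- (2 * t))) + 4 * exp (- t)"
  proof (rule Hoeffding_complex_truncated[OF _ ind])
    fix k assume k: "k \<in> {1..K}"
    show "integrable (gains K M) (\<lambda>x. (cmod (?X k x))\<^sup>2)" by (rule sqX[OF k])
    have "expectation (\<lambda>x. (cmod (?X k x))\<^sup>2) \<le> expectation (\<lambda>x. (M\<^sup>2)\<^sup>2 * (y k x)\<^sup>2)"
      by (rule integral_mono[OF sqX[OF k] integrable_mult_right[OF sqi[OF k]] bd[OF k]])
    also have "\<dots> \<le> (M\<^sup>2)\<^sup>2 * a\<^sup>2" using sq[OF k] by (simp add: mult_left_mono)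
    finally show "expectation (\<lambda>x. (cmod (?X k x))\<^sup>2) \<le> (a * M\<^sup>2)\<^sup>2" by (simp add: power_mult_distrib mult_ac)
    let ?A1 = "{x \<in> space (gains K M). y k x > b}"
    let ?A3 = "{x \<in> space (gains K M). cmod (G k x) > 2 * sqrt (M * (2 * t))}"
    have [measurable]: "?A1 \<in> sets (gains K M)" using y[OF k] by measurable
    have [measurable]: "?A3 \<in> sets (gains K M)" by (rule G_event[OF k])
    have "{x \<in> space (gains K M). cmod (?X k x) > b * (8 * M * t)} \<subseteq> ?A1 \<union> ?A3"
    proof (rule subsetI, rule ccontr)
      fix x assume x: "x \<in> {x \<in> space (gains K M). cmod (?X k x) > b * (8 * M * t)}" and n: "x \<notin> ?A1 \<union> ?A3"
      have "(cmod (G k x))\<^sup>2 \<le> (2 * sqrt (M * (2 * t)))\<^sup>2" using x n by (intro power_mono) auto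
      also have "\<dots> = 8 * M * t" using pos by (simp add: power_mult_distrib)
      finally have "cmod (?X k x) \<le> b * (8 * M * t)"
        unfolding nX[OF k] using n x pos nonneg[OF k] by (intro mult_mono) auto
      then show False using x by simp
    qed
    then have "prob {x \<in> space (gains K M). cmod (?X k x) > b * (8 * M * t)} \<le> prob (?A1 \<union> ?A3)"
      by (intro finite_measure_mono) measurable
    also have "\<dots> \<le> prob ?A1 + prob ?A3" by (intro measure_Un_le) measurable
    also have "\<dots> \<le> q + 4 * exp (- (2 * t))"
      using k pos by (intro add_mono tail G_tail) auto
    finally show "prob {x \<in> space (gains K M). cmod (?X k x) > b * (8 * M * t)} \<le> q + 4 * exp (- (2 * t))" .
  qed (use pos M_pos in \<open>auto intro!: add_nonneg_pos\<close>)
  moreover have "cmod ((\<Sum>k\<in>{1..K}. ?X k x) - (\<Sum>k\<in>{1..K}. expectation (?X k))) =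
      \<bar>(\<Sum>k\<in>{1..K}. y k x * (cmod (G k x))\<^sup>2) - M * (\<Sum>k\<in>{1..K}. expectation (y k))\<bar>" for x
  proof -
    have "(\<Sum>k\<in>{1..K}. ?X k x) - (\<Sum>k\<in>{1..K}. expectation (?X k)) =
      of_real ((\<Sum>k\<in>{1..K}. y k x * (cmod (G k x))\<^sup>2) - M * (\<Sum>k\<in>{1..K}. expectation (y k)))"
      using E by (simp add: sum_distrib_left del: integral_complex_of_real)
    then show ?thesis by (simp only: norm_of_real)
  qed
  ultimately show ?thesis by simp
qed

end

section \<open>Random signs and the interference\<close>

definition sg :: "bool \<Rightarrow> real" where "sg b = (if b then 1 else - 1)"

text \<open>Independent Rademacher signs, coded by booleans through \<open>sg\<close>. Indices
  outside J take the default \<open>True\<close>, that is the sign + 1.\<close>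

definition random_signs :: "'j set \<Rightarrow> ('j \<Rightarrow> bool) pmf"
  where "random_signs J = Pi_pmf J True (\<lambda>_. pmf_of_set UNIV)"

lemma indep_random_signs:
  assumes "finite J" "\<And>j. j \<in> J \<Longrightarrow> F j \<in> measurable (count_space UNIV) N"
  shows "prob_space.indep_vars (measure_pmf (random_signs J)) (\<lambda>_. N) (\<lambda>j e. F j (e j)) J"
  unfolding random_signs_def
  by (rule prob_space.indep_vars_compose2[OF measure_pmf.prob_space_axioms indep_vars_Pi_pmf]) (use assms in auto)

lemma expectation_random_sign:
  assumes "finite J" "j \<in> J"
  shows "measure_pmf.expectation (random_signs J) (\<lambda>e. sg (e j)) = 0"
proof -
  have "measure_pmf.expectation (random_signs J) (\<lambda>e. sg (e j)) =
      measure_pmf.expectation (map_pmf (\<lambda>e. e j) (random_signs J)) sg"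
    by simp
  also have "map_pmf (\<lambda>e. e j) (random_signs J) = pmf_of_set UNIV"
    using assms by (simp add: random_signs_def Pi_pmf_component)
  also have "measure_pmf.expectation (pmf_of_set UNIV) sg = 0"
    by (simp add: integral_pmf_of_set UNIV_bool sg_def)
  finally show ?thesis .
qed

text \<open>The tail, the mean square and the worst case of one Rademacher sum, which are exactly
  what truncated Hoeffding requires of its square. The mean square follows from orthogonality of the
  signs.\<close>

lemma random_sign_sum:
  fixes v :: "'j \<Rightarrow> complex" and V t :: real
  assumes J: "finite J" and v: "\<And>j. j \<in> J \<Longrightarrow> cmod (v j) \<le> V" and V: "V > 0" and t: "t \<ge> 0"
  defines "T \<equiv> \<lambda>e. \<Sum>j\<in>J. of_real (sg (e j)) * v j"
  shows "measure_pmf.prob (random_signs J) {e. cmod (T e) > 2 * V * sqrt (card J * t)} \<le> 4 * exp (- t)"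
    and "measure_pmf.expectation (random_signs J) (\<lambda>e. (cmod (T e))\<^sup>2) = (\<Sum>j\<in>J. (cmod (v j))\<^sup>2)"
    and "cmod (T e) \<le> card J * V"
proof -
  let ?R = "random_signs J"
  let ?X = "\<lambda>j e. of_real (sg (e j)) * v j"
  have ind: "prob_space.indep_vars (measure_pmf ?R) (\<lambda>_. borel) ?X J" by (rule indep_random_signs[OF J]) simp
  have nX: "cmod (?X j e) = cmod (v j)" for j e by (simp add: norm_mult sg_def)
  have E: "measure_pmf.expectation ?R (?X j) = 0" if "j \<in> J" for j
    using expectation_random_sign[OF J that] by simp
  have Z: "(\<Sum>j\<in>J. measure_pmf.expectation ?R (?X j)) = 0" by (intro sum.neutral ballI E)
  have "measure_pmf.prob ?R {e \<in> space (measure_pmf (random_signs J)). cmod ((\<Sum>j\<in>J. ?X j e) - (\<Sum>j\<in>J. measure_pmf.expectation ?R (?X j))) > 2 * V * sqrt (card J * t)} \<le> 4 * exp (- t)"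
    by (rule measure_pmf.Hoeffding_complex[OF J ind V t]) (simp add: nX v)
  then show "measure_pmf.prob (random_signs J) {e. cmod (T e) > 2 * V * sqrt (card J * t)} \<le> 4 * exp (- t)"
    unfolding Z by (simp add: T_def)
  show "cmod (T e) \<le> card J * V"
    unfolding T_def by (rule order.trans[OF norm_sum]) (use sum_bounded_above[of J, OF v] in \<open>simp add: nX\<close>)
  have int: "integrable (measure_pmf (random_signs J)) (\<lambda>e. sg (e j) * sg (e l))" for j l
    by (rule measure_pmf.integrable_const_bound[where B=1]) (simp_all add: sg_def)
  have E2: "measure_pmf.expectation ?R (\<lambda>e. sg (e j) * sg (e l)) = (if j = l then 1 else 0)" if jl: "j \<in> J" "l \<in> J" for j l
  proof (cases "j = l")
    case True
    have "(\<lambda>e. sg (e l) * sg (e l)) = (\<lambda>e. 1)" by (simp add: sg_def fun_eq_iff)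
    then show ?thesis using True by simp
  next
    case False
    have int1: "integrable (measure_pmf (random_signs J)) (\<lambda>e. sg (e i))" for i
      by (rule measure_pmf.integrable_const_bound[where B=1]) (simp_all add: sg_def)
    have "prob_space.indep_vars (measure_pmf ?R) (\<lambda>_. borel) (\<lambda>i e. sg (e i)) {j, l}"
      by (rule prob_space.indep_vars_subset[OF measure_pmf.prob_space_axioms indep_random_signs[OF J]]) (use jl in auto)
    then have "measure_pmf.expectation ?R (\<lambda>e. \<Prod>i\<in>{j, l}. sg (e i)) = (\<Prod>i\<in>{j, l}. measure_pmf.expectation ?R (\<lambda>e. sg (e i)))"
      using int1 by (intro prob_space.indep_vars_lebesgue_integral[OF measure_pmf.prob_space_axioms]) auto
    then show ?thesis using False jl expectation_random_sign[OF J] by simp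
  qed
  \<comment> \<open>Taking real parts of T times its conjugate turns the square into a real
    quadratic form in the signs, so that real expectations apply.\<close>
  have "(cmod (T e))\<^sup>2 = (\<Sum>j\<in>J. \<Sum>l\<in>J. sg (e j) * sg (e l) * Re (v j * cnj (v l)))" for e
  proof -
    have "of_real ((cmod (T e))\<^sup>2) = T e * cnj (T e)" by (simp add: complex_norm_square del: of_real_power)
    also have "\<dots> = (\<Sum>j\<in>J. \<Sum>l\<in>J. of_real (sg (e j) * sg (e l)) * (v j * cnj (v l)))"
      unfolding T_def cnj_sum sum_product by (intro sum.cong refl) simp
    finally have "Re (of_real ((cmod (T e))\<^sup>2)) = Re (\<Sum>j\<in>J. \<Sum>l\<in>J. of_real (sg (e j) * sg (e l)) * (v j * cnj (v l)))"
      by (rule arg_cong)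
    then show ?thesis by simp
  qed
  then have "measure_pmf.expectation ?R (\<lambda>e. (cmod (T e))\<^sup>2) = measure_pmf.expectation ?R (\<lambda>e. \<Sum>j\<in>J. \<Sum>l\<in>J. sg (e j) * sg (e l) * Re (v j * cnj (v l)))"
    by presburger
  also have "\<dots> = (\<Sum>j\<in>J. \<Sum>l\<in>J. measure_pmf.expectation ?R (\<lambda>e. sg (e j) * sg (e l) * Re (v j * cnj (v l))))"
    by (subst Bochner_Integration.integral_sum, intro Bochner_Integration.integrable_sum integrable_mult_left int,
        intro sum.cong refl Bochner_Integration.integral_sum integrable_mult_left int)
  also have "\<dots> = (\<Sum>j\<in>J. \<Sum>l\<in>J. if j = l then Re (v j * cnj (v l)) else 0)"
    by (intro sum.cong refl) (simp add: E2 del: times_complex.sel)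
  also have "\<dots> = (\<Sum>j\<in>J. (cmod (v j))\<^sup>2)"
    using J by (simp add: cmod_def power2_eq_square)
  finally show "measure_pmf.expectation ?R (\<lambda>e. (cmod (T e))\<^sup>2) = (\<Sum>j\<in>J. (cmod (v j))\<^sup>2)" .
qed

text \<open>Drawn row by row, so that a product law over I gives independence of functions of
  separate rows directly.\<close>

definition random_sign_matrix :: "'i set \<Rightarrow> 'j set \<Rightarrow> ('i \<Rightarrow> 'j \<Rightarrow> bool) pmf"
  where "random_sign_matrix I J = Pi_pmf I (\<lambda>_. True) (\<lambda>_. random_signs J)"

text \<open>Finite support turns averages over the signs into finite sums, which commute with the
  integral over the gains.\<close>

lemma finite_random_sign_matrix:
  assumes "finite I" "finite J"
  shows "finite (set_pmf (random_sign_matrix I J))"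
  using assms by (auto simp: random_sign_matrix_def random_signs_def set_Pi_pmf intro!: finite_PiE_dflt)

text \<open>The squared row sums are independent over I, with means equal to the diagonal sums. Each
  is cut at the square of 2 V sqrt (2 card J t), which fails with probability at most 4 exp (- 2 t);
  the worst case (card J * V)^2 plays the role of A in the bias.\<close>

lemma random_sign_quadratic:
  fixes v :: "'i \<Rightarrow> 'j \<Rightarrow> complex" and V t :: real
  assumes I: "finite I" and J: "finite J" "J \<noteq> {}"
    and v: "\<And>i j. i \<in> I \<Longrightarrow> j \<in> J \<Longrightarrow> cmod (v i j) \<le> V" and V: "V > 0" and t: "t > 0"
  shows "measure_pmf.prob (random_sign_matrix I J)
      {r. \<bar>\<Sum>i\<in>I. (cmod (\<Sum>j\<in>J. of_real (sg (r i j)) * v i j))\<^sup>2 - (\<Sum>j\<in>J. (cmod (v i j))\<^sup>2)\<bar>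
        > 2 * (8 * V\<^sup>2 * card J * t) * sqrt (card I * t) + card I * ((card J * V)\<^sup>2 * sqrt (4 * exp (- (2 * t))))}
      \<le> card I * (4 * exp (- (2 * t))) + 4 * exp (- t)"
proof -
  let ?R = "random_sign_matrix I J"
  let ?T = "\<lambda>i e. \<Sum>j\<in>J. of_real (sg (e j)) * v i j"
  let ?X = "\<lambda>i r. of_real ((cmod (?T i (r i)))\<^sup>2) :: complex"
  have J0: "card J > 0" using J by (simp add: card_gt_0_iff)
  have comp: "map_pmf (\<lambda>r. r i) (random_sign_matrix I J) = random_signs J" if "i \<in> I" for i
    using that I by (simp add: random_sign_matrix_def Pi_pmf_component)
  have Ecomp: "measure_pmf.expectation ?R (\<lambda>r. g (r i)) = measure_pmf.expectation (random_signs J) g"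
    if "i \<in> I" for i and g :: "_ \<Rightarrow> real"
    unfolding comp[OF that, symmetric] by simp
  have Pcomp: "measure_pmf.prob ?R {r. Q (r i)} = measure_pmf.prob (random_signs J) {e. Q e}" if "i \<in> I" for i Q
    unfolding comp[OF that, symmetric] by (simp add: vimage_def)
  have ind: "prob_space.indep_vars (measure_pmf ?R) (\<lambda>_. borel) ?X I"
    unfolding random_sign_matrix_def
    by (rule prob_space.indep_vars_compose2[OF measure_pmf.prob_space_axioms indep_vars_Pi_pmf[OF I]]) simp
  have nT: "cmod (?T i e) \<le> card J * V" if "i \<in> I" for i e
    by (rule random_sign_sum(3)[OF J(1) v[OF that] V less_imp_le[OF t]])
  have nX: "cmod (?X i r) \<le> (card J * V)\<^sup>2" if "i \<in> I" for i r
    unfolding norm_of_real using nT[OF that, of "r i"] by (simp add: power_mono)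
  have nX2: "(cmod (?X i r))\<^sup>2 \<le> ((card J * V)\<^sup>2)\<^sup>2" if "i \<in> I" for i r
    by (rule power_mono[OF nX[OF that] norm_ge_zero])
  have E: "measure_pmf.expectation ?R (?X i) = of_real (\<Sum>j\<in>J. (cmod (v i j))\<^sup>2)" if "i \<in> I" for i
    unfolding integral_complex_of_real Ecomp[OF that, of "\<lambda>e. (cmod (?T i e))\<^sup>2"]
    by (intro arg_cong[where f=of_real] random_sign_sum(2)[where V=V and t=t]) (use J v that V t in auto)
  have sqi: "integrable (measure_pmf (random_sign_matrix I J)) (\<lambda>r. (cmod (?X i r))\<^sup>2)" if "i \<in> I" for i
    using nX2[OF that] by (intro measure_pmf.integrable_const_bound[where B="((card J * V)\<^sup>2)\<^sup>2"] AE_I2)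
      (simp_all only: real_norm_def abs_power2, simp)
  have "measure_pmf.prob ?R {r \<in> space (measure_pmf (random_sign_matrix I J)). cmod ((\<Sum>i\<in>I. ?X i r) - (\<Sum>i\<in>I. measure_pmf.expectation ?R (?X i)))
      > 2 * (8 * V\<^sup>2 * card J * t) * sqrt (card I * t) + card I * ((card J * V)\<^sup>2 * sqrt (4 * exp (- (2 * t))))}
      \<le> card I * (4 * exp (- (2 * t))) + 4 * exp (- t)"
  proof (rule measure_pmf.Hoeffding_complex_truncated[OF I ind])
    fix i assume i: "i \<in> I"
    show "integrable (measure_pmf (random_sign_matrix I J)) (\<lambda>r. (cmod (?X i r))\<^sup>2)" by (rule sqi[OF i])
    have "measure_pmf.expectation ?R (\<lambda>r. (cmod (?X i r))\<^sup>2) \<le> measure_pmf.expectation ?R (\<lambda>r. ((card J * V)\<^sup>2)\<^sup>2)"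
      by (intro integral_mono sqi[OF i] nX2[OF i]) simp
    then show "measure_pmf.expectation ?R (\<lambda>r. (cmod (?X i r))\<^sup>2) \<le> ((card J * V)\<^sup>2)\<^sup>2" by simp
    have sq: "(2 * V * sqrt (card J * (2 * t)))\<^sup>2 = 8 * V\<^sup>2 * card J * t"
      using t by (simp add: power_mult_distrib)
    have "measure_pmf.prob ?R {r \<in> space (measure_pmf (random_sign_matrix I J)). cmod (?X i r) > 8 * V\<^sup>2 * card J * t}
      = measure_pmf.prob ?R {r. (2 * V * sqrt (card J * (2 * t)))\<^sup>2 < (cmod (?T i (r i)))\<^sup>2}"
      by (intro arg_cong[where f="measure_pmf.prob ?R"]) (simp add: sq del: of_real_power)
    also have "\<dots> \<le> measure_pmf.prob ?R {r. cmod (?T i (r i)) > 2 * V * sqrt (card J * (2 * t))}"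
      by (rule measure_pmf.finite_measure_mono) (auto dest: power_less_imp_less_base[OF _ norm_ge_zero])
    also have "\<dots> = measure_pmf.prob (random_signs J) {e. cmod (?T i e) > 2 * V * sqrt (card J * (2 * t))}"
      by (rule Pcomp[OF i])
    also have "\<dots> \<le> 4 * exp (- (2 * t))"
      by (rule random_sign_sum(1)[OF J(1) v[OF i] V]) (use t in auto)
    finally show "measure_pmf.prob ?R {r \<in> space (measure_pmf (random_sign_matrix I J)). cmod (?X i r) > 8 * V\<^sup>2 * card J * t} \<le> 4 * exp (- (2 * t))" .
  qed (use V t J0 in auto)
  moreover have ES: "(\<Sum>i\<in>I. measure_pmf.expectation ?R (?X i)) = (\<Sum>i\<in>I. of_real (\<Sum>j\<in>J. (cmod (v i j))\<^sup>2))"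
    by (intro sum.cong refl E)
  moreover have "cmod ((\<Sum>i\<in>I. ?X i r) - (\<Sum>i\<in>I. measure_pmf.expectation ?R (?X i))) =
     \<bar>\<Sum>i\<in>I. (cmod (\<Sum>j\<in>J. of_real (sg (r i j)) * v i j))\<^sup>2 - (\<Sum>j\<in>J. (cmod (v i j))\<^sup>2)\<bar>" for r
  proof -
    have "(\<Sum>i\<in>I. ?X i r) - (\<Sum>i\<in>I. measure_pmf.expectation ?R (?X i)) =
        of_real (\<Sum>i\<in>I. (cmod (?T i (r i)))\<^sup>2 - (\<Sum>j\<in>J. (cmod (v i j))\<^sup>2))"
      unfolding ES by (simp only: of_real_sum sum_subtractf of_real_diff)
    then show ?thesis by (simp only: norm_of_real)
  qed
  ultimately show ?thesis by (simp only: space_measure_pmf UNIV_I simp_thms)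
qed

section \<open>Deviations of noise, diagonal interference and off-diagonal interference\<close>

context channel
begin

text \<open>The weight here is w |f|^2. Its level 4 t W has failure probability 2 exp (- 2 t), which
  with the 4 exp (- 2 t) of \<open>G k\<close> makes 6; the factor 4 W is the root of the fourth
  moment bound 16 W^2.\<close>

lemma noise_tail:
  fixes w :: "nat \<Rightarrow> real" and W t :: real
  assumes m: "m \<in> {1..M}" and w: "\<And>k. k \<in> {1..K} \<Longrightarrow> 0 \<le> w k \<and> w k \<le> W" and W: "W > 0" and t: "t > 0"
  shows "prob {x \<in> space (gains K M).
      \<bar>(\<Sum>k\<in>{1..K}. w k * (cmod (f m k x))\<^sup>2 * (cmod (G k x))\<^sup>2) - M * (\<Sum>k\<in>{1..K}. w k)\<bar>
        > 2 * (W * (4 * t) * (8 * M * t)) * sqrt (K * t) + K * (4 * W * M\<^sup>2 * sqrt (6 * exp (- (2 * t))))}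
      \<le> K * (6 * exp (- (2 * t))) + 4 * exp (- t)"
proof -
  let ?y = "\<lambda>k x. w k * (cmod (f m k x))\<^sup>2"
  have L: "Inr (m, k) \<in> links K M" if "k \<in> {1..K}" for k using that m by auto
  have E: "expectation (?y k) = w k" if "k \<in> {1..K}" for k
    using component_integral[OF L[OF that] cgauss_norm_square(1)] by (simp add: cgauss_norm_square)
  have i4: "integrable (gains K M) (\<lambda>x. (cmod (f m k x)) ^ 4)" "expectation (\<lambda>x. (cmod (f m k x)) ^ 4) \<le> 16"
    if "k \<in> {1..K}" for k
    using component_integral[OF L[OF that] cgauss_norm_4(1)] cgauss_norm_4(2) by auto
  have sq: "(?y k x)\<^sup>2 = (w k)\<^sup>2 * (cmod (f m k x)) ^ 4" for k x
    by (simp add: power_mult_distrib flip: power_mult)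
  have "prob {x \<in> space (gains K M).
      \<bar>(\<Sum>k\<in>{1..K}. ?y k x * (cmod (G k x))\<^sup>2) - M * (\<Sum>k\<in>{1..K}. expectation (?y k))\<bar>
        > 2 * (W * (4 * t) * (8 * M * t)) * sqrt (K * t) + K * (4 * W * M\<^sup>2 * sqrt (2 * exp (- (2 * t)) + 4 * exp (- (2 * t))))}
      \<le> K * (2 * exp (- (2 * t)) + 4 * exp (- (2 * t))) + 4 * exp (- t)"
  proof (rule weighted_tail)
    fix k assume k: "k \<in> {1..K}"
    show "?y k \<in> borel_measurable (PiM (col k) (\<lambda>_. borel))"
      using measurable_component_singleton[of "Inr (m, k)" "col k" "\<lambda>_. borel"] m by auto
    show "?y k (restrict x (col k)) = ?y k x" for x using m by simp
    show "?y k x \<ge> 0" for x using w[OF k] by simp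
    show "?y k (flip s x) = ?y k x" if "\<And>i. s i \<in> {1, - 1}" for s x
      using that[of "Inr (m, k)"] k m by (auto simp: norm_mult)
    show "integrable (gains K M) (\<lambda>x. (?y k x)\<^sup>2)" unfolding sq using i4[OF k] by simp
    have "(w k)\<^sup>2 * expectation (\<lambda>x. (cmod (f m k x)) ^ 4) \<le> W\<^sup>2 * 16"
      using w[OF k] i4[OF k] by (intro mult_mono power_mono) auto
    then show "expectation (\<lambda>x. (?y k x)\<^sup>2) \<le> (4 * W)\<^sup>2" unfolding sq by (simp add: power_mult_distrib)
    have "prob {x \<in> space (gains K M). ?y k x > W * (4 * t)} \<le> prob {x \<in> space (gains K M). (cmod (f m k x))\<^sup>2 > 2 * (2 * t)}"
    proof (rule finite_measure_mono)
      show "{x \<in> space (gains K M). ?y k x > W * (4 * t)} \<subseteq> {x \<in> space (gains K M). (cmod (f m k x))\<^sup>2 > 2 * (2 * t)}"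
      proof (rule subsetI, rule ccontr)
        fix x assume x: "x \<in> {x \<in> space (gains K M). ?y k x > W * (4 * t)}"
          and n: "x \<notin> {x \<in> space (gains K M). (cmod (f m k x))\<^sup>2 > 2 * (2 * t)}"
        have "?y k x \<le> W * (4 * t)" using n x w[OF k] W t by (intro mult_mono) auto
        then show False using x by simp
      qed
      show "{x \<in> space (gains K M). (cmod (f m k x))\<^sup>2 > 2 * (2 * t)} \<in> events"
        by (rule component_event[OF L[OF k]])
    qed
    also have "\<dots> \<le> 2 * exp (- (2 * t))" by (rule component_tail[OF L[OF k]])
    finally show "prob {x \<in> space (gains K M). ?y k x > W * (4 * t)} \<le> 2 * exp (- (2 * t))" .
  qed (use W t in auto)
  moreover have "(\<Sum>k\<in>{1..K}. expectation (?y k)) = (\<Sum>k\<in>{1..K}. w k)" by (intro sum.cong refl E)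
  moreover have "2 * exp (- (2 * t)) + 4 * exp (- (2 * t)) = 6 * exp (- (2 * t))" by simp
  ultimately show ?thesis by (simp only:)
qed

text \<open>The sources share \<open>f m k\<close> and \<open>G k\<close>, so the sum over them
  stays inside the weight at relay k, and independence is used over k only. With all squared gains
  at most 4 t the weight is at most 16 t^2 M W; one forward and at most M backward gains may violate
  this, hence 2 + 2 M. The constant 16 M W is the root of M^2 W^2 times 256, the square of the
  fourth moment bound.\<close>

lemma diagonal_tail:
  fixes w :: "nat \<Rightarrow> nat \<Rightarrow> real" and W t :: real
  assumes m: "m \<in> {1..M}" and Q: "Q \<subseteq> {1..M}"
    and w: "\<And>k n. k \<in> {1..K} \<Longrightarrow> n \<in> Q \<Longrightarrow> 0 \<le> w k n \<and> w k n \<le> W" and W: "W > 0" and t: "t > 0"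
  shows "prob {x \<in> space (gains K M).
      \<bar>(\<Sum>k\<in>{1..K}. (\<Sum>n\<in>Q. w k n * ((cmod (f m k x))\<^sup>2 * (cmod (h k n x))\<^sup>2)) * (cmod (G k x))\<^sup>2)
          - M * (\<Sum>k\<in>{1..K}. \<Sum>n\<in>Q. w k n)\<bar>
        > 2 * (M * W * (16 * t\<^sup>2) * (8 * M * t)) * sqrt (K * t)
          + K * (16 * M * W * M\<^sup>2 * sqrt ((2 + 2 * M) * exp (- (2 * t)) + 4 * exp (- (2 * t))))}
      \<le> K * ((2 + 2 * M) * exp (- (2 * t)) + 4 * exp (- (2 * t))) + 4 * exp (- t)"
proof -
  let ?z = "\<lambda>k n x. (cmod (f m k x))\<^sup>2 * (cmod (h k n x))\<^sup>2"
  let ?y = "\<lambda>k x. \<Sum>n\<in>Q. w k n * ?z k n x"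
  have finQ: "finite Q" and cQ: "card Q \<le> M"
    using Q finite_subset card_mono[OF _ Q] by auto
  have L: "Inr (m, k) \<in> links K M" "\<And>n. n \<in> Q \<Longrightarrow> Inl (k, n) \<in> links K M" if "k \<in> {1..K}" for k using that m Q by auto
  have z: "integrable (gains K M) (?z k n)" "expectation (?z k n) = 1" if "k \<in> {1..K}" "n \<in> Q" for k n
    using pair_integral[OF L(1) L(2) _ cgauss_norm_square(1) cgauss_norm_square(1)] that by (auto simp: cgauss_norm_square)
  have z4: "integrable (gains K M) (\<lambda>x. (?z k n x)\<^sup>2)" "expectation (\<lambda>x. (?z k n x)\<^sup>2) \<le> 256" if "k \<in> {1..K}" "n \<in> Q" for k n
  proof -
    have "(?z k n x)\<^sup>2 = (cmod (f m k x)) ^ 4 * (cmod (h k n x)) ^ 4" for x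
      by (simp add: power_mult_distrib flip: power_mult)
    then show "integrable (gains K M) (\<lambda>x. (?z k n x)\<^sup>2)" "expectation (\<lambda>x. (?z k n x)\<^sup>2) \<le> 256"
      using pair_integral[OF L(1) L(2) _ cgauss_norm_4(1) cgauss_norm_4(1)] that
        mult_mono[OF cgauss_norm_4(2) cgauss_norm_4(2)] by auto
  qed
  have E: "expectation (?y k) = (\<Sum>n\<in>Q. w k n)" if "k \<in> {1..K}" for k
    using z that by (subst Bochner_Integration.integral_sum) auto
  have sq: "(?y k x)\<^sup>2 \<le> M * (\<Sum>n\<in>Q. W\<^sup>2 * (?z k n x)\<^sup>2)" if "k \<in> {1..K}" for k x
  proof -
    \<comment> \<open>Cauchy-Schwarz over the sources replaces mixed moments of different
      \<open>h k n\<close> by fourth moments.\<close>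
    have "(?y k x)\<^sup>2 \<le> card Q * (\<Sum>n\<in>Q. (w k n * ?z k n x)\<^sup>2)"
      by (subst mult.commute) (rule sum_squared_le_sum_of_squares)
    also have "\<dots> \<le> M * (\<Sum>n\<in>Q. (w k n * ?z k n x)\<^sup>2)"
      using cQ by (intro mult_right_mono sum_nonneg) auto
    also have "\<dots> \<le> M * (\<Sum>n\<in>Q. W\<^sup>2 * (?z k n x)\<^sup>2)"
    proof (intro mult_left_mono sum_mono)
      fix n assume "n \<in> Q"
      then show "(w k n * ?z k n x)\<^sup>2 \<le> W\<^sup>2 * (?z k n x)\<^sup>2"
        using w[OF that] unfolding power_mult_distrib[of "w k n"] by (intro mult_right_mono power_mono) auto
    qed simp
    finally show ?thesis .
  qed
  have meas: "?y k \<in> borel_measurable (PiM (col k) (\<lambda>_. borel))" for k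
    using m Q by (intro borel_measurable_sum borel_measurable_times borel_measurable_power borel_measurable_const
        borel_measurable_norm[THEN measurable_compose[rotated]] measurable_component_singleton) auto
  have loc: "?y k (restrict x (col k)) = ?y k x" for k x using m Q by (intro sum.cong refl) auto
  have y[measurable]: "?y k \<in> borel_measurable (gains K M)" if "k \<in> {1..K}" for k
    by (rule local_measurable[where F="?y k", OF meas col_links[OF that] loc])
  have intr: "integrable (gains K M) (\<lambda>x. M * (\<Sum>n\<in>Q. W\<^sup>2 * (?z k n x)\<^sup>2))" if "k \<in> {1..K}" for k
    using z4[OF that] by (intro integrable_mult_right Bochner_Integration.integrable_sum) auto
  have sqi: "integrable (gains K M) (\<lambda>x. (?y k x)\<^sup>2)" if "k \<in> {1..K}" for k
  proof (rule Bochner_Integration.integrable_bound[OF intr[OF that]])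
    show "AE x in gains K M. norm ((?y k x)\<^sup>2) \<le> norm (M * (\<Sum>n\<in>Q. W\<^sup>2 * (?z k n x)\<^sup>2))"
      unfolding real_norm_def abs_power2 by (intro AE_I2 order.trans[OF sq[OF that] abs_ge_self])
  qed (rule borel_measurable_power[OF y[OF that]])
  have "prob {x \<in> space (gains K M).
      \<bar>(\<Sum>k\<in>{1..K}. ?y k x * (cmod (G k x))\<^sup>2) - M * (\<Sum>k\<in>{1..K}. expectation (?y k))\<bar>
        > 2 * (M * W * (16 * t\<^sup>2) * (8 * M * t)) * sqrt (K * t)
          + K * (16 * M * W * M\<^sup>2 * sqrt ((2 + 2 * M) * exp (- (2 * t)) + 4 * exp (- (2 * t))))}
      \<le> K * ((2 + 2 * M) * exp (- (2 * t)) + 4 * exp (- (2 * t))) + 4 * exp (- t)"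
  proof (rule weighted_tail)
    fix k assume k: "k \<in> {1..K}"
    show "?y k \<in> borel_measurable (PiM (col k) (\<lambda>_. borel))" by (rule meas)
    show "?y k (restrict x (col k)) = ?y k x" for x by (rule loc)
    show "?y k x \<ge> 0" for x using w[OF k] by (intro sum_nonneg) auto
    show "?y k (flip s x) = ?y k x" if s: "\<And>i. s i \<in> {1, - 1}" for s x
    proof (intro sum.cong refl)
      fix n assume "n \<in> Q"
      then show "w k n * ?z k n (flip s x) = w k n * ?z k n x"
        using s[of "Inr (m, k)"] s[of "Inl (k, n)"] k m Q by (auto simp: norm_mult)
    qed
    show "integrable (gains K M) (\<lambda>x. (?y k x)\<^sup>2)" by (rule sqi[OF k])
    have "expectation (\<lambda>x. (?y k x)\<^sup>2) \<le> expectation (\<lambda>x. M * (\<Sum>n\<in>Q. W\<^sup>2 * (?z k n x)\<^sup>2))"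
      by (rule integral_mono[OF sqi[OF k] intr[OF k] sq[OF k]])
    also have "\<dots> = M * (\<Sum>n\<in>Q. W\<^sup>2 * expectation (\<lambda>x. (?z k n x)\<^sup>2))"
      by (subst integral_mult_right_zero, subst Bochner_Integration.integral_sum)
        (auto intro!: integrable_mult_right z4(1)[OF k])
    also have "\<dots> \<le> M * (\<Sum>n\<in>Q. W\<^sup>2 * 256)"
      using z4[OF k] by (intro mult_left_mono sum_mono) auto
    also have "\<dots> \<le> M * (M * (W\<^sup>2 * 256))"
      using cQ by (auto intro!: mult_left_mono mult_right_mono)
    finally show "expectation (\<lambda>x. (?y k x)\<^sup>2) \<le> (16 * M * W)\<^sup>2" by (simp add: power2_eq_square mult_ac)
    let ?A = "\<lambda>i. {x \<in> space (gains K M). (cmod (x i))\<^sup>2 > 2 * (2 * t)}"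
    have A: "?A i \<in> events" if "i \<in> links K M" for i by (rule component_event[OF that])
    have "{x \<in> space (gains K M). ?y k x > M * W * (16 * t\<^sup>2)} \<subseteq> ?A (Inr (m, k)) \<union> (\<Union>n\<in>Q. ?A (Inl (k, n)))"
    proof (rule subsetI, rule ccontr)
      fix x assume x: "x \<in> {x \<in> space (gains K M). ?y k x > M * W * (16 * t\<^sup>2)}"
        and n: "x \<notin> ?A (Inr (m, k)) \<union> (\<Union>n\<in>Q. ?A (Inl (k, n)))"
      have "?y k x \<le> (\<Sum>n\<in>Q. W * ((4 * t) * (4 * t)))"
        using n x w[OF k] W t by (intro sum_mono mult_mono) auto
      also have "\<dots> \<le> M * (W * ((4 * t) * (4 * t)))"
        using cQ W t by (auto intro!: mult_right_mono)
      finally show False using x by (simp add: power2_eq_square mult_ac)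
    qed
    then have "prob {x \<in> space (gains K M). ?y k x > M * W * (16 * t\<^sup>2)} \<le> prob (?A (Inr (m, k)) \<union> (\<Union>n\<in>Q. ?A (Inl (k, n))))"
      using A L[OF k] finQ by (intro finite_measure_mono sets.Un sets.finite_UN) auto
    also have "\<dots> \<le> prob (?A (Inr (m, k))) + prob (\<Union>n\<in>Q. ?A (Inl (k, n)))"
      using A L[OF k] finQ by (intro measure_Un_le sets.finite_UN) auto
    also have "prob (\<Union>n\<in>Q. ?A (Inl (k, n))) \<le> (\<Sum>n\<in>Q. prob (?A (Inl (k, n))))"
      using A L[OF k] finQ by (intro measure_UNION_le) auto
    also have "\<dots> \<le> (\<Sum>n\<in>Q. 2 * exp (- (2 * t)))" by (intro sum_mono component_tail L[OF k])
    also have "\<dots> \<le> M * (2 * exp (- (2 * t)))" using cQ by (auto intro!: mult_right_mono)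
    also have "prob (?A (Inr (m, k))) \<le> 2 * exp (- (2 * t))" by (rule component_tail[OF L(1)[OF k]])
    finally show "prob {x \<in> space (gains K M). ?y k x > M * W * (16 * t\<^sup>2)} \<le> (2 + 2 * M) * exp (- (2 * t))"
      by (simp add: algebra_simps)
  qed (use W t M_pos in auto)
  moreover have "(\<Sum>k\<in>{1..K}. expectation (?y k)) = (\<Sum>k\<in>{1..K}. \<Sum>n\<in>Q. w k n)" by (intro sum.cong refl E)
  ultimately show ?thesis by (simp only:)
qed

text \<open>
  Flipping the signs of the gains at random does not change their law, so the probability of an
  event may be estimated by its probability over the signs alone, for fixed gains.
\<close>

lemma prob_le_random_flip:
  fixes R :: "'r pmf" and \<beta> :: real
  assumes A: "A \<in> events" and Bad: "Bad \<in> events" and R: "finite (set_pmf R)"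
    and \<sigma>: "\<And>r i. \<sigma> r i \<in> {1, - 1}" and \<beta>: "\<beta> \<ge> 0"
    and bound: "\<And>x. x \<in> space (gains K M) \<Longrightarrow> x \<notin> Bad \<Longrightarrow> measure_pmf.prob R {r. flip (\<sigma> r) x \<in> A} \<le> \<beta>"
  shows "prob A \<le> prob Bad + \<beta>"
proof -
  have P: "measure_pmf.prob R S = (\<Sum>r\<in>set_pmf R. indicator S r * pmf R r)" for S
    using integral_measure_pmf_real[OF R, of R "indicator S"] by simp
  have ind: "integrable (gains K M) (\<lambda>x. indicator A (flip (\<sigma> r) x) :: real)" for r
    using A by (intro integrable_const_bound[where B=1]) auto
  \<comment> \<open>The constant \<open>prob A\<close> is averaged over the signs, each copy is
    rewritten by invariance under its own flip, and the finite sum is moved inside the integral.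
    There it is the conditional probability of A given the gains, which is bounded by 1 on
    \<open>Bad\<close>.\<close>
  have "prob A = (\<Sum>r\<in>set_pmf R. prob A * pmf R r)"
    using sum_pmf_eq_1[OF R order.refl] by (simp flip: sum_distrib_left)
  also have "\<dots> = (\<Sum>r\<in>set_pmf R. expectation (\<lambda>x. indicator A (flip (\<sigma> r) x)) * pmf R r)"
    using expectation_flip[OF \<sigma>, where \<Phi>="indicator A :: _ \<Rightarrow> real"] A by simp
  also have "\<dots> = expectation (\<lambda>x. \<Sum>r\<in>set_pmf R. indicator A (flip (\<sigma> r) x) * pmf R r)"
    using ind by (subst Bochner_Integration.integral_sum) auto
  also have "\<dots> \<le> expectation (\<lambda>x. indicator Bad x + \<beta>)"
  proof (rule integral_mono)
    fix x assume x: "x \<in> space (gains K M)"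
    have "(\<Sum>r\<in>set_pmf R. indicator A (flip (\<sigma> r) x) * pmf R r) = measure_pmf.prob R {r. flip (\<sigma> r) x \<in> A}"
      unfolding P by (intro sum.cong refl) (auto simp: indicator_def)
    also have "\<dots> \<le> indicator Bad x + \<beta>"
    proof (cases "x \<in> Bad")
      case True
      have "measure_pmf.prob R {r. flip (\<sigma> r) x \<in> A} \<le> 1" by simp
      also have "1 \<le> indicator Bad x + \<beta>" using True \<beta> by simp
      finally show ?thesis .
    next
      case False
      then show ?thesis using bound[OF x] by simp
    qed
    finally show "(\<Sum>r\<in>set_pmf R. indicator A (flip (\<sigma> r) x) * pmf R r) \<le> indicator Bad x + \<beta>" .
  qed (use Bad ind in \<open>auto intro!: Bochner_Integration.integrable_sum Bochner_Integration.integrable_add integrable_real_indicator simp: emeasure_eq_measure\<close>)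
  also have "\<dots> = prob Bad + \<beta>"
    using Bad by (subst Bochner_Integration.integral_add) (auto intro!: integrable_real_indicator simp: emeasure_eq_measure prob_space)
  finally show ?thesis .
qed

text \<open>For fixed gains outside the bad event all terms are at most V, and
  \<open>random_sign_quadratic\<close> applies with the sources as rows and the relays as columns.
  The gains are cut with tails exp (- t) instead of exp (- 2 t): this bad event only adds its
  probability and causes no bias. Per relay it costs 2 for \<open>f m k\<close>, 4 for
  \<open>G k\<close> and 2 M for the backward gains.\<close>

lemma offdiagonal_tail:
  fixes c :: "nat \<Rightarrow> nat \<Rightarrow> real" and C t V :: real
  assumes m: "m \<in> {1..M}" and Q: "Q \<subseteq> {1..M} - {m}"
    and c: "\<And>k n. k \<in> {1..K} \<Longrightarrow> n \<in> Q \<Longrightarrow> 0 \<le> c k n \<and> c k n \<le> C" and C: "C > 0" and t: "t > 0"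
  defines "V \<equiv> C * (2 * t) * (2 * sqrt (M * t))"
  shows "prob {x \<in> space (gains K M).
      \<bar>\<Sum>n\<in>Q. (cmod (\<Sum>k\<in>{1..K}. of_real (c k n) * (f m k x * h k n x * G k x)))\<^sup>2
          - (\<Sum>k\<in>{1..K}. (cmod (of_real (c k n) * (f m k x * h k n x * G k x)))\<^sup>2)\<bar>
        > 2 * (8 * V\<^sup>2 * K * t) * sqrt (card Q * t) + card Q * ((K * V)\<^sup>2 * sqrt (4 * exp (- (2 * t))))}
      \<le> (6 * K + 2 * K * M) * exp (- t) + (card Q * (4 * exp (- (2 * t))) + 4 * exp (- t))"
    (is "prob ?A \<le> _")
proof -
  let ?v = "\<lambda>x n k. of_real (c k n) * (f m k x * h k n x * G k x)"
  let ?u = "2 * (8 * V\<^sup>2 * K * t) * sqrt (card Q * t) + card Q * ((K * V)\<^sup>2 * sqrt (4 * exp (- (2 * t))))"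
  \<comment> \<open>\<open>h k n\<close> and \<open>f n k\<close> get the same sign, which leaves \<open>G k\<close> unchanged.\<close>
  let ?\<sigma> = "\<lambda>r. case_sum (\<lambda>(k, n). if n \<in> Q then sg (r n k) else 1) (\<lambda>(n, k). if n \<in> Q then sg (r n k) else 1)
     :: nat \<times> nat + nat \<times> nat \<Rightarrow> real"
  have finQ: "finite Q" using Q finite_subset by auto
  have mQ: "m \<notin> Q" and QM: "\<And>n. n \<in> Q \<Longrightarrow> n \<in> {1..M}" using Q by auto
  have V: "V > 0" using C t M_pos by (simp add: V_def)
  have vmeas: "(\<lambda>x. ?v x n k) \<in> borel_measurable (gains K M)" if "k \<in> {1..K}" "n \<in> Q" for n k
    using that m QM[OF that(2)] by (intro measurable_gain_intros borel_measurable_const G_measurable) auto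
  have Aev: "?A \<in> events"
    using vmeas by measurable
  let ?A1 = "\<lambda>i. {x \<in> space (gains K M). (cmod (x i))\<^sup>2 > 2 * t}"
  let ?A3 = "\<lambda>k. {x \<in> space (gains K M). cmod (G k x) > 2 * sqrt (M * t)}"
  let ?B = "\<lambda>k. (?A1 (Inr (m, k)) \<union> ?A3 k) \<union> (\<Union>n\<in>{1..M}. ?A1 (Inl (k, n)))"
  let ?Bad = "\<Union>k\<in>{1..K}. ?B k"
  have A1: "?A1 i \<in> events" if "i \<in> links K M" for i by (rule component_event[OF that])
  have A3: "?A3 k \<in> events" if "k \<in> {1..K}" for k by (rule G_event[OF that])
  have B: "?B k \<in> events" if "k \<in> {1..K}" for k
    using A1 A3 that m by (intro sets.Un sets.finite_UN) auto
  have "prob ?A \<le> prob ?Bad + (card Q * (4 * exp (- (2 * t))) + 4 * exp (- t))"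
  proof (rule prob_le_random_flip[where R="random_sign_matrix Q {1..K}" and \<sigma>="?\<sigma>", OF Aev])
    show "?Bad \<in> events" using B by (intro sets.finite_UN) auto
    show "finite (set_pmf (random_sign_matrix Q {1..K}))" using finQ by (intro finite_random_sign_matrix) auto
    show s: "?\<sigma> r i \<in> {1, - 1}" for r i by (auto simp: sg_def split: sum.split)
    fix x assume x: "x \<in> space (gains K M)" "x \<notin> ?Bad"
    have bd: "cmod (?v x n k) \<le> V" if "n \<in> Q" "k \<in> {1..K}" for n k
    proof -
      have sq: "sqrt (2 * t) * sqrt (2 * t) = 2 * t" using t by simp
      have "cmod (f m k x) \<le> sqrt (2 * t)" "cmod (h k n x) \<le> sqrt (2 * t)" "cmod (G k x) \<le> 2 * sqrt (M * t)"
        using x that QM[OF that(1)] by (auto intro!: real_le_rsqrt simp: not_less)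
      then have "cmod (?v x n k) \<le> C * ((sqrt (2 * t) * sqrt (2 * t)) * (2 * sqrt (M * t)))"
        unfolding norm_mult norm_of_real using c[OF that(2,1)] t C by (intro mult_mono) auto
      then show ?thesis unfolding sq by (simp add: V_def mult_ac)
    qed
    \<comment> \<open>The sign enters through \<open>h k n\<close> alone: \<open>f m k\<close> keeps
      the sign + 1 because m is not in Q, and \<open>G k\<close> is invariant. The subtracted
      squares do not see the sign at all.\<close>
    have fl: "?v (flip (?\<sigma> r) x) n k = of_real (sg (r n k)) * ?v x n k" if "n \<in> Q" "k \<in> {1..K}" for n k r
      using that m mQ QM[OF that(1)] G_flip[of k "?\<sigma> r" x, OF _ s] by simp
    have nfl: "cmod (of_real (sg b) * z) = cmod z" for b z by (simp add: norm_mult sg_def)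
    have "{r. flip (?\<sigma> r) x \<in> ?A} \<subseteq> {r. \<bar>\<Sum>n\<in>Q. (cmod (\<Sum>k\<in>{1..K}. of_real (sg (r n k)) * ?v x n k))\<^sup>2
        - (\<Sum>k\<in>{1..K}. (cmod (?v x n k))\<^sup>2)\<bar> > 2 * (8 * V\<^sup>2 * card {1..K} * t) * sqrt (card Q * t)
          + card Q * ((card {1..K} * V)\<^sup>2 * sqrt (4 * exp (- (2 * t))))}" (is "_ \<subseteq> ?S")
    proof
      fix r assume "r \<in> {r. flip (?\<sigma> r) x \<in> ?A}"
      then have "?u < \<bar>\<Sum>n\<in>Q. (cmod (\<Sum>k\<in>{1..K}. ?v (flip (?\<sigma> r) x) n k))\<^sup>2 - (\<Sum>k\<in>{1..K}. (cmod (?v (flip (?\<sigma> r) x) n k))\<^sup>2)\<bar>"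
        by simp
      also have "(\<Sum>n\<in>Q. (cmod (\<Sum>k\<in>{1..K}. ?v (flip (?\<sigma> r) x) n k))\<^sup>2 - (\<Sum>k\<in>{1..K}. (cmod (?v (flip (?\<sigma> r) x) n k))\<^sup>2))
        = (\<Sum>n\<in>Q. (cmod (\<Sum>k\<in>{1..K}. of_real (sg (r n k)) * ?v x n k))\<^sup>2 - (\<Sum>k\<in>{1..K}. (cmod (of_real (sg (r n k)) * ?v x n k))\<^sup>2))"
        by (intro sum.cong refl arg_cong2[where f="(-)"] arg_cong[where f="\<lambda>z. (cmod z)\<^sup>2"] fl)
      finally show "r \<in> ?S" by (simp only: nfl card_atLeastAtMost mem_Collect_eq) simp
    qed
    then have "measure_pmf.prob (random_sign_matrix Q {1..K}) {r. flip (?\<sigma> r) x \<in> ?A}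
        \<le> measure_pmf.prob (random_sign_matrix Q {1..K}) ?S"
      by (intro measure_pmf.finite_measure_mono) auto
    also have "\<dots> \<le> card Q * (4 * exp (- (2 * t))) + 4 * exp (- t)"
      by (rule random_sign_quadratic[OF finQ _ _ bd V t]) (use K_pos in auto)
    finally show "measure_pmf.prob (random_sign_matrix Q {1..K}) {r. flip (?\<sigma> r) x \<in> ?A}
        \<le> card Q * (4 * exp (- (2 * t))) + 4 * exp (- t)" .
  qed simp
  also have "prob ?Bad \<le> (6 * K + 2 * K * M) * exp (- t)"
  proof -
    have "prob (?B k) \<le> (6 + 2 * M) * exp (- t)" if k: "k \<in> {1..K}" for k
    proof -
      have "prob (?B k) \<le> prob (?A1 (Inr (m, k)) \<union> ?A3 k) + prob (\<Union>n\<in>{1..M}. ?A1 (Inl (k, n)))"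
        using A1 A3 k m by (intro measure_Un_le sets.Un sets.finite_UN) auto
      also have "\<dots> \<le> (prob (?A1 (Inr (m, k))) + prob (?A3 k)) + (\<Sum>n\<in>{1..M}. prob (?A1 (Inl (k, n))))"
        using A1 A3 k m by (intro add_mono measure_Un_le measure_UNION_le) auto
      also have "\<dots> \<le> (2 * exp (- t) + 4 * exp (- t)) + (\<Sum>n\<in>{1..M}. 2 * exp (- t))"
        using k m t by (intro add_mono component_tail G_tail sum_mono) auto
      finally show ?thesis by (simp add: algebra_simps)
    qed
    then have "(\<Sum>k\<in>{1..K}. prob (?B k)) \<le> (\<Sum>k\<in>{1..K}. (6 + 2 * M) * exp (- t))" by (rule sum_mono)
    moreover have "prob ?Bad \<le> (\<Sum>k\<in>{1..K}. prob (?B k))" using B by (intro measure_UNION_le) auto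
    ultimately show ?thesis by (simp add: algebra_simps)
  qed
  finally show ?thesis by simp
qed

end

section \<open>Simultaneous concentration\<close>

lemma add_le_double:
  fixes a b c p q z :: real
  assumes "a \<le> p * z" "b \<le> q * z" "p + q \<le> 2" "0 \<le> z" "c = 2 * z"
  shows "a + b \<le> c"
  using add_mono[OF assms(1,2)] mult_right_mono[OF assms(3,4)] assms(5) by (simp add: distrib_right)

lemma abs_diff_le_double:
  fixes T D N a b r s :: real
  assumes "\<bar>T - D\<bar> \<le> a" "\<bar>D - N\<bar> \<le> b" "b \<le> r * (2 * s)" "a \<le> r * (2 * s)"
  shows "\<bar>T - N\<bar> \<le> r * (4 * s)"
  using assms by (simp add: mult_ac)

lemma bounds_of_deviation:
  fixes T N r d l u :: real
  assumes "\<bar>T - N\<bar> \<le> r * d" "r * l \<le> N" "N \<le> r * u"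
  shows "r * (l - d) \<le> T" "T \<le> r * (u + d)"
  using assms by (simp_all add: right_diff_distrib distrib_left)

lemma (in finite_measure) measure_Un4_le:
  assumes "A \<in> sets M" "B \<in> sets M" "C \<in> sets M" "D \<in> sets M"
  shows "measure M (((A \<union> B) \<union> C) \<union> D) \<le> ((measure M A + measure M B) + measure M C) + measure M D"
  using measure_Un_le[of "(A \<union> B) \<union> C" M D] measure_Un_le[of "A \<union> B" M C] measure_Un_le[of A M B] assms
  by auto

context channel
begin

text \<open>The assumptions on y say that t^(9/2), also multiplied by each of the coefficient bounds
  C, C^2 and W, is at most y / 512. The assumption \<open>small\<close> is the case in which the
  asserted probability is at most one; it serves to absorb the truncation biases.\<close>

lemma concentration:
  fixes c :: "nat \<Rightarrow> nat \<Rightarrow> real" and w :: "nat \<Rightarrow> real" and C W t y :: real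
  assumes m: "m \<in> {1..M}"
    and c: "\<And>k n. k \<in> {1..K} \<Longrightarrow> n \<in> {1..M} \<Longrightarrow> 0 \<le> c k n \<and> c k n \<le> C" and C: "C > 0"
    and w: "\<And>k. k \<in> {1..K} \<Longrightarrow> 0 \<le> w k \<and> w k \<le> W" and W: "W > 0"
    and t: "t \<ge> 1" and small: "814 * (real K)\<^sup>2 * (real M) ^ 3 * exp (- t) \<le> 1"
    and y: "t ^ 4 * sqrt t \<le> y / 512" "C * (t ^ 4 * sqrt t) \<le> y / 512"
      "C\<^sup>2 * (t ^ 4 * sqrt t) \<le> y / 512" "W * (t ^ 4 * sqrt t) \<le> y / 512"
  defines "v \<equiv> \<lambda>x n k. of_real (c k n) * (f m k x * h k n x * G k x)"
  obtains Bad where "Bad \<in> events" "prob Bad \<le> 814 * (real K)\<^sup>2 * (real M) ^ 3 * exp (- t)"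
    "\<And>x. x \<in> space (gains K M) \<Longrightarrow> x \<notin> Bad \<Longrightarrow>
      cmod ((\<Sum>k\<in>{1..K}. v x m k) - of_real (pi / 4 * (\<Sum>k\<in>{1..K}. c k m))) \<le> 2 * sqrt (real K * real M) * y"
    "\<And>x. x \<in> space (gains K M) \<Longrightarrow> x \<notin> Bad \<Longrightarrow>
      \<bar>(\<Sum>n\<in>{1..M} - {m}. (cmod (\<Sum>k\<in>{1..K}. v x n k))\<^sup>2) - M * (\<Sum>k\<in>{1..K}. \<Sum>n\<in>{1..M} - {m}. (c k n)\<^sup>2)\<bar>
        \<le> K * (real M)\<^sup>2 * (4 * (y / min (sqrt M) (sqrt K)))"
    "\<And>x. x \<in> space (gains K M) \<Longrightarrow> x \<notin> Bad \<Longrightarrow>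
      \<bar>(\<Sum>k\<in>{1..K}. w k * (cmod (f m k x))\<^sup>2 * (cmod (G k x))\<^sup>2) - M * (\<Sum>k\<in>{1..K}. w k)\<bar>
        \<le> K * real M * (2 * (y / sqrt K))"
proof -
  define e where "e = exp (- t)"
  define \<tau> where "\<tau> = t ^ 4 * sqrt t"
  have t0: "t > 0" and y0: "y > 0"
  proof -
    show "t > 0" using t by simp
    then have "0 < t ^ 4 * sqrt t" by simp
    then show "y > 0" using y(1) by linarith
  qed
  have K1: "real K \<ge> 1" and M1: "real M \<ge> 1" using K_pos M_pos by auto
  have e: "0 < e" "e \<le> 1" "exp (- (2 * t)) = e\<^sup>2" "e\<^sup>2 \<le> e"
  proof -
    show "0 < e" "e \<le> 1" using t by (simp_all add: e_def)
    then show "e\<^sup>2 \<le> e" by (simp add: power2_eq_square mult_le_one mult_left_le)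
    show "exp (- (2 * t)) = e\<^sup>2" by (simp add: e_def power2_eq_square flip: exp_add)
  qed
  have sq_e: "sqrt (g * e\<^sup>2) = sqrt g * e" for g using e by (simp add: real_sqrt_mult)
  let ?Q = "{1..M} - {m}"
  have cQ: "real (card ?Q) \<le> M" using m by simp
  let ?S = "{x \<in> space (gains K M).
      cmod ((\<Sum>k\<in>{1..K}. v x m k) - of_real (pi / 4 * (\<Sum>k\<in>{1..K}. c k m)))
        > 2 * (C * (4 * t) * (2 * sqrt (M * (2 * t)))) * sqrt (K * t) + K * (C * M * sqrt (8 * exp (- (2 * t))))}"
  let ?N = "{x \<in> space (gains K M).
      \<bar>(\<Sum>k\<in>{1..K}. w k * (cmod (f m k x))\<^sup>2 * (cmod (G k x))\<^sup>2) - M * (\<Sum>k\<in>{1..K}. w k)\<bar>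
        > 2 * (W * (4 * t) * (8 * M * t)) * sqrt (K * t) + K * (4 * W * M\<^sup>2 * sqrt (6 * exp (- (2 * t))))}"
  let ?D = "{x \<in> space (gains K M).
      \<bar>(\<Sum>k\<in>{1..K}. (\<Sum>n\<in>?Q. (c k n)\<^sup>2 * ((cmod (f m k x))\<^sup>2 * (cmod (h k n x))\<^sup>2)) * (cmod (G k x))\<^sup>2)
          - M * (\<Sum>k\<in>{1..K}. \<Sum>n\<in>?Q. (c k n)\<^sup>2)\<bar>
        > 2 * (M * C\<^sup>2 * (16 * t\<^sup>2) * (8 * M * t)) * sqrt (K * t)
          + K * (16 * M * C\<^sup>2 * M\<^sup>2 * sqrt ((2 + 2 * M) * exp (- (2 * t)) + 4 * exp (- (2 * t))))}"
  let ?V = "C * (2 * t) * (2 * sqrt (M * t))"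
  let ?O = "{x \<in> space (gains K M).
      \<bar>\<Sum>n\<in>?Q. (cmod (\<Sum>k\<in>{1..K}. v x n k))\<^sup>2 - (\<Sum>k\<in>{1..K}. (cmod (v x n k))\<^sup>2)\<bar>
        > 2 * (8 * ?V\<^sup>2 * K * t) * sqrt (card ?Q * t) + card ?Q * ((K * ?V)\<^sup>2 * sqrt (4 * exp (- (2 * t))))}"
  have vm: "(\<lambda>x. v x n k) \<in> borel_measurable (gains K M)" if "k \<in> {1..K}" "n \<in> {1..M}" for n k
    unfolding v_def using that m by (intro measurable_gain_intros borel_measurable_const G_measurable) auto
  have fm: "(\<lambda>x. f m k x) \<in> borel_measurable (gains K M)" if "k \<in> {1..K}" for k
    using that m by (intro component_measurable) auto
  have hm: "(\<lambda>x. h k n x) \<in> borel_measurable (gains K M)" if "k \<in> {1..K}" "n \<in> {1..M}" for k n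
    using that by (intro component_measurable) auto
  have meas: "?S \<in> events" "?N \<in> events" "?D \<in> events" "?O \<in> events"
  proof -
    show "?S \<in> events" using vm m by measurable
    show "?N \<in> events" using fm G_measurable by measurable
    show "?D \<in> events" using fm hm G_measurable by measurable
    show "?O \<in> events" using vm by measurable
  qed
  have pS: "prob ?S \<le> K * (8 * exp (- (2 * t))) + 4 * exp (- t)"
    unfolding v_def by (rule signal_tail[OF m _ C t0]) (use c m in auto)
  have pN: "prob ?N \<le> K * (6 * exp (- (2 * t))) + 4 * exp (- t)"
    by (rule noise_tail[OF m w W t0])
  have pD: "prob ?D \<le> K * ((2 + 2 * M) * exp (- (2 * t)) + 4 * exp (- (2 * t))) + 4 * exp (- t)"
    by (rule diagonal_tail[OF m _ _ _ t0]) (use c C in \<open>auto intro!: power_mono\<close>)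
  have pO: "prob ?O \<le> (6 * K + 2 * K * M) * exp (- t) + (card ?Q * (4 * exp (- (2 * t))) + 4 * exp (- t))"
    unfolding v_def by (rule offdiagonal_tail[OF m order.refl _ C t0]) (use c in auto)
  have "prob (((?S \<union> ?N) \<union> ?D) \<union> ?O) \<le> ((prob ?S + prob ?N) + prob ?D) + prob ?O"
    by (rule measure_Un4_le[OF meas])
  also have "\<dots> \<le> ((K * (8 * e) + 4 * e) + (K * (6 * e) + 4 * e) + (K * ((2 + 2 * M) * e + 4 * e) + 4 * e))
      + ((6 * K + 2 * K * M) * e + (M * (4 * e) + 4 * e))"
  proof -
    have "K * (8 * e\<^sup>2) \<le> K * (8 * e)" "K * (6 * e\<^sup>2) \<le> K * (6 * e)"
      "K * ((2 + 2 * M) * e\<^sup>2 + 4 * e\<^sup>2) \<le> K * ((2 + 2 * M) * e + 4 * e)" "card ?Q * (4 * e\<^sup>2) \<le> M * (4 * e)"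
      using e cQ by (intro mult_left_mono add_mono mult_mono; simp)+
    then show ?thesis
      using pS pN pD pO unfolding e(3) e_def[symmetric] by linarith
  qed
  also have "\<dots> = (26 * K + 4 * (real K * M) + 4 * M + 16) * e" by (simp add: algebra_simps)
  also have "\<dots> \<le> 814 * (real K)\<^sup>2 * (real M) ^ 3 * e"
  proof (intro mult_right_mono)
    define z where "z = (real K)\<^sup>2 * (real M) ^ 3"
    have k2: "real K \<le> (real K)\<^sup>2" "1 \<le> (real K)\<^sup>2" using K1 power_increasing[of 1 2 "real K"] by simp_all
    have m3: "real M \<le> (real M) ^ 3" "1 \<le> (real M) ^ 3" using M1 power_increasing[of 1 3 "real M"] by simp_all
    have "real K * 1 \<le> z" "real K * M \<le> z" "1 * real M \<le> z" "1 * 1 \<le> z"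
      unfolding z_def using k2 m3 by (intro mult_mono; simp)+
    then show "26 * K + 4 * (real K * M) + 4 * M + 16 \<le> 814 * (real K)\<^sup>2 * (real M) ^ 3"
      unfolding mult.assoc[of 814] z_def[symmetric] by simp
  qed (use e in simp)
  finally have P: "prob (((?S \<union> ?N) \<union> ?D) \<union> ?O) \<le> 814 * (real K)\<^sup>2 * (real M) ^ 3 * exp (- t)"
    by (simp add: e_def)
  \<comment> \<open>This and its variants below turn each polynomial prefactor of a bias into a
    constant: the exponential decay has already paid for it.\<close>
  have eK: "real K * real M ^ 3 * e \<le> 1 / 814"
  proof -
    have "814 * (real K)\<^sup>2 * (real M) ^ 3 * e \<ge> 814 * (real K * 1) * (real M) ^ 3 * e"
      unfolding power2_eq_square[of "real K"] using K1 M1 e by (intro mult_right_mono mult_left_mono) auto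
    then show ?thesis using small by (simp add: e_def)
  qed
  have eKK: "(real K)\<^sup>2 * real M ^ 3 * e \<le> 1 / 814" using small by (simp add: e_def)
  \<comment> \<open>As t >= 1, every smaller power of t is dominated by t^(9/2), the power that the
    off-diagonal part reaches.\<close>
  have tpow: "t ^ j * sqrt t \<le> \<tau>" if "j \<le> 4" for j
    unfolding \<tau>_def using t that by (intro mult_right_mono power_increasing) auto
  have tau1: "t ^ j \<le> \<tau>" if "j \<le> 4" for j
  proof -
    have "t ^ j * 1 \<le> t ^ 4 * sqrt t" using t that by (intro mult_mono power_increasing) auto
    then show ?thesis by (simp add: \<tau>_def)
  qed
  have t1: "1 \<le> \<tau>" using tau1[of 0] by simp
  have rKt: "sqrt (K * t) = sqrt K * sqrt t" and rMt: "sqrt (M * t) = sqrt M * sqrt t"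
    by (simp_all add: real_sqrt_mult)
  have sK1: "1 \<le> sqrt K" and sM1: "1 \<le> sqrt M" using K1 M1 by auto
  note y' = y[folded \<tau>_def]
  have tt: "sqrt t * sqrt t = t" using t0 by simp
  have KM3: "real K * real M * e \<le> 1 / 814" "real K * (real M)\<^sup>2 * e \<le> 1 / 814"
  proof -
    have "real K * real M ^ 1 * e \<le> real K * real M ^ 3 * e" "real K * real M ^ 2 * e \<le> real K * real M ^ 3 * e"
      using M1 e by (intro mult_right_mono mult_left_mono power_increasing; simp)+
    then show "real K * real M * e \<le> 1 / 814" "real K * (real M)\<^sup>2 * e \<le> 1 / 814" using eK by auto
  qed
  have KKM2: "(real K)\<^sup>2 * (real M)\<^sup>2 * e \<le> 1 / 814"
  proof -
    have "(real K)\<^sup>2 * real M ^ 2 * e \<le> (real K)\<^sup>2 * real M ^ 3 * e"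
      using M1 e by (intro mult_right_mono mult_left_mono power_increasing; simp)
    then show ?thesis using eKK by simp
  qed
  have Cy: "C * t ^ j \<le> y / 512" "C\<^sup>2 * t ^ j \<le> y / 512" "C\<^sup>2 * (t ^ j * sqrt t) \<le> y / 512"
    "W * t ^ j \<le> y / 512" "W * (t ^ j * sqrt t) \<le> y / 512" if j: "j \<le> 4" for j
  proof -
    have le: "g * t ^ j \<le> g * \<tau>" "g * (t ^ j * sqrt t) \<le> g * \<tau>" if "g \<ge> 0" for g
      using that by (auto intro!: mult_left_mono tau1[OF j] tpow[OF j])
    have n: "0 \<le> C" "0 \<le> C\<^sup>2" "0 \<le> W" using C W by auto
    show "C * t ^ j \<le> y / 512" by (rule order.trans[OF le(1)[OF n(1)] y'(2)])
    show "C\<^sup>2 * t ^ j \<le> y / 512" by (rule order.trans[OF le(1)[OF n(2)] y'(3)])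
    show "C\<^sup>2 * (t ^ j * sqrt t) \<le> y / 512" by (rule order.trans[OF le(2)[OF n(2)] y'(3)])
    show "W * t ^ j \<le> y / 512" by (rule order.trans[OF le(1)[OF n(3)] y'(4)])
    show "W * (t ^ j * sqrt t) \<le> y / 512" by (rule order.trans[OF le(2)[OF n(3)] y'(4)])
  qed
  have divK: "real K * a * (2 * (y / sqrt K)) = 2 * (a * sqrt K) * y" for a :: real
    using K1 by (simp add: field_simps)
  have divM: "K * (real M)\<^sup>2 * (2 * (y / sqrt M)) = 2 * (K * M * sqrt M) * y"
    using M1 by (simp add: field_simps power2_eq_square)
  \<comment> \<open>In this and the next three estimates R * y is the natural unit of the deviation
    and 2 * R * y is allowed. The Hoeffding part takes at most 256 / 512 of a unit, the bias at most
    1 / 512.\<close>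
  have bS: "2 * (C * (4 * t) * (2 * sqrt (M * (2 * t)))) * sqrt (K * t) + K * (C * M * sqrt (8 * exp (- (2 * t))))
      \<le> 2 * sqrt (real K * real M) * y"
  proof -
    define R where "R = sqrt K * sqrt M"
    have R: "R \<ge> 1" unfolding R_def using mult_mono[OF sK1 sM1] by simp
    have "2 * (C * (4 * t) * (2 * sqrt (M * (2 * t)))) * sqrt (K * t) = 16 * sqrt 2 * (C * t) * R * (sqrt t * sqrt t)"
      unfolding R_def by (simp add: real_sqrt_mult mult_ac)
    also have "\<dots> = 16 * sqrt 2 * R * (C * t ^ 2)" unfolding tt by (simp add: power2_eq_square mult_ac)
    also have "\<dots> \<le> 16 * (3 / 2) * R * (y / 512)"
      using R Cy(1)[of 2] C t0 by (intro mult_mono real_le_lsqrt) (auto simp: power2_eq_square)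
    finally have 1: "2 * (C * (4 * t) * (2 * sqrt (M * (2 * t)))) * sqrt (K * t) \<le> 24 / 512 * (R * y)" by simp
    have "K * (C * M * sqrt (8 * exp (- (2 * t)))) = sqrt 8 * C * (K * M * e)"
      unfolding e(3) sq_e by (simp add: mult_ac)
    also have "\<dots> \<le> 3 * C * (1 / 814)"
      using KM3(1) C e by (intro mult_mono real_le_lsqrt) auto
    also have "\<dots> \<le> C" using C by simp
    also have "\<dots> \<le> y / 512 * 1" using Cy(1)[of 0] by simp
    also have "\<dots> \<le> y / 512 * R" using R y0 by (intro mult_left_mono) auto
    finally have 2: "K * (C * M * sqrt (8 * exp (- (2 * t)))) \<le> 1 / 512 * (R * y)" by (simp add: mult_ac)
    have "0 \<le> R * y" using R y0 by simp
    moreover have "2 * sqrt (real K * real M) * y = 2 * (R * y)" by (simp add: R_def real_sqrt_mult)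
    ultimately show ?thesis by (intro add_le_double[OF 1 2]) simp_all
  qed
  have bN: "2 * (W * (4 * t) * (8 * M * t)) * sqrt (K * t) + K * (4 * W * M\<^sup>2 * sqrt (6 * exp (- (2 * t))))
      \<le> K * real M * (2 * (y / sqrt K))"
  proof -
    define R where "R = M * sqrt K"
    have R: "R \<ge> 1" unfolding R_def using mult_mono[OF M1 sK1] by simp
    have "2 * (W * (4 * t) * (8 * M * t)) * sqrt (K * t) = 64 * R * (W * (t ^ 2 * sqrt t))"
      unfolding R_def by (simp add: real_sqrt_mult power2_eq_square mult_ac)
    also have "\<dots> \<le> 64 * R * (y / 512)"
      using R Cy(5)[of 2] by (intro mult_left_mono) auto
    finally have 1: "2 * (W * (4 * t) * (8 * M * t)) * sqrt (K * t) \<le> 64 / 512 * (R * y)" by simp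
    have "K * (4 * W * M\<^sup>2 * sqrt (6 * exp (- (2 * t)))) = 4 * sqrt 6 * W * (K * (real M)\<^sup>2 * e)"
      unfolding e(3) sq_e by (simp add: mult_ac)
    also have "\<dots> \<le> 4 * 3 * W * (1 / 814)"
      using KM3(2) W e by (intro mult_mono real_le_lsqrt) auto
    also have "\<dots> \<le> W" using W by simp
    also have "\<dots> \<le> y / 512 * 1" using Cy(4)[of 0] by simp
    also have "\<dots> \<le> y / 512 * R" using R y0 by (intro mult_left_mono) auto
    finally have 2: "K * (4 * W * M\<^sup>2 * sqrt (6 * exp (- (2 * t)))) \<le> 1 / 512 * (R * y)" by (simp add: mult_ac)
    have "0 \<le> R * y" using R y0 by simp
    moreover have "K * real M * (2 * (y / sqrt K)) = 2 * (R * y)" unfolding divK R_def by simp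
    ultimately show ?thesis by (intro add_le_double[OF 1 2]) simp_all
  qed
  have bD: "2 * (M * C\<^sup>2 * (16 * t\<^sup>2) * (8 * M * t)) * sqrt (K * t)
          + K * (16 * M * C\<^sup>2 * M\<^sup>2 * sqrt ((2 + 2 * M) * exp (- (2 * t)) + 4 * exp (- (2 * t))))
      \<le> K * (real M)\<^sup>2 * (2 * (y / sqrt K))"
  proof -
    define R where "R = (real M)\<^sup>2 * sqrt K"
    have R: "R \<ge> M" unfolding R_def power2_eq_square
      using mult_mono[OF M1 sK1] M1 mult_left_mono[of 1 "M * sqrt K" "real M"] by (simp add: mult_ac)
    have "2 * (M * C\<^sup>2 * (16 * t\<^sup>2) * (8 * M * t)) * sqrt (K * t) = 256 * R * (C\<^sup>2 * (t ^ 3 * sqrt t))"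
      unfolding R_def by (simp add: real_sqrt_mult power2_eq_square power3_eq_cube mult_ac)
    also have "\<dots> \<le> 256 * R * (y / 512)"
      using R M1 Cy(3)[of 3] by (intro mult_left_mono) auto
    finally have 1: "2 * (M * C\<^sup>2 * (16 * t\<^sup>2) * (8 * M * t)) * sqrt (K * t) \<le> 256 / 512 * (R * y)" by simp
    have "(2 + 2 * M) * e\<^sup>2 + 4 * e\<^sup>2 = (6 + 2 * M) * e\<^sup>2" by (simp add: algebra_simps)
    then have "sqrt ((2 + 2 * M) * e\<^sup>2 + 4 * e\<^sup>2) = sqrt (6 + 2 * M) * e" using sq_e by simp
    moreover have "sqrt (6 + 2 * M) \<le> 3 * M"
    proof (rule real_le_lsqrt)
      have "1 \<le> (real M)\<^sup>2" "real M \<le> (real M)\<^sup>2" using M1 power_increasing[of 1 2 "real M"] by simp_all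
      then have "6 + 2 * real M \<le> 9 * (real M)\<^sup>2" by linarith
      then show "real (6 + 2 * M) \<le> (real (3 * M))\<^sup>2" by (simp add: power_mult_distrib)
    qed simp_all
    ultimately have "sqrt ((2 + 2 * M) * e\<^sup>2 + 4 * e\<^sup>2) \<le> 3 * M * e" using e by simp
    then have "K * (16 * M * C\<^sup>2 * M\<^sup>2 * sqrt ((2 + 2 * M) * exp (- (2 * t)) + 4 * exp (- (2 * t))))
        \<le> K * (16 * M * C\<^sup>2 * M\<^sup>2 * (3 * M * e))"
      unfolding e(3) by (intro mult_left_mono) auto
    also have "\<dots> = 48 * (C\<^sup>2 * M) * (real K * real M ^ 3 * e)" by (simp add: power2_eq_square power3_eq_cube mult_ac)
    also have "\<dots> \<le> 48 * (C\<^sup>2 * M) * (1 / 814)" by (intro mult_left_mono eK) auto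
    also have "\<dots> \<le> C\<^sup>2 * M" by simp
    also have "\<dots> \<le> y / 512 * M" using Cy(2)[of 0] by (intro mult_right_mono) auto
    also have "\<dots> \<le> y / 512 * R" using R y0 by (intro mult_left_mono) auto
    finally have 2: "K * (16 * M * C\<^sup>2 * M\<^sup>2 * sqrt ((2 + 2 * M) * exp (- (2 * t)) + 4 * exp (- (2 * t)))) \<le> 1 / 512 * (R * y)" by (simp add: mult_ac)
    have "0 \<le> R * y" using R M1 y0 by simp
    moreover have "K * (real M)\<^sup>2 * (2 * (y / sqrt K)) = 2 * (R * y)" unfolding divK R_def by simp
    ultimately show ?thesis by (intro add_le_double[OF 1 2]) simp_all
  qed
  have bO: "2 * (8 * ?V\<^sup>2 * K * t) * sqrt (card ?Q * t) + card ?Q * ((K * ?V)\<^sup>2 * sqrt (4 * exp (- (2 * t))))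
      \<le> K * (real M)\<^sup>2 * (2 * (y / sqrt M))"
  proof -
    define R where "R = K * M * sqrt M"
    have R: "R \<ge> 1" unfolding R_def using mult_mono[OF mult_mono[OF K1 M1] sM1] by simp
    have V: "?V\<^sup>2 = 16 * C\<^sup>2 * M * t ^ 3"
      using t0 by (simp add: power_mult_distrib power2_eq_square power3_eq_cube mult_ac)
    have "2 * (8 * ?V\<^sup>2 * K * t) * sqrt (card ?Q * t) \<le> 2 * (8 * ?V\<^sup>2 * K * t) * sqrt (M * t)"
      \<comment> \<open>With V^2 = 16 C^2 M t^3 the next line has magnitude 256 C^2 K M sqrt M
        t^(9/2), that is K M^2 / sqrt M in K and M, while the diagonal part had K M^2 / sqrt
        K.\<close>
      using cQ t0 by (intro mult_left_mono real_sqrt_le_mono mult_right_mono) auto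
    also have "\<dots> = 256 * R * (C\<^sup>2 * (t ^ 4 * sqrt t))"
      unfolding V R_def by (simp add: real_sqrt_mult power4_eq_xxxx power3_eq_cube mult_ac)
    also have "\<dots> \<le> 256 * R * (y / 512)"
      using R Cy(3)[of 4] by (intro mult_left_mono) auto
    finally have 1: "2 * (8 * ?V\<^sup>2 * K * t) * sqrt (card ?Q * t) \<le> 256 / 512 * (R * y)" by simp
    have "card ?Q * ((K * ?V)\<^sup>2 * sqrt (4 * exp (- (2 * t)))) \<le> M * ((K * ?V)\<^sup>2 * sqrt (4 * exp (- (2 * t))))"
      using cQ by (intro mult_right_mono) auto
    also have "\<dots> = 32 * (C\<^sup>2 * t ^ 3) * ((real K)\<^sup>2 * (real M)\<^sup>2 * e)"
      unfolding power_mult_distrib[of "real K"] V e(3) sq_e by (simp add: power2_eq_square mult_ac)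
    also have "\<dots> \<le> 32 * (C\<^sup>2 * t ^ 3) * (1 / 814)" using t0 by (intro mult_left_mono KKM2) auto
    also have "\<dots> \<le> C\<^sup>2 * t ^ 3" using t0 by simp
    also have "\<dots> \<le> y / 512 * 1" using Cy(2)[of 3] by simp
    also have "\<dots> \<le> y / 512 * R" using R y0 by (intro mult_left_mono) auto
    finally have 2: "card ?Q * ((K * ?V)\<^sup>2 * sqrt (4 * exp (- (2 * t)))) \<le> 1 / 512 * (R * y)" by (simp add: mult_ac)
    have "0 \<le> R * y" using R y0 by simp
    moreover have "K * (real M)\<^sup>2 * (2 * (y / sqrt M)) = 2 * (R * y)" unfolding divM R_def by simp
    ultimately show ?thesis by (intro add_le_double[OF 1 2]) simp_all
  qed
  show thesis
  proof (rule that)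
    show "((?S \<union> ?N) \<union> ?D) \<union> ?O \<in> events" using meas by (intro sets.Un)
    show "prob (((?S \<union> ?N) \<union> ?D) \<union> ?O) \<le> 814 * (real K)\<^sup>2 * (real M) ^ 3 * exp (- t)" by (rule P)
    fix x assume x: "x \<in> space (gains K M)" and "x \<notin> ((?S \<union> ?N) \<union> ?D) \<union> ?O"
    then have n: "x \<notin> ?S" "x \<notin> ?N" "x \<notin> ?D" "x \<notin> ?O" by blast+
    show "cmod ((\<Sum>k\<in>{1..K}. v x m k) - of_real (pi / 4 * (\<Sum>k\<in>{1..K}. c k m))) \<le> 2 * sqrt (real K * real M) * y"
      using n(1) x by (intro order.trans[OF _ bS]) simp
    show "\<bar>(\<Sum>k\<in>{1..K}. w k * (cmod (f m k x))\<^sup>2 * (cmod (G k x))\<^sup>2) - M * (\<Sum>k\<in>{1..K}. w k)\<bar>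
        \<le> K * real M * (2 * (y / sqrt K))"
      using n(2) x by (intro order.trans[OF _ bN]) simp
    let ?dg = "\<Sum>k\<in>{1..K}. (\<Sum>n\<in>?Q. (c k n)\<^sup>2 * ((cmod (f m k x))\<^sup>2 * (cmod (h k n x))\<^sup>2)) * (cmod (G k x))\<^sup>2"
    let ?mn = "M * (\<Sum>k\<in>{1..K}. \<Sum>n\<in>?Q. (c k n)\<^sup>2)"
    let ?T = "\<Sum>n\<in>?Q. (cmod (\<Sum>k\<in>{1..K}. v x n k))\<^sup>2"
    have dg: "(\<Sum>n\<in>?Q. \<Sum>k\<in>{1..K}. (cmod (v x n k))\<^sup>2) = ?dg"
      by (subst sum.swap) (simp add: v_def norm_mult power_mult_distrib sum_distrib_left mult_ac)
    have 1: "\<bar>?dg - ?mn\<bar> \<le> K * (real M)\<^sup>2 * (2 * (y / sqrt K))"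
      using n(3) x by (intro order.trans[OF _ bD]) simp
    have "\<bar>\<Sum>n\<in>?Q. (cmod (\<Sum>k\<in>{1..K}. v x n k))\<^sup>2 - (\<Sum>k\<in>{1..K}. (cmod (v x n k))\<^sup>2)\<bar>
        \<le> K * (real M)\<^sup>2 * (2 * (y / sqrt M))"
      using n(4) x by (intro order.trans[OF _ bO]) simp
    then have 2: "\<bar>?T - ?dg\<bar> \<le> K * (real M)\<^sup>2 * (2 * (y / sqrt M))"
      unfolding sum_subtractf dg .
    \<comment> \<open>The minimum is the common denominator of the diagonal and off-diagonal errors;
      their two allowances of 2 make the 4 in \<open>L_P2\<close> and \<open>U_P2\<close>.\<close>
    have "y / sqrt K \<le> y / min (sqrt M) (sqrt K)" "y / sqrt M \<le> y / min (sqrt M) (sqrt K)"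
      using y0 sK1 sM1 by (intro divide_left_mono; simp add: min_def)+
    then have "K * (real M)\<^sup>2 * (2 * (y / sqrt K)) \<le> K * (real M)\<^sup>2 * (2 * (y / min (sqrt M) (sqrt K)))"
      "K * (real M)\<^sup>2 * (2 * (y / sqrt M)) \<le> K * (real M)\<^sup>2 * (2 * (y / min (sqrt M) (sqrt K)))"
      by (intro mult_left_mono; simp)+
    then show "\<bar>?T - ?mn\<bar> \<le> K * (real M)\<^sup>2 * (4 * (y / min (sqrt M) (sqrt K)))"
      by (rule abs_diff_le_double[OF 2 1])
  qed
qed

end

section \<open>Deterministic estimates\<close>

text \<open>The quotient increases in the signal and decreases in the denominator, so opposite
  bounds are combined. After dividing the denominator by K M^2 the normalisation by
  \<open>C_SN\<close> cancels. The maxima with 0 come from the nonnegativity of s, D1 and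
  D2.\<close>

lemma SINR_sandwich:
  fixes Cl Cu cl cu \<sigma> y s D1 D2 :: real and K M :: nat
  assumes pos: "0 < Cl" "0 < Cu" "0 < cl" "0 < cu" "\<sigma>\<^sup>2 > 0" "K > 0" "M > 0" "y > 0" "s \<ge> 0" "D1 \<ge> 0" "D2 \<ge> 0"
    and s: "K * pi * Cl / 4 - 2 * sqrt (real K * real M) * y \<le> s" "s \<le> K * pi * Cu / 4 + 2 * sqrt (real K * real M) * y"
    and D1: "K * (real M)\<^sup>2 * (Cl\<^sup>2 * ((real M - 1) / M) - 4 * (y / min (sqrt M) (sqrt K))) \<le> D1"
      "D1 \<le> K * (real M)\<^sup>2 * (Cu\<^sup>2 + 4 * (y / min (sqrt M) (sqrt K)))"
    and D2: "K * real M * (cl\<^sup>2 - 2 * (y / sqrt K)) \<le> D2" "D2 \<le> K * real M * (cu\<^sup>2 + 2 * (y / sqrt K))"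
  shows "s\<^sup>2 / (D1 + \<sigma>\<^sup>2 * M * D2 + K * (real M)\<^sup>2 * \<sigma>\<^sup>2) \<in> {L_P2 \<sigma> K M Cl Cu cu y .. U_P2 \<sigma> K M Cl Cu cl y}"
proof -
  define D where "D = D1 + \<sigma>\<^sup>2 * M * D2 + K * (real M)\<^sup>2 * \<sigma>\<^sup>2"
  define z where "z = y / min (sqrt M) (sqrt K)"
  define q where "q = y / sqrt K"
  have z: "z > 0" and q: "q > 0" using pos by (auto simp: z_def q_def min_def)
  have KM: "K * (real M)\<^sup>2 > 0" using pos by simp
  have Dpos: "D > 0" unfolding D_def using pos KM by (intro add_nonneg_pos add_nonneg_nonneg mult_nonneg_nonneg) auto
  \<comment> \<open>Factoring the mean K pi C / 4 out of the signal bound turns the deviation 2 sqrt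
    (K M) y into the relative error 8 / (C pi) * sqrt (M / K) * y.\<close>
  have root: "sqrt (real K * real M) = K * sqrt (M / K)"
    using pos by (simp add: real_sqrt_mult real_sqrt_divide field_simps)
  have SNu: "(C_SN \<sigma> Cu cu)\<^sup>2 > 0" and SNl: "(C_SN \<sigma> Cl cl)\<^sup>2 > 0"
    using pos by (auto simp: C_SN_def intro!: add_pos_nonneg)
  have nz: "C_SN \<sigma> Cu cu \<noteq> 0" "C_SN \<sigma> Cl cl \<noteq> 0" using SNu SNl by auto
  define u where "u = Cu\<^sup>2 + 4 * z + \<sigma>\<^sup>2 * (cu\<^sup>2 + 2 * q) + \<sigma>\<^sup>2"
  have u: "u > 0" using pos z q by (auto simp: u_def intro!: add_pos_nonneg)
  have Du: "D \<le> K * (real M)\<^sup>2 * u"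
  proof -
    have "\<sigma>\<^sup>2 * M * D2 \<le> \<sigma>\<^sup>2 * M * (K * real M * (cu\<^sup>2 + 2 * (y / sqrt K)))"
      using D2 pos by (intro mult_left_mono) auto
    then show ?thesis using D1 unfolding D_def u_def z_def[symmetric] q_def[symmetric]
      by (simp add: algebra_simps power2_eq_square)
  qed
  define l where "l = max 0 (Cl\<^sup>2 * ((real M - 1) / M) - 4 * z) + max 0 (\<sigma>\<^sup>2 * (cl\<^sup>2 - 2 * q)) + \<sigma>\<^sup>2"
  \<comment> \<open>The last noise term keeps the lower bound of the denominator positive even when
    both maxima vanish.\<close>
  have l: "l > 0" using pos by (auto simp: l_def intro!: add_nonneg_pos add_nonneg_nonneg)
  have Dl: "K * (real M)\<^sup>2 * l \<le> D"
  proof -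
    have 1: "K * (real M)\<^sup>2 * max 0 (Cl\<^sup>2 * ((real M - 1) / M) - 4 * z) \<le> D1"
      using D1(1) pos unfolding z_def[symmetric] by (auto simp: max_def)
    have *: "\<sigma>\<^sup>2 * M * (K * real M * (cl\<^sup>2 - 2 * q)) \<le> \<sigma>\<^sup>2 * M * D2"
      using D2(1) pos unfolding q_def[symmetric] by (intro mult_left_mono) auto
    have 2: "K * (real M)\<^sup>2 * max 0 (\<sigma>\<^sup>2 * (cl\<^sup>2 - 2 * q)) \<le> \<sigma>\<^sup>2 * M * D2"
    proof (cases "cl\<^sup>2 - 2 * q \<ge> 0")
      case True
      then have "max 0 (\<sigma>\<^sup>2 * (cl\<^sup>2 - 2 * q)) = \<sigma>\<^sup>2 * (cl\<^sup>2 - 2 * q)" by (simp add: max_def)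
      then show ?thesis using * by (simp add: power2_eq_square mult_ac)
    next
      case False
      then have "\<sigma>\<^sup>2 * (cl\<^sup>2 - 2 * q) \<le> 0" by (intro mult_nonneg_nonpos) auto
      then show ?thesis using pos by (simp add: max_def)
    qed
    show ?thesis unfolding D_def l_def distrib_left using 1 2 by simp
  qed
  define a where "a = max 0 (1 - 8 / (Cl * pi) * sqrt (M / K) * y)"
  have a: "(K * pi * Cl / 4 * a) \<le> s"
  proof -
    have "K * pi * Cl / 4 * (1 - 8 / (Cl * pi) * sqrt (M / K) * y) = K * pi * Cl / 4 - 2 * sqrt (real K * real M) * y"
      unfolding root using pos by (simp add: right_diff_distrib field_simps)
    then show ?thesis using s(1) pos by (auto simp: a_def max_def)
  qed
  define b where "b = 1 + 8 / (Cu * pi) * sqrt (M / K) * y"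
  have b: "s \<le> K * pi * Cu / 4 * b"
  proof -
    have "K * pi * Cu / 4 * b = K * pi * Cu / 4 + 2 * sqrt (real K * real M) * y"
      unfolding root b_def using pos by (simp add: distrib_left field_simps)
    then show ?thesis using s(2) by simp
  qed
  have "L_P2 \<sigma> K M Cl Cu cu y = pi\<^sup>2 / 16 * (Cl\<^sup>2 / (C_SN \<sigma> Cu cu)\<^sup>2) * (K / (real M)\<^sup>2) * (a\<^sup>2 / (u / (C_SN \<sigma> Cu cu)\<^sup>2))"
    unfolding L_P2_def a_def u_def z_def q_def by (simp add: add_divide_distrib)
  also have "\<dots> = (K * pi * Cl / 4 * a)\<^sup>2 / (K * (real M)\<^sup>2 * u)"
    using nz u pos by (simp add: field_simps power2_eq_square)
  also have "\<dots> \<le> s\<^sup>2 / D"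
    using a Du Dpos pos by (intro frac_le power_mono) (auto simp: a_def)
  finally have L: "L_P2 \<sigma> K M Cl Cu cu y \<le> s\<^sup>2 / D" .
  have mx: "max 0 (v / (C_SN \<sigma> Cl cl)\<^sup>2) = max 0 v / (C_SN \<sigma> Cl cl)\<^sup>2" for v
    using SNl by (auto simp: max_def divide_simps)
  have e1: "Cl\<^sup>2 / (C_SN \<sigma> Cl cl)\<^sup>2 * ((real M - 1) / M) - 4 / (C_SN \<sigma> Cl cl)\<^sup>2 * z = (Cl\<^sup>2 * ((real M - 1) / M) - 4 * z) / (C_SN \<sigma> Cl cl)\<^sup>2"
    and e2: "\<sigma>\<^sup>2 / (C_SN \<sigma> Cl cl)\<^sup>2 * (cl\<^sup>2 - 2 * q) = (\<sigma>\<^sup>2 * (cl\<^sup>2 - 2 * q)) / (C_SN \<sigma> Cl cl)\<^sup>2"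
    by (simp_all add: diff_divide_distrib)
  have "s\<^sup>2 / D \<le> (K * pi * Cu / 4 * b)\<^sup>2 / (K * (real M)\<^sup>2 * l)"
    using b Dl KM l pos by (intro frac_le power_mono) auto
  also have "\<dots> = pi\<^sup>2 / 16 * (Cu\<^sup>2 / (C_SN \<sigma> Cl cl)\<^sup>2) * (K / (real M)\<^sup>2) * (b\<^sup>2 / (l / (C_SN \<sigma> Cl cl)\<^sup>2))"
    using nz l pos by (simp add: field_simps power2_eq_square)
  also have "\<dots> = U_P2 \<sigma> K M Cl Cu cl y"
    unfolding U_P2_def z_def[symmetric] q_def[symmetric] b_def[symmetric] e1 e2 mx l_def add_divide_distrib by simp
  finally show ?thesis using L unfolding D_def[symmetric] by simp
qed

text \<open>Here t^(9/2) equals \<Delta>^(9/2) x. One factor \<Delta> pays for the coefficient,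
  leaving at most 1/4; the remaining \<Delta>^(7/2) is at most (1/4)^3 * (1/2), as \<Delta> <= 1/4.
  The product is 1/512.\<close>

lemma Delta_bounds:
  fixes C c x :: real
  assumes "C > 0" "c > 0" "x \<ge> 1"
  defines "t \<equiv> Delta_P2 C c * x powr (2 / 9)"
  shows "t > 0" "t ^ 4 * sqrt t \<le> x / 512" "C * (t ^ 4 * sqrt t) \<le> x / 512"
    "C\<^sup>2 * (t ^ 4 * sqrt t) \<le> x / 512" "c\<^sup>2 * (t ^ 4 * sqrt t) \<le> x / 512"
proof -
  define \<Delta> where "\<Delta> = Delta_P2 C c"
  have D: "\<Delta> \<le> 2 powr (- 11 / 5)" "\<Delta> \<le> 1 / (8 * C ^ 4)" "\<Delta> \<le> 1 / (4 * c ^ 4)" "\<Delta> > 0"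
    using assms by (auto simp: \<Delta>_def Delta_P2_def)
  have "\<Delta> \<le> 2 powr (- 2)" by (rule order.trans[OF D(1) powr_mono]) auto
  then have D4: "\<Delta> \<le> 1 / 4" by (simp add: powr_minus_divide)
  \<comment> \<open>The fourth powers in \<open>Delta_P2\<close> control C^4 \<Delta>; another
    \<Delta> <= 1/4 makes this a bound on the square of C^2 \<Delta>, and likewise for c.\<close>
  have "C ^ 4 * \<Delta> \<le> 1 / 8" "c ^ 4 * \<Delta> \<le> 1 / 4" using D assms by (simp_all add: field_simps)
  then have "C ^ 4 * \<Delta> * \<Delta> \<le> 1 / 8 * (1 / 4)" "c ^ 4 * \<Delta> * \<Delta> \<le> 1 / 4 * (1 / 4)"
    using D4 D(4) by (intro mult_mono; simp)+
  then have "(C\<^sup>2 * \<Delta>)\<^sup>2 \<le> (1 / 4)\<^sup>2" "(c\<^sup>2 * \<Delta>)\<^sup>2 \<le> (1 / 4)\<^sup>2"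
    by (simp_all add: power2_eq_square power4_eq_xxxx mult_ac)
  then have C: "C\<^sup>2 * \<Delta> \<le> 1 / 4" and c: "c\<^sup>2 * \<Delta> \<le> 1 / 4" by (auto dest: power2_le_imp_le)
  have "\<Delta> ^ 3 \<le> (1 / 4) ^ 3" "sqrt \<Delta> \<le> sqrt ((1 / 2)\<^sup>2)"
    using D4 D(4) by (intro power_mono real_sqrt_le_mono; simp add: power2_eq_square)+
  then have D3: "\<Delta> ^ 3 * sqrt \<Delta> \<le> (1 / 4) ^ 3 * (1 / 2)"
    using D(4) by (intro mult_mono) auto
  have "sqrt (x powr (2 / 9)) = x powr (1 / 9)" "(x powr (2 / 9)) ^ 4 = x powr (8 / 9)"
    using assms by (simp_all add: powr_half_sqrt[symmetric] powr_powr powr_realpow[symmetric])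
  then have xx: "(x powr (2 / 9)) ^ 4 * sqrt (x powr (2 / 9)) = x"
    using assms by (simp flip: powr_add)
  have "t ^ 4 * sqrt t = \<Delta> ^ 4 * sqrt \<Delta> * ((x powr (2 / 9)) ^ 4 * sqrt (x powr (2 / 9)))"
    by (simp add: t_def \<Delta>_def power_mult_distrib real_sqrt_mult mult_ac)
  then have tau: "t ^ 4 * sqrt t = \<Delta> * (\<Delta> ^ 3 * sqrt \<Delta>) * x"
    unfolding xx by (simp add: power4_eq_xxxx power3_eq_cube mult_ac)
  have gen: "g * (t ^ 4 * sqrt t) \<le> x / 512" if "0 \<le> g" "g * \<Delta> \<le> 1 / 4" for g
  proof -
    have "(g * \<Delta>) * (\<Delta> ^ 3 * sqrt \<Delta>) \<le> 1 / 4 * ((1 / 4) ^ 3 * (1 / 2))"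
      by (rule mult_mono[OF that(2) D3]) (use D(4) in auto)
    then have "(g * \<Delta>) * (\<Delta> ^ 3 * sqrt \<Delta>) * x \<le> 1 / 4 * ((1 / 4) ^ 3 * (1 / 2)) * x"
      using assms by (intro mult_right_mono) auto
    then show ?thesis unfolding tau by (simp add: mult_ac power3_eq_cube)
  qed
  show "t > 0" using D(4) assms by (simp add: t_def \<Delta>_def)
  show "C\<^sup>2 * (t ^ 4 * sqrt t) \<le> x / 512" "c\<^sup>2 * (t ^ 4 * sqrt t) \<le> x / 512" "t ^ 4 * sqrt t \<le> x / 512"
    using gen[of "C\<^sup>2"] gen[of "c\<^sup>2"] gen[of 1] C c D4 by auto
  \<comment> \<open>The linear coefficient C is reduced to the two settled cases 1 and C^2 by C <=
    (1 + C^2) / 2.\<close>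
  have "0 \<le> (C - 1)\<^sup>2" by simp
  then have "C \<le> (1 + C\<^sup>2) / 2" unfolding power2_diff by simp
  then have "C * \<Delta> \<le> (1 + C\<^sup>2) / 2 * \<Delta>" using D(4) by (intro mult_right_mono) auto
  also have "\<dots> \<le> 1 / 4" using C D4 by (simp add: field_simps)
  finally show "C * (t ^ 4 * sqrt t) \<le> x / 512" using assms by (intro gen) auto
qed

text \<open>The factor sqrt (K M) cancels the growth of the normalisation: what remains is sqrt
  (Prel / (S + \<sigma>^2)) with S the mean energy at relay k, which lies between the energy
  bounds.\<close>

lemma P2_coefficient_bounds:
  fixes E P :: "nat \<Rightarrow> nat \<Rightarrow> real"
  assumes pos: "0 < El" "0 < Pl" "Prel > 0" "\<sigma>\<^sup>2 > 0" "K > 0" "M > 0"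
    and E: "\<And>m. m \<in> {1..M} \<Longrightarrow> El \<le> E k m \<and> E k m \<le> Eu"
    and P: "Pl \<le> P m k" "P m k \<le> Pu" and n: "n \<in> {1..M}"
  shows "CS_P2 Prel \<sigma> K M E P m n k \<in> {C_const Prel \<sigma> Pl El Eu .. C_const Prel \<sigma> Pu Eu El}"
    and "CN_P2 Prel \<sigma> K M E P m k \<in> {c_const Prel \<sigma> Pl Eu .. c_const Prel \<sigma> Pu El}"
proof -
  define S where "S = (\<Sum>m=1..M. E k m) / M"
  have "(\<Sum>m=1..M. El) \<le> (\<Sum>m=1..M. E k m)" "(\<Sum>m=1..M. E k m) \<le> (\<Sum>m=1..M. Eu)"
    using E by (intro sum_mono; simp)+
  then have S: "El \<le> S" "S \<le> Eu" using pos by (simp_all add: S_def field_simps)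
  have En: "El \<le> E k n" "E k n \<le> Eu" using E[OF n] by auto
  have p: "K * M > (0::real)" "S + \<sigma>\<^sup>2 > 0" "El + \<sigma>\<^sup>2 > 0" using pos(1,4-6) S(1) by (simp, linarith+)
  have "K * (\<Sum>m=1..M. E k m) + M * K * \<sigma>\<^sup>2 = K * M * (S + \<sigma>\<^sup>2)"
    using pos by (simp add: S_def field_simps)
  then have "d_P2 Prel \<sigma> K M E k = sqrt Prel * (1 / sqrt (K * M * (S + \<sigma>\<^sup>2)))"
    unfolding d_P2_def using p by (simp add: powr_minus_divide powr_half_sqrt)
  then have d: "sqrt (real K * real M) * d_P2 Prel \<sigma> K M E k = sqrt (Prel / (S + \<sigma>\<^sup>2))"
    using p pos by (simp add: real_sqrt_mult real_sqrt_divide)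
  have CS: "CS_P2 Prel \<sigma> K M E P m n k = sqrt (P m k * E k n * Prel / (S + \<sigma>\<^sup>2))"
    unfolding CS_P2_def d by (simp add: mult_ac flip: real_sqrt_mult)
  have CN: "CN_P2 Prel \<sigma> K M E P m k = sqrt (P m k * Prel / (S + \<sigma>\<^sup>2))"
    unfolding CN_P2_def d by (simp add: mult_ac flip: real_sqrt_mult)
  show "CS_P2 Prel \<sigma> K M E P m n k \<in> {C_const Prel \<sigma> Pl El Eu .. C_const Prel \<sigma> Pu Eu El}"
    unfolding CS C_const_def atLeastAtMost_iff using pos P S En p
    by (intro conjI real_sqrt_le_mono frac_le mult_right_mono mult_mono) auto
  show "CN_P2 Prel \<sigma> K M E P m k \<in> {c_const Prel \<sigma> Pl Eu .. c_const Prel \<sigma> Pu El}"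
    unfolding CN c_const_def atLeastAtMost_iff using pos P S p
    by (intro conjI real_sqrt_le_mono frac_le mult_right_mono) auto
qed

section \<open>From the gains to the SINR\<close>

lemma abs_bounds:
  fixes T N d l u :: real
  assumes "\<bar>T - N\<bar> \<le> d" "l \<le> N" "N \<le> u"
  shows "l - d \<le> T" "T \<le> u + d"
  using assms by linarith+

lemma phase_eq_sgn: "z \<noteq> 0 \<Longrightarrow> phase z = sgn z"
  by (simp add: phase_def cis_Arg)

text \<open>The transfer to the canonical model: the tuple of given gains has the product law, so
  probabilities of events in the gains may be computed in \<open>gains K M\<close>.\<close>

lemma (in channel) distr_gains:
  fixes hh ff :: "nat \<Rightarrow> nat \<Rightarrow> 'a \<Rightarrow> complex"
  assumes "prob_space \<Omega>"
    and h: "\<And>k m. k \<in> {1..K} \<Longrightarrow> m \<in> {1..M} \<Longrightarrow> circ_complex_normal \<Omega> 1 (hh k m)"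
    and f: "\<And>k m. k \<in> {1..K} \<Longrightarrow> m \<in> {1..M} \<Longrightarrow> circ_complex_normal \<Omega> 1 (ff m k)"
    and ind: "prob_space.indep_vars \<Omega> (\<lambda>_. borel) (case_sum (\<lambda>(k, m). hh k m) (\<lambda>(m, k). ff m k)) (links K M)"
  defines "X \<equiv> \<lambda>\<omega>. \<lambda>i\<in>links K M. case_sum (\<lambda>(k, m). hh k m) (\<lambda>(m, k). ff m k) i \<omega>"
  shows "X \<in> measurable \<Omega> (gains K M)" and "distr \<Omega> (gains K M) X = gains K M"
proof -
  interpret \<Omega>: prob_space \<Omega> by fact
  let ?g = "case_sum (\<lambda>(k, m). hh k m) (\<lambda>(m, k). ff m k)"
  have rv: "?g i \<in> borel_measurable \<Omega>" if "i \<in> links K M" for i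
    using ind that unfolding \<Omega>.indep_vars_def by blast
  have "X \<in> measurable \<Omega> (PiM (links K M) (\<lambda>_. borel))"
    unfolding X_def by (rule measurable_restrict) (rule rv)
  then show "X \<in> measurable \<Omega> (gains K M)" by (simp add: measurable_cong_sets[OF refl sets_gains])
  have "distr \<Omega> (gains K M) X = distr \<Omega> (PiM (links K M) (\<lambda>_. borel)) X"
    by (intro distr_cong) (auto simp: sets_gains)
  also have "\<dots> = PiM (links K M) (\<lambda>i. distr \<Omega> borel (?g i))"
    using ind unfolding X_def by (subst (asm) \<Omega>.indep_vars_iff_distr_eq_PiM'[OF links_nonempty rv])
  also have "\<dots> = gains K M" unfolding gains_def
  proof (intro PiM_cong refl)
    fix i assume i: "i \<in> links K M"
    have "circ_complex_normal \<Omega> 1 (?g i)"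
      using i h f by (auto simp: links_def)
    then show "distr \<Omega> borel (?g i) = cgauss"
      by (rule distr_circ_complex_normal[OF assms(1) _ rv[OF i]])
  qed
  finally show "distr \<Omega> (gains K M) X = gains K M" .
qed

text \<open>Only the two conjugated phases depend on the third index, so summing over it produces
  \<open>G k\<close>. Nonzero gains are required to replace \<open>phase\<close> by
  \<open>sgn\<close>.\<close>

lemma (in channel) P2_sums:
  assumes nz: "\<And>i. i \<in> links K M \<Longrightarrow> x i \<noteq> 0" and k: "k \<in> {1..K}"
  shows "(\<Sum>mtil=1..M. a_P2 Prel \<sigma> K M E P (\<lambda>k m. x (Inl (k, m))) (\<lambda>m k. x (Inr (m, k))) m n mtil k)
      = of_real (CS_P2 Prel \<sigma> K M E P m n k) * (f m k x * h k n x * G k x)"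
    and "(\<Sum>mtil=1..M. b_P2 Prel \<sigma> K M E P (\<lambda>k m. x (Inl (k, m))) (\<lambda>m k. x (Inr (m, k))) m mtil k)
      = of_real (CN_P2 Prel \<sigma> K M E P m k) * (f m k x * G k x)"
proof -
  have p: "phase (x (Inr (m', k))) = sgn (x (Inr (m', k)))" "phase (x (Inl (k, m'))) = sgn (x (Inl (k, m')))"
    if "m' \<in> {1..M}" for m'
    using that k by (auto intro!: phase_eq_sgn nz)
  show "(\<Sum>mtil=1..M. a_P2 Prel \<sigma> K M E P (\<lambda>k m. x (Inl (k, m))) (\<lambda>m k. x (Inr (m, k))) m n mtil k)
      = of_real (CS_P2 Prel \<sigma> K M E P m n k) * (f m k x * h k n x * G k x)"
    unfolding G_def sum_distrib_left
    by (intro sum.cong refl) (simp only: a_P2_def p, simp only: mult_ac)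
  show "(\<Sum>mtil=1..M. b_P2 Prel \<sigma> K M E P (\<lambda>k m. x (Inl (k, m))) (\<lambda>m k. x (Inr (m, k))) m mtil k)
      = of_real (CN_P2 Prel \<sigma> K M E P m k) * (f m k x * G k x)"
    unfolding G_def sum_distrib_left
    by (intro sum.cong refl) (simp only: b_P2_def p, simp only: mult_ac)
qed

text \<open>The tuple of gains agrees with the given families only on the index ranges, so the SINR
  has to be shown insensitive to other indices.\<close>

lemma SINR_P2_cong:
  assumes "\<And>k n. k \<in> {1..K} \<Longrightarrow> n \<in> {1..M} \<Longrightarrow> h k n = h' k n \<and> f n k = f' n k" "m \<in> {1..M}"
  shows "SINR_P2 Prel \<sigma> K M E P h f m = SINR_P2 Prel \<sigma> K M E P h' f' m"
proof -
  have "a_P2 Prel \<sigma> K M E P h f m n j k = a_P2 Prel \<sigma> K M E P h' f' m n j k"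
    "b_P2 Prel \<sigma> K M E P h f m j k = b_P2 Prel \<sigma> K M E P h' f' m j k"
    if "k \<in> {1..K}" "n \<in> {1..M}" "j \<in> {1..M}" for k n j
    using that assms by (simp_all add: a_P2_def b_P2_def)
  then show ?thesis using assms(2) unfolding SINR_P2_def by simp
qed

theorem theorem2:
  fixes \<Omega> :: "'a measure"
    and El Eu Pl Pu Prel \<sigma> x :: real
    and K M m :: nat
    and E P :: "nat \<Rightarrow> nat \<Rightarrow> real"
    and h f :: "nat \<Rightarrow> nat \<Rightarrow> 'a \<Rightarrow> complex"
  defines "Cl \<equiv> C_const Prel \<sigma> Pl El Eu"
    and "Cu \<equiv> C_const Prel \<sigma> Pu Eu El"
    and "cl \<equiv> c_const Prel \<sigma> Pl Eu"
    and "cu \<equiv> c_const Prel \<sigma> Pu El"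
  assumes "prob_space \<Omega>"
    and "0 < El" "El \<le> Eu" "0 < Pl" "Pl \<le> Pu" "Prel > 0" "\<sigma>\<^sup>2 > 0"
    and "K \<ge> 2" "M \<ge> 2" "x \<ge> 1"
    and "\<And>k m. k \<in> {1..K} \<Longrightarrow> m \<in> {1..M} \<Longrightarrow> E k m \<in> {El..Eu}"
    and "\<And>k m. k \<in> {1..K} \<Longrightarrow> m \<in> {1..M} \<Longrightarrow> P m k \<in> {Pl..Pu}"
    and "\<And>k m. k \<in> {1..K} \<Longrightarrow> m \<in> {1..M} \<Longrightarrow> circ_complex_normal \<Omega> 1 (h k m)"
    and "\<And>k m. k \<in> {1..K} \<Longrightarrow> m \<in> {1..M} \<Longrightarrow> circ_complex_normal \<Omega> 1 (f m k)"
    and "prob_space.indep_vars \<Omega> (\<lambda>_. borel)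
           (case_sum (\<lambda>(k, m). h k m) (\<lambda>(m, k). f m k))
           (({1..K} \<times> {1..M}) <+> ({1..M} \<times> {1..K}))"
    and "m \<in> {1..M}"
  shows "measure \<Omega> {\<omega> \<in> space \<Omega>.
            SINR_P2 Prel \<sigma> K M E P (\<lambda>k m. h k m \<omega>) (\<lambda>m k. f m k \<omega>) m
              \<notin> {L_P2 \<sigma> K M Cl Cu cu x .. U_P2 \<sigma> K M Cl Cu cl x}}
         \<le> 814 * (real K)\<^sup>2 * (real M)^3 * exp (- Delta_P2 Cu cu * x powr (2 / 9))"
proof -
  note pos = assms(6-11) and K2 = assms(12) and M2 = assms(13) and x1 = assms(14)
    and E = assms(15) and P = assms(16) and m = assms(20)
  interpret \<Omega>: prob_space \<Omega> by fact
  interpret ch: channel K M by unfold_locales (use K2 M2 in auto)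
  define t where "t = Delta_P2 Cu cu * x powr (2 / 9)"
  let ?p = "814 * (real K)\<^sup>2 * (real M) ^ 3 * exp (- t)"
  let ?bad = "{\<omega> \<in> space \<Omega>. SINR_P2 Prel \<sigma> K M E P (\<lambda>k m. h k m \<omega>) (\<lambda>m k. f m k \<omega>) m
              \<notin> {L_P2 \<sigma> K M Cl Cu cu x .. U_P2 \<sigma> K M Cl Cu cl x}}"
  have EuPu: "0 < Eu" "0 < Pu" using pos by auto
  have c_pos: "Cl > 0" "Cu > 0" "cl > 0" "cu > 0"
    unfolding Cl_def Cu_def cl_def cu_def C_const_def c_const_def using pos EuPu
    by (auto intro!: divide_pos_pos add_pos_pos)
  have "measure \<Omega> ?bad \<le> ?p"
  \<comment> \<open>If the bound exceeds one, it holds for any probability. In the other case it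
    supplies the assumption \<open>small\<close> of \<open>concentration\<close>.\<close>
  proof (cases "?p \<le> 1")
    case False
    then show ?thesis using \<Omega>.prob_le_1[of ?bad] by linarith
  next
    case small: True
    note \<Delta> = Delta_bounds[OF c_pos(2,4) x1, folded t_def]
    have KM1: "1 \<le> (real K)\<^sup>2 * real M ^ 3"
      using mult_mono[of 1 "(real K)\<^sup>2" 1 "real M ^ 3"] K2 M2 by (simp add: one_le_power)
    \<comment> \<open>Otherwise exp (- t) > exp (- 1) > 1 / 814, and as K^2 M^3 >= 1 the bound would
      exceed one.\<close>
    have t1: "t \<ge> 1"
    proof (rule ccontr)
      assume "\<not> 1 \<le> t"
      then have "exp (- 1) \<le> exp (- t)" by simp
      moreover have "1 / 814 < exp (- 1 :: real)"
        using exp_le by (simp add: exp_minus field_simps)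
      ultimately have "814 * 1 * exp (- t) > 1" by linarith
      moreover have "814 * 1 * exp (- t) \<le> ?p"
        using KM1 by (simp add: mult.assoc[symmetric])
      ultimately show False using small by linarith
    qed
    define c where "c = (\<lambda>k n. CS_P2 Prel \<sigma> K M E P m n k)"
    define w where "w = (\<lambda>k. (CN_P2 Prel \<sigma> K M E P m k)\<^sup>2)"
    have c: "Cl \<le> c k n" "c k n \<le> Cu" if "k \<in> {1..K}" "n \<in> {1..M}" for k n
      using P2_coefficient_bounds(1)[of El Pl Prel \<sigma> K M E k Eu P m Pu n] pos K2 M2 E[OF that(1)] P[OF that(1) m] that(2)
      by (auto simp: c_def Cl_def Cu_def)
    have w: "cl\<^sup>2 \<le> w k" "w k \<le> cu\<^sup>2" if "k \<in> {1..K}" for k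
    proof -
      have "cl \<le> CN_P2 Prel \<sigma> K M E P m k" "CN_P2 Prel \<sigma> K M E P m k \<le> cu"
        using P2_coefficient_bounds(2)[of El Pl Prel \<sigma> K M E k Eu P m Pu m] pos K2 M2 E[OF that] P[OF that m] m
        by (auto simp: cl_def cu_def)
      then show "cl\<^sup>2 \<le> w k" "w k \<le> cu\<^sup>2" using c_pos by (auto simp: w_def intro!: power_mono)
    qed
    have w0: "0 \<le> w k" for k by (simp add: w_def)
    have c0: "0 \<le> c k n \<and> c k n \<le> Cu" if "k \<in> {1..K}" "n \<in> {1..M}" for k n
      using c[OF that] c_pos(1) by linarith
    have w0': "0 \<le> w k \<and> w k \<le> cu\<^sup>2" if "k \<in> {1..K}" for k using w[OF that] w0 by auto
    have cu2: "cu\<^sup>2 > 0" using c_pos by simp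
    obtain Bad where Bad: "Bad \<in> ch.events" "ch.prob Bad \<le> ?p"
      and S: "\<And>z. z \<in> space (gains K M) \<Longrightarrow> z \<notin> Bad \<Longrightarrow>
        cmod ((\<Sum>k\<in>{1..K}. of_real (c k m) * (z (Inr (m, k)) * z (Inl (k, m)) * ch.G k z)) - of_real (pi / 4 * (\<Sum>k\<in>{1..K}. c k m))) \<le> 2 * sqrt (real K * real M) * x"
      and D1: "\<And>z. z \<in> space (gains K M) \<Longrightarrow> z \<notin> Bad \<Longrightarrow>
      \<bar>(\<Sum>n\<in>{1..M} - {m}. (cmod (\<Sum>k\<in>{1..K}. of_real (c k n) * (z (Inr (m, k)) * z (Inl (k, n)) * ch.G k z)))\<^sup>2) - M * (\<Sum>k\<in>{1..K}. \<Sum>n\<in>{1..M} - {m}. (c k n)\<^sup>2)\<bar>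
        \<le> K * (real M)\<^sup>2 * (4 * (x / min (sqrt M) (sqrt K)))"
      and D2: "\<And>z. z \<in> space (gains K M) \<Longrightarrow> z \<notin> Bad \<Longrightarrow>
      \<bar>(\<Sum>k\<in>{1..K}. w k * (cmod (z (Inr (m, k))))\<^sup>2 * (cmod (ch.G k z))\<^sup>2) - M * (\<Sum>k\<in>{1..K}. w k)\<bar>
        \<le> K * real M * (2 * (x / sqrt K))"
      by (rule ch.concentration[where m=m and c=c and w=w and C=Cu and W="cu\<^sup>2" and t=t and y=x,
            OF m c0 c_pos(2) w0' cu2 t1 small \<Delta>(2,3,4,5)]) (assumption+, rule that, assumption+)
    let ?g = "case_sum (\<lambda>(k, m). h k m) (\<lambda>(m, k). f m k)"
    define X where "X = (\<lambda>\<omega>. \<lambda>i\<in>links K M. ?g i \<omega>)"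
    have X: "X \<in> measurable \<Omega> (gains K M)" "distr \<Omega> (gains K M) X = gains K M"
      unfolding X_def
      by (rule ch.distr_gains[OF assms(5) _ _ assms(19)[folded links_def]]; rule assms(17,18); assumption)+
    have "AE z in distr \<Omega> (gains K M) X. \<forall>i\<in>links K M. z i \<noteq> 0"
      unfolding X(2) by (rule ch.AE_nonzero)
    then have nz: "AE \<omega> in \<Omega>. \<forall>i\<in>links K M. X \<omega> i \<noteq> 0" by (rule AE_distrD[OF X(1)])
    have good: "SINR_P2 Prel \<sigma> K M E P (\<lambda>k m. h k m \<omega>) (\<lambda>m k. f m k \<omega>) m
        \<in> {L_P2 \<sigma> K M Cl Cu cu x .. U_P2 \<sigma> K M Cl Cu cl x}"
      if \<omega>: "\<omega> \<in> space \<Omega>" "X \<omega> \<notin> Bad" and nz: "\<forall>i\<in>links K M. X \<omega> i \<noteq> 0" for \<omega>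
    proof -
      define z where "z = X \<omega>"
      have z: "z \<in> space (gains K M)" "z \<notin> Bad" using \<omega> measurable_space[OF X(1)] by (auto simp: z_def)
      have nz': "\<And>i. i \<in> links K M \<Longrightarrow> z i \<noteq> 0" using nz by (simp add: z_def)
      define A where "A = (\<lambda>n. \<Sum>k\<in>{1..K}. of_real (c k n) * (z (Inr (m, k)) * z (Inl (k, n)) * ch.G k z))"
      let ?D1 = "\<Sum>n\<in>{1..M} - {m}. (cmod (A n))\<^sup>2"
      let ?D2 = "\<Sum>k\<in>{1..K}. w k * (cmod (z (Inr (m, k))))\<^sup>2 * (cmod (ch.G k z))\<^sup>2"
      have "SINR_P2 Prel \<sigma> K M E P (\<lambda>k m. h k m \<omega>) (\<lambda>m k. f m k \<omega>) m
          = SINR_P2 Prel \<sigma> K M E P (\<lambda>k m. z (Inl (k, m))) (\<lambda>m k. z (Inr (m, k))) m"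
        by (rule SINR_P2_cong) (use m in \<open>auto simp: z_def X_def\<close>)
      also have "\<dots> = (cmod (A m))\<^sup>2 / (?D1 + \<sigma>\<^sup>2 * M * ?D2 + K * (real M)\<^sup>2 * \<sigma>\<^sup>2)"
      proof -
        have a: "(\<Sum>k=1..K. \<Sum>mtil=1..M. a_P2 Prel \<sigma> K M E P (\<lambda>k m. z (Inl (k, m))) (\<lambda>m k. z (Inr (m, k))) m n mtil k) = A n" for n
          unfolding A_def c_def by (intro sum.cong refl ch.P2_sums(1)[OF nz'])
        have b: "(\<Sum>k=1..K. (cmod (\<Sum>mtil=1..M. b_P2 Prel \<sigma> K M E P (\<lambda>k m. z (Inl (k, m))) (\<lambda>m k. z (Inr (m, k))) m mtil k))\<^sup>2) = ?D2"
        proof (intro sum.cong refl)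
          fix k assume k: "k \<in> {1..K}"
          have e: "(\<Sum>mtil=1..M. b_P2 Prel \<sigma> K M E P (\<lambda>k m. z (Inl (k, m))) (\<lambda>m k. z (Inr (m, k))) m mtil k)
              = of_real (CN_P2 Prel \<sigma> K M E P m k) * (z (Inr (m, k)) * ch.G k z)"
            by (rule ch.P2_sums(2)[OF _ k]) (rule nz')
          show "(cmod (\<Sum>mtil=1..M. b_P2 Prel \<sigma> K M E P (\<lambda>k m. z (Inl (k, m))) (\<lambda>m k. z (Inr (m, k))) m mtil k))\<^sup>2
              = w k * (cmod (z (Inr (m, k))))\<^sup>2 * (cmod (ch.G k z))\<^sup>2"
            unfolding e w_def norm_mult norm_of_real power_mult_distrib power2_abs by simp
        qed
        show ?thesis unfolding SINR_P2_def a b ..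
      qed
      also have "\<dots> \<in> {L_P2 \<sigma> K M Cl Cu cu x .. U_P2 \<sigma> K M Cl Cu cl x}"
      proof (rule SINR_sandwich)
        \<comment> \<open>The mean of the signal is a nonnegative real number, hence its own
          modulus, and the reverse triangle inequality passes from the complex deviation to the
          modulus.\<close>
        have S': "\<bar>cmod (A m) - pi / 4 * (\<Sum>k\<in>{1..K}. c k m)\<bar> \<le> 2 * sqrt (real K * real M) * x"
        proof -
          have c0: "0 \<le> pi / 4 * (\<Sum>k\<in>{1..K}. c k m)"
            using c(1)[OF _ m] c_pos(1) by (intro mult_nonneg_nonneg sum_nonneg) (auto intro: order.trans[of 0 Cl])
          have "\<bar>cmod (A m) - cmod (of_real (pi / 4 * (\<Sum>k\<in>{1..K}. c k m)))\<bar> \<le> cmod (A m - of_real (pi / 4 * (\<Sum>k\<in>{1..K}. c k m)))"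
            by (rule norm_triangle_ineq3)
          also have "\<dots> \<le> 2 * sqrt (real K * real M) * x" using S[OF z] by (simp only: A_def)
          finally show ?thesis unfolding norm_of_real abs_of_nonneg[OF c0] .
        qed
        have "(\<Sum>k\<in>{1..K}. Cl) \<le> (\<Sum>k\<in>{1..K}. c k m)" "(\<Sum>k\<in>{1..K}. c k m) \<le> (\<Sum>k\<in>{1..K}. Cu)"
          using c[OF _ m] by (intro sum_mono; simp)+
        then have "pi / 4 * (K * Cl) \<le> pi / 4 * (\<Sum>k\<in>{1..K}. c k m)" "pi / 4 * (\<Sum>k\<in>{1..K}. c k m) \<le> pi / 4 * (K * Cu)"
          by (intro mult_left_mono; simp)+
        moreover have "K * pi * Cl / 4 = pi / 4 * (K * Cl)" "K * pi * Cu / 4 = pi / 4 * (K * Cu)" by simp_all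
        ultimately have "K * pi * Cl / 4 \<le> pi / 4 * (\<Sum>k\<in>{1..K}. c k m)"
          "pi / 4 * (\<Sum>k\<in>{1..K}. c k m) \<le> K * pi * Cu / 4" by (simp_all only:)
        from abs_bounds[OF S' this]
        show "K * pi * Cl / 4 - 2 * sqrt (real K * real M) * x \<le> cmod (A m)"
          "cmod (A m) \<le> K * pi * Cu / 4 + 2 * sqrt (real K * real M) * x" .
        \<comment> \<open>The M - 1 interfering sources cause the factor (M - 1) / M in
          \<open>U_P2\<close>; for \<open>L_P2\<close> the count is relaxed to M.\<close>
        have card: "real (card ({1..M} - {m})) = real M - 1" using m by (simp add: of_nat_diff)
        have "(\<Sum>k\<in>{1..K}. \<Sum>n\<in>{1..M} - {m}. Cl\<^sup>2) \<le> (\<Sum>k\<in>{1..K}. \<Sum>n\<in>{1..M} - {m}. (c k n)\<^sup>2)"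
          "(\<Sum>k\<in>{1..K}. \<Sum>n\<in>{1..M} - {m}. (c k n)\<^sup>2) \<le> (\<Sum>k\<in>{1..K}. \<Sum>n\<in>{1..M} - {m}. Cu\<^sup>2)"
          using c c_pos by (intro sum_mono power_mono; auto intro: order.trans[OF less_imp_le])+
        then have 1: "M * (K * ((real M - 1) * Cl\<^sup>2)) \<le> M * (\<Sum>k\<in>{1..K}. \<Sum>n\<in>{1..M} - {m}. (c k n)\<^sup>2)"
          and 2: "M * (\<Sum>k\<in>{1..K}. \<Sum>n\<in>{1..M} - {m}. (c k n)\<^sup>2) \<le> M * (K * ((real M - 1) * Cu\<^sup>2))"
          unfolding sum_constant card by (intro mult_left_mono; simp)+
        have 3: "M * (K * ((real M - 1) * Cl\<^sup>2)) = K * (real M)\<^sup>2 * (Cl\<^sup>2 * ((real M - 1) / M))"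
          using M2 by (simp add: field_simps power2_eq_square)
        have 4: "M * (K * ((real M - 1) * Cu\<^sup>2)) \<le> K * (real M)\<^sup>2 * Cu\<^sup>2"
        proof -
          have "M * (K * ((real M - 1) * Cu\<^sup>2)) \<le> M * (K * (real M * Cu\<^sup>2))"
            by (intro mult_left_mono mult_right_mono) auto
          then show ?thesis by (simp add: power2_eq_square mult_ac)
        qed
        have "\<bar>?D1 - M * (\<Sum>k\<in>{1..K}. \<Sum>n\<in>{1..M} - {m}. (c k n)\<^sup>2)\<bar>
            \<le> K * (real M)\<^sup>2 * (4 * (x / min (sqrt M) (sqrt K)))"
          using D1[OF z] by (simp only: A_def)
        from bounds_of_deviation[OF this 1[unfolded 3] order.trans[OF 2 4]]
        show "K * (real M)\<^sup>2 * (Cl\<^sup>2 * ((real M - 1) / M) - 4 * (x / min (sqrt M) (sqrt K))) \<le> ?D1"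
            "?D1 \<le> K * (real M)\<^sup>2 * (Cu\<^sup>2 + 4 * (x / min (sqrt M) (sqrt K)))" .
        have "(\<Sum>k\<in>{1..K}. cl\<^sup>2) \<le> (\<Sum>k\<in>{1..K}. w k)" "(\<Sum>k\<in>{1..K}. w k) \<le> (\<Sum>k\<in>{1..K}. cu\<^sup>2)"
          by (intro sum_mono w; assumption)+
        then have "M * (K * cl\<^sup>2) \<le> M * (\<Sum>k\<in>{1..K}. w k)" "M * (\<Sum>k\<in>{1..K}. w k) \<le> M * (K * cu\<^sup>2)"
          by (intro mult_left_mono; simp)+
        moreover have "M * (K * g) = K * real M * g" for g :: real by simp
        ultimately have "K * real M * cl\<^sup>2 \<le> M * (\<Sum>k\<in>{1..K}. w k)" "M * (\<Sum>k\<in>{1..K}. w k) \<le> K * real M * cu\<^sup>2"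
          by (simp_all only:)
        from bounds_of_deviation[OF D2[OF z] this]
        show "K * real M * (cl\<^sup>2 - 2 * (x / sqrt K)) \<le> ?D2" "?D2 \<le> K * real M * (cu\<^sup>2 + 2 * (x / sqrt K))" .
        show "?D1 \<ge> 0" "?D2 \<ge> 0" by (auto intro!: sum_nonneg mult_nonneg_nonneg w0)
      qed (use c_pos pos K2 M2 x1 in auto)
      finally show ?thesis .
    qed
    \<comment> \<open>Up to the null set where some gain vanishes, an outcome with SINR outside the
      interval lies in the preimage of \<open>Bad\<close>, whose probability is given by the law of
      X.\<close>
    have "measure \<Omega> ?bad \<le> measure \<Omega> (X -` Bad \<inter> space \<Omega>)"
    proof (rule \<Omega>.finite_measure_mono_AE)
      show "AE \<omega> in \<Omega>. \<omega> \<in> ?bad \<longrightarrow> \<omega> \<in> X -` Bad \<inter> space \<Omega>"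
        using nz by eventually_elim (use good in blast)
      show "X -` Bad \<inter> space \<Omega> \<in> sets \<Omega>" using X(1) Bad(1) by (rule measurable_sets)
    qed
    also have "\<dots> = ch.prob Bad"
      using measure_distr[OF X(1) Bad(1)] unfolding X(2) by simp
    finally show ?thesis using Bad(2) by linarith
  qed
  then show ?thesis by (simp add: t_def)
qed

end
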